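(* Let $$X=[0,\infty)\times_f N\times_h M$$ be a doubly warped product, where $N$ and $M$ are compact Riemannian manifolds, $f'(0)=0$, $f(0)>0$, either $h'(0)=0$ or $h(0)=0$, and $f(r)>0$ and $h(r)>0$ for $r\in(0,\infty)$. If $M$ is simply connected or $h(0)=0$, then for every $g\in\pi_1(X)$ $$L^\infty_{rs}(g)=\liminf_{r\to\infty}\frac{F(r,L_N(g))}{r},$$ where $F(r,d)$ is the length of a minimal geodesic in $\mathbb R\times_f\mathbb R$ between $(r,0)$ and $(r,d)$, and $L_N(g)$ is the length of $g$ viewed as an element of $\pi_1(N)$.
   Context: The doubly warped product $[0,\infty)\times_f N\times_h M$ carries the metric $dr^2+f(r)^2g_N+h(r)^2g_M$ (when $h(0)=0$ the factor $M$ is collapsed to a point over $r=0$). In $\mathbb R\times_f\mathbb R$, with metric $dr^2+f(r)^2ds^2$, the function $f$ is extended to $\mathbb R$ evenly. Under the stated hypotheses the universal cover of $X$ is $\tilde X=[0,\infty)\times_f\tilde N\times_h M$ with $\tilde N$ the universal cover of $N$, and each $g\in\pi_1(X)$, viewed as a deck transformation of $\tilde X$, is identified with an element of $\pi_1(N)$ acting by $g(r,\tilde y,z)=(r,g\tilde y,z)$. The length of $g\in\pi_1(N)$ is $L_N(g)=\inf_{\tilde y\in\tilde N}d_{\tilde N}(g\tilde y,\tilde y)$. The infinite rescaled length of $g\in\pi_1(X)$ is $$L^\infty_{rs}(g)=\lim_{R\to\infty}\ \inf_{x\in X\setminus B_{x_0}(R)}\frac{d_{\tilde X}(g\tilde x,\tilde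 x)}{d_X(x,x_0)},$$ where $x_0\in X$ is any basepoint (the value does not depend on it) and $\tilde x$ ranges over the lifts of $x$ to $\tilde X$. *)

theory Defs
  imports "HOL-Analysis.Analysis"
begin

section \<open>Smooth maps and Riemannian manifolds\<close>

text \<open>The derivative is taken within \<open>S\<close>, so that the notion applies both to open sets and to
  the half line \<open>{0..}\<close> (one-sided derivatives at \<open>0\<close>). For a finite-dimensional domain,
  continuity of all the directional derivatives amounts to continuity of the full derivative.\<close>

primrec Ck_on :: "nat \<Rightarrow> ('a::real_normed_vector \<Rightarrow> 'b::real_normed_vector) \<Rightarrow> 'a set \<Rightarrow> bool" where
  "Ck_on 0 F S \<longleftrightarrow> continuous_on S F"
| "Ck_on (Suc k) F S \<longleftrightarrow>
     (\<exists>D. (\<forall>x\<in>S. (F has_derivative D x) (at x within S)) \<and> (\<forall>v. Ck_on k (\<lambda>x. D x v) S))"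

definition smooth_on :: "'a::real_normed_vector set \<Rightarrow> ('a \<Rightarrow> 'b::real_normed_vector) \<Rightarrow> bool" where
  "smooth_on S F \<longleftrightarrow> (\<forall>k. Ck_on k F S)"

text \<open>A chart is a pair of its domain and its coordinate map. The metric is given by its
  coordinate expressions: \<open>metr R (U, \<phi>) x u v\<close> is the inner product, in the tangent space at
  \<open>x \<in> U\<close>, of the vectors whose coordinates in the chart \<open>(U, \<phi>)\<close> are \<open>u\<close> and \<open>v\<close>.\<close>

type_synonym ('p, 'e) chart = "'p set \<times> ('p \<Rightarrow> 'e)"

record ('p, 'e) riem =
  rtop :: "'p topology"
  atlas :: "('p, 'e) chart set"
  metr :: "('p, 'e) chart \<Rightarrow> 'p \<Rightarrow> 'e \<Rightarrow> 'e \<Rightarrow> real"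

text \<open>The model space \<open>'e\<close> is an arbitrary finite-dimensional Euclidean vector space. The class
  \<open>euclidean_space\<close> is not used because it excludes dimension \<open>0\<close>. Manifolds have no boundary;
  connectedness is not part of this definition.\<close>

definition riemannian_manifold :: "('p, 'e::real_inner) riem \<Rightarrow> bool" where
  "riemannian_manifold R \<longleftrightarrow>
     (\<exists>B::'e set. finite B \<and> pairwise orthogonal B \<and> (\<forall>b\<in>B. norm b = 1) \<and> span B = UNIV) \<and>
     Hausdorff_space (rtop R) \<and> second_countable (rtop R) \<and>
     (\<Union>(U, \<phi>)\<in>atlas R. U) = topspace (rtop R) \<and>
     (\<forall>(U, \<phi>)\<in>atlas R. openin (rtop R) U \<and> open (\<phi> ` U) \<and>
        homeomorphic_map (subtopology (rtop R) U) (top_of_set (\<phi> ` U)) \<phi>) \<and>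
     (\<forall>(U, \<phi>)\<in>atlas R. \<forall>(V, \<psi>)\<in>atlas R. smooth_on (\<phi> ` (U \<inter> V)) (\<psi> \<circ> inv_into U \<phi>)) \<and>
     (\<forall>(U, \<phi>)\<in>atlas R. \<forall>x\<in>U.
        bilinear (metr R (U, \<phi>) x) \<and>
        (\<forall>u v. metr R (U, \<phi>) x u v = metr R (U, \<phi>) x v u) \<and>
        (\<forall>u. u \<noteq> 0 \<longrightarrow> metr R (U, \<phi>) x u u > 0)) \<and>
     (\<forall>(U, \<phi>)\<in>atlas R. \<forall>u v.
        smooth_on (\<phi> ` U) (\<lambda>a. metr R (U, \<phi>) (inv_into U \<phi> a) u v)) \<and>
     (\<forall>(U, \<phi>)\<in>atlas R. \<forall>(V, \<psi>)\<in>atlas R. \<forall>x\<in>U \<inter> V. \<forall>u v.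
        metr R (U, \<phi>) x u v =
        (let D = frechet_derivative (\<psi> \<circ> inv_into U \<phi>) (at (\<phi> x))
         in metr R (V, \<psi>) x (D u) (D v)))"

section \<open>Piecewise continuously differentiable curves and their length\<close>

text \<open>All curves are parametrized by \<open>{0..1}\<close>. On each closed piece the derivative exists up to
  the end points (one-sidedly) and is continuous, hence bounded, so that lengths are finite.\<close>

definition piecewise01 :: "(real \<Rightarrow> real \<Rightarrow> bool) \<Rightarrow> bool" where
  "piecewise01 P \<longleftrightarrow> (\<exists>S. finite S \<and> {0, 1} \<subseteq> S \<and> S \<subseteq> {0..1} \<and>
     (\<forall>a\<in>S. \<forall>b\<in>S. a < b \<and> {a<..<b} \<inter> S = {} \<longrightarrow> P a b))"

definition pw_C1_real :: "(real \<Rightarrow> real) \<Rightarrow> bool" where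
  "pw_C1_real \<rho> \<longleftrightarrow> piecewise01 (\<lambda>a b. \<exists>D.
     (\<forall>t\<in>{a..b}. (\<rho> has_vector_derivative D t) (at t within {a..b})) \<and> continuous_on {a..b} D)"

definition pw_C1_curve :: "('p, 'e::real_inner) riem \<Rightarrow> (real \<Rightarrow> 'p) \<Rightarrow> bool" where
  "pw_C1_curve R c \<longleftrightarrow> pathin (rtop R) c \<and>
     piecewise01 (\<lambda>a b. \<forall>(U, \<phi>)\<in>atlas R. \<exists>D.
       (\<forall>t\<in>{a..b}. c t \<in> U \<longrightarrow> ((\<phi> \<circ> c) has_vector_derivative D t) (at t within {a..b})) \<and>
       continuous_on {t\<in>{a..b}. c t \<in> U} D)"

text \<open>Norm of the velocity. The value does not depend on the chart; it is unspecified at the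
  finitely many points where the derivative does not exist.\<close>

definition speed :: "('p, 'e::real_inner) riem \<Rightarrow> (real \<Rightarrow> 'p) \<Rightarrow> real \<Rightarrow> real" where
  "speed R c t = (THE s. \<exists>(U, \<phi>)\<in>atlas R. \<exists>v. c t \<in> U \<and>
     ((\<phi> \<circ> c) has_vector_derivative v) (at t within {0..1}) \<and>
     s = sqrt (metr R (U, \<phi>) (c t) v v))"

definition riem_length :: "('p, 'e::real_inner) riem \<Rightarrow> (real \<Rightarrow> 'p) \<Rightarrow> real" where
  "riem_length R c = integral {0..1} (speed R c)"

section \<open>Universal covers\<close>

definition covering_map :: "'a topology \<Rightarrow> 'b topology \<Rightarrow> ('a \<Rightarrow> 'b) \<Rightarrow> bool" where
  "covering_map T B p \<longleftrightarrow> continuous_map T B p \<and> p ` topspace T = topspace B \<and>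
     (\<forall>x\<in>topspace B. \<exists>U. x \<in> U \<and> openin B U \<and>
        (\<exists>\<V>. \<Union>\<V> = {a\<in>topspace T. p a \<in> U} \<and> (\<forall>V\<in>\<V>. openin T V) \<and> pairwise disjnt \<V> \<and>
             (\<forall>V\<in>\<V>. homeomorphic_map (subtopology T V) (subtopology B U) p)))"

text \<open>The analogue of \<open>simply_connected\<close> for abstract topologies.\<close>

definition simply_connected_space :: "'a topology \<Rightarrow> bool" where
  "simply_connected_space T \<longleftrightarrow> path_connected_space T \<and>
     (\<forall>c c'. pathin T c \<and> c 1 = c 0 \<and> pathin T c' \<and> c' 1 = c' 0 \<longrightarrow>
        homotopic_with (\<lambda>l. l 1 = l 0) (top_of_set {0..1}) T c c')"

definition universal_cover :: "'a topology \<Rightarrow> 'b topology \<Rightarrow> ('a \<Rightarrow> 'b) \<Rightarrow> bool" where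
  "universal_cover T B p \<longleftrightarrow> covering_map T B p \<and> simply_connected_space T"

text \<open>The fundamental group of the base, as the group of deck transformations of the universal
  cover.\<close>

definition deck :: "'a topology \<Rightarrow> ('a \<Rightarrow> 'b) \<Rightarrow> ('a \<Rightarrow> 'a) set" where
  "deck T p = {g. homeomorphic_map T T g \<and> (\<forall>x\<in>topspace T. p (g x) = p x)}"

text \<open>The homomorphism between fundamental groups induced by a map \<open>\<pi>\<close> between the bases of two
  universal covers \<open>q\<close> and \<open>p\<close>, up to conjugation: a path \<open>\<alpha>\<close> from \<open>x\<close> to \<open>g x\<close> projects to a
  loop representing \<open>g\<close>, and a lift of the \<open>\<pi>\<close>-image of that loop goes from some \<open>y\<close> to
  \<open>\<gamma> y\<close>.\<close>

definition induced_on_deck ::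
  "'a topology \<Rightarrow> ('a \<Rightarrow> 'b) \<Rightarrow> 'c topology \<Rightarrow> ('c \<Rightarrow> 'd) \<Rightarrow> ('b \<Rightarrow> 'd) \<Rightarrow>
   ('a \<Rightarrow> 'a) \<Rightarrow> ('c \<Rightarrow> 'c) \<Rightarrow> bool" where
  "induced_on_deck T q T' p \<pi> g \<gamma> \<longleftrightarrow>
     (\<exists>\<alpha> \<beta>. pathin T \<alpha> \<and> \<alpha> 1 = g (\<alpha> 0) \<and> pathin T' \<beta> \<and> \<beta> 1 = \<gamma> (\<beta> 0) \<and>
            (\<forall>t\<in>{0..1}. p (\<beta> t) = \<pi> (q (\<alpha> t))))"

text \<open>The Riemannian distance of the universal cover \<open>p\<close> of \<open>N\<close>, with the pulled back metric:
  a curve upstairs has the same length as its projection.\<close>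

definition riem_cover_dist ::
  "('n, 'e::real_inner) riem \<Rightarrow> 'c topology \<Rightarrow> ('c \<Rightarrow> 'n) \<Rightarrow> 'c \<Rightarrow> 'c \<Rightarrow> real" where
  "riem_cover_dist N T p a b =
     Inf {riem_length N (p \<circ> \<beta>) | \<beta>. pathin T \<beta> \<and> \<beta> 0 = a \<and> \<beta> 1 = b \<and> pw_C1_curve N (p \<circ> \<beta>)}"

definition deck_length ::
  "('n, 'e::real_inner) riem \<Rightarrow> 'c topology \<Rightarrow> ('c \<Rightarrow> 'n) \<Rightarrow> ('c \<Rightarrow> 'c) \<Rightarrow> real" where
  "deck_length N T p \<gamma> = (INF y\<in>topspace T. riem_cover_dist N T p (\<gamma> y) y)"

section \<open>The doubly warped product\<close>

text \<open>A point of \<open>X\<close> is \<open>(r, y, Some z)\<close>; when \<open>h 0 = 0\<close>, the factor \<open>M\<close> over \<open>r = 0\<close> is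
  collapsed to the single point \<open>None\<close>. The topology is the quotient topology.\<close>

definition collapse :: "(real \<Rightarrow> real) \<Rightarrow> real \<times> 'n \<times> 'm \<Rightarrow> real \<times> 'n \<times> 'm option" where
  "collapse h = (\<lambda>(r, y, z). (r, y, if r = 0 \<and> h 0 = 0 then None else Some z))"

definition cyl_top :: "'n topology \<Rightarrow> 'm topology \<Rightarrow> (real \<times> 'n \<times> 'm) topology" where
  "cyl_top TN TM = prod_topology (top_of_set {0..}) (prod_topology TN TM)"

definition dw_top ::
  "(real \<Rightarrow> real) \<Rightarrow> 'n topology \<Rightarrow> 'm topology \<Rightarrow> (real \<times> 'n \<times> 'm option) topology" where
  "dw_top h TN TM = topology (\<lambda>U. U \<subseteq> collapse h ` topspace (cyl_top TN TM) \<and>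
     openin (cyl_top TN TM) {x \<in> topspace (cyl_top TN TM). collapse h x \<in> U})"

lemma quotient_map_collapse: "quotient_map (cyl_top TN TM) (dw_top h TN TM) (collapse h)"
proof -
  let ?P = "cyl_top TN TM" and ?k = "collapse h"
  let ?O = "\<lambda>U. U \<subseteq> ?k ` topspace ?P \<and> openin ?P {x \<in> topspace ?P. ?k x \<in> U}"
  have "istopology ?O"
    unfolding istopology_def
  proof (intro conjI allI impI)
    fix S T assume S: "?O S" and T: "?O T"
    have "{x \<in> topspace ?P. ?k x \<in> S \<inter> T} =
          {x \<in> topspace ?P. ?k x \<in> S} \<inter> {x \<in> topspace ?P. ?k x \<in> T}" by auto
    then show "S \<inter> T \<subseteq> ?k ` topspace ?P" "openin ?P {x \<in> topspace ?P. ?k x \<in> S \<inter> T}"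
      using S T by auto
  next
    fix \<K> assume K: "\<forall>S\<in>\<K>. ?O S"
    have "{x \<in> topspace ?P. ?k x \<in> \<Union>\<K>} = (\<Union>S\<in>\<K>. {x \<in> topspace ?P. ?k x \<in> S})" by auto
    moreover have "openin ?P (\<Union>S\<in>\<K>. {x \<in> topspace ?P. ?k x \<in> S})"
      using K by (intro openin_Union) auto
    ultimately show "openin ?P {x \<in> topspace ?P. ?k x \<in> \<Union>\<K>}" by simp
    show "\<Union>\<K> \<subseteq> ?k ` topspace ?P" using K by blast
  qed
  then have o: "openin (dw_top h TN TM) U \<longleftrightarrow> ?O U" for U
    unfolding dw_top_def by (simp add: topology_inverse')
  have "{x \<in> topspace ?P. ?k x \<in> ?k ` topspace ?P} = topspace ?P" by auto
  then have "openin (dw_top h TN TM) (?k ` topspace ?P)"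
    using o by simp
  then have t: "topspace (dw_top h TN TM) = ?k ` topspace ?P"
    using o openin_topspace[of "dw_top h TN TM"] openin_subset by blast
  show ?thesis
    unfolding quotient_map_def using t o by auto
qed

text \<open>A curve in \<open>X\<close> is the image under \<open>collapse h\<close> of a curve \<open>(\<rho>, y, z)\<close> in the cylinder
  \<open>{0..} \<times> N \<times> M\<close>, with the possibly degenerate metric \<open>dr\<^sup>2 + f\<^sup>2 g\<^sub>N + h\<^sup>2 g\<^sub>M\<close>.\<close>

definition dw_curve ::
  "('n, 'e::real_inner) riem \<Rightarrow> ('m, 'd::real_inner) riem \<Rightarrow>
   (real \<Rightarrow> real) \<Rightarrow> (real \<Rightarrow> 'n) \<Rightarrow> (real \<Rightarrow> 'm) \<Rightarrow> bool" where
  "dw_curve N M \<rho> y z \<longleftrightarrow>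
     pw_C1_real \<rho> \<and> (\<forall>t\<in>{0..1}. 0 \<le> \<rho> t) \<and> pw_C1_curve N y \<and> pw_C1_curve M z"

definition dw_length ::
  "(real \<Rightarrow> real) \<Rightarrow> (real \<Rightarrow> real) \<Rightarrow> ('n, 'e::real_inner) riem \<Rightarrow> ('m, 'd::real_inner) riem \<Rightarrow>
   (real \<Rightarrow> real) \<Rightarrow> (real \<Rightarrow> 'n) \<Rightarrow> (real \<Rightarrow> 'm) \<Rightarrow> real" where
  "dw_length f h N M \<rho> y z = integral {0..1} (\<lambda>t.
     sqrt ((vector_derivative \<rho> (at t within {0..1}))\<^sup>2
           + (f (\<rho> t))\<^sup>2 * (speed N y t)\<^sup>2 + (h (\<rho> t))\<^sup>2 * (speed M z t)\<^sup>2))"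

definition dw_dist ::
  "(real \<Rightarrow> real) \<Rightarrow> (real \<Rightarrow> real) \<Rightarrow> ('n, 'e::real_inner) riem \<Rightarrow> ('m, 'd::real_inner) riem \<Rightarrow>
   real \<times> 'n \<times> 'm option \<Rightarrow> real \<times> 'n \<times> 'm option \<Rightarrow> real" where
  "dw_dist f h N M a b = Inf {dw_length f h N M \<rho> y z | \<rho> y z. dw_curve N M \<rho> y z \<and>
     collapse h (\<rho> 0, y 0, z 0) = a \<and> collapse h (\<rho> 1, y 1, z 1) = b}"

text \<open>The induced length distance on a covering space \<open>q\<close> of \<open>X\<close>.\<close>

definition dw_cover_dist ::
  "(real \<Rightarrow> real) \<Rightarrow> (real \<Rightarrow> real) \<Rightarrow> ('n, 'e::real_inner) riem \<Rightarrow> ('m, 'd::real_inner) riem \<Rightarrow>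
   'x topology \<Rightarrow> ('x \<Rightarrow> real \<times> 'n \<times> 'm option) \<Rightarrow> 'x \<Rightarrow> 'x \<Rightarrow> real" where
  "dw_cover_dist f h N M T q a b = Inf {dw_length f h N M \<rho> y z | \<rho> y z. dw_curve N M \<rho> y z \<and>
     (\<exists>\<alpha>. pathin T \<alpha> \<and> \<alpha> 0 = a \<and> \<alpha> 1 = b \<and>
          (\<forall>t\<in>{0..1}. q (\<alpha> t) = collapse h (\<rho> t, y t, z t)))}"

text \<open>The infimum over \<open>x\<close> outside the ball and over the lifts of \<open>x\<close> is one infimum over the
  points of the cover. It is taken in \<open>ereal\<close>, where the limit always exists by monotonicity.\<close>

definition rescaled_length ::
  "(real \<Rightarrow> real) \<Rightarrow> (real \<Rightarrow> real) \<Rightarrow> ('n, 'e::real_inner) riem \<Rightarrow> ('m, 'd::real_inner) riem \<Rightarrow>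
   'x topology \<Rightarrow> ('x \<Rightarrow> real \<times> 'n \<times> 'm option) \<Rightarrow> real \<times> 'n \<times> 'm option \<Rightarrow> ('x \<Rightarrow> 'x) \<Rightarrow> ereal" where
  "rescaled_length f h N M T q x0 g = Lim at_top (\<lambda>R::real.
     INF x\<in>{x\<in>topspace T. R \<le> dw_dist f h N M (q x) x0}.
       ereal (dw_cover_dist f h N M T q (g x) x / dw_dist f h N M (q x) x0))"

section \<open>The warped product of two lines\<close>

text \<open>\<open>\<bar>\<cdot>\<bar>\<close> implements the even extension of \<open>f\<close>.\<close>

definition plane_length ::
  "(real \<Rightarrow> real) \<Rightarrow> (real \<Rightarrow> real) \<Rightarrow> (real \<Rightarrow> real) \<Rightarrow> real" where
  "plane_length f \<rho> \<sigma> = integral {0..1} (\<lambda>t.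
     sqrt ((vector_derivative \<rho> (at t within {0..1}))\<^sup>2
           + (f \<bar>\<rho> t\<bar>)\<^sup>2 * (vector_derivative \<sigma> (at t within {0..1}))\<^sup>2))"

definition plane_dist :: "(real \<Rightarrow> real) \<Rightarrow> real \<times> real \<Rightarrow> real \<times> real \<Rightarrow> real" where
  "plane_dist f a b = Inf {plane_length f \<rho> \<sigma> | \<rho> \<sigma>. pw_C1_real \<rho> \<and> pw_C1_real \<sigma> \<and>
     (\<rho> 0, \<sigma> 0) = a \<and> (\<rho> 1, \<sigma> 1) = b}"

text \<open>Minimal geodesics are parametrized by arc length, so that the parameter interval \<open>{0..l}\<close>
  has the length of the curve.\<close>

definition minimal_geodesic ::
  "(real \<Rightarrow> real) \<Rightarrow> (real \<Rightarrow> real \<times> real) \<Rightarrow> real \<Rightarrow> real \<times> real \<Rightarrow> real \<times> real \<Rightarrow> bool" where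
  "minimal_geodesic f c l a b \<longleftrightarrow> 0 \<le> l \<and> c 0 = a \<and> c l = b \<and>
     (\<forall>s\<in>{0..l}. \<forall>t\<in>{0..l}. plane_dist f (c s) (c t) = \<bar>s - t\<bar>)"

definition geodesic_length :: "(real \<Rightarrow> real) \<Rightarrow> real \<Rightarrow> real \<Rightarrow> real" where
  "geodesic_length f r d = (THE l. \<exists>c. minimal_geodesic f c l (r, 0) (r, d))"

end

theory Submission
  imports Defs
begin

text \<open>
  Let \<open>L\<close> be the length of \<open>\<gamma>\<close> and let \<open>F r\<close> be the distance between \<open>(r, 0)\<close> and \<open>(r, L)\<close> in
  the warped plane. At a point \<open>x\<close> of the cover over radius \<open>r\<close>, the displacement of \<open>g\<close> is
  compared with \<open>F r\<close>.

  A curve from \<open>g x\<close> to \<open>x\<close> consists of a radial function, a curve in \<open>N\<close> and a curve in \<open>M\<close>.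
  Since \<open>g\<close> corresponds to \<open>\<gamma>\<close>, the curve in \<open>N\<close> lifts to a curve from \<open>\<gamma> y\<close> to \<open>y\<close> for some
  point \<open>y\<close>, so its length is at least \<open>L\<close>. If the point of \<open>N\<close> is replaced by the arc length travelled so far,
  one obtains a curve in the warped plane that is not longer. Hence the displacement is at least
  \<open>F r\<close> (\<open>displacement_ge\<close>).

  Conversely, choose \<open>y\<close> such that \<open>\<gamma>\<close> displaces it by little more than \<open>L\<close>. A nearly minimal
  curve of the warped plane can be reparametrized so that its second coordinate is the arc length of a
  nearly minimal curve from \<open>\<gamma> y\<close> to \<open>y\<close> (\<open>dw_curve_along\<close>). The two together form a curve in
  the warped product with constant third coordinate. It lifts to a curve from \<open>g x\<close> to \<open>x\<close>
  because a loop in the warped product whose projection to \<open>N\<close> is contractible has closed lifts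
  (\<open>dw_loop_closed\<close>); this uses that \<open>M\<close> is simply connected or collapsed over \<open>r = 0\<close>. Hence
  at every radius \<open>r > 0\<close> some point has displacement at most \<open>F r + 1\<close> (\<open>displacement_le\<close>).

  The factors are compact, so the distance to the base point differs from \<open>r\<close> by a bounded amount
  (\<open>dw_dist_bounds\<close>). Moreover \<open>F r \<le> 2 * r + f 0 * L\<close>, by passing through radius \<open>0\<close>. After division the
  bounded errors disappear, and the infima converge to the limit inferior of \<open>F r / r\<close>
  (\<open>limit_of_infima\<close>). Finally, \<open>F r\<close> is the length of a minimal geodesic because the warped plane
  contains minimal geodesics between such points (\<open>minimal_geodesic_exists\<close>).

  Many identities between derivatives, speeds and integrands hold only up to finitely many
  parameters, namely off the breakpoints of the curves; such exceptional sets are called \<open>E\<close>.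
\<close>

section \<open>Piecewise continuous and piecewise continuously differentiable functions\<close>

text \<open>Lengths are integrals of expressions in this derivative; within \<open>{0..1}\<close> it is one-sided at
  the end points, where its value does not affect an integral.\<close>

abbreviation vd :: "(real \<Rightarrow> real) \<Rightarrow> real \<Rightarrow> real" where
  "vd \<rho> t \<equiv> vector_derivative \<rho> (at t within {0..1})"

text \<open>Under a condition inherited by subintervals, breakpoints need not belong to the partition: a piece is
  any interval without a breakpoint inside. Conditions with different breakpoints are then combined by
  taking the union of the breakpoints.\<close>

lemma piecewise01_iff:
  assumes her: "\<And>a b a' b'. P a b \<Longrightarrow> a \<le> a' \<Longrightarrow> a' < b' \<Longrightarrow> b' \<le> b \<Longrightarrow> P a' b'"
  shows "piecewise01 P \<longleftrightarrow>
    (\<exists>S. finite S \<and> (\<forall>a b. 0 \<le> a \<and> a < b \<and> b \<le> 1 \<and> {a<..<b} \<inter> S = {} \<longrightarrow> P a b))"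
proof
  assume "piecewise01 P"
  then obtain S where S: "finite S" "{0,1} \<subseteq> S" "S \<subseteq> {0..1}"
    and P: "\<And>a b. a \<in> S \<Longrightarrow> b \<in> S \<Longrightarrow> a < b \<Longrightarrow> {a<..<b} \<inter> S = {} \<Longrightarrow> P a b"
    unfolding piecewise01_def by (elim exE conjE) (rule that, auto)
  have "P a b" if ab: "0 \<le> a" "a < b" "b \<le> 1" "{a<..<b} \<inter> S = {}" for a b
  proof -
    define a' where "a' = Max {s\<in>S. s \<le> a}"
    define b' where "b' = Min {s\<in>S. b \<le> s}"
    have 1: "a' \<in> {s\<in>S. s \<le> a}" unfolding a'_def by (rule Max_in) (use S ab in auto)
    have 2: "b' \<in> {s\<in>S. b \<le> s}" unfolding b'_def by (rule Min_in) (use S ab in auto)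
    have 3: "s \<le> a'" if "s \<in> S" "s \<le> a" for s
      unfolding a'_def using that S by (intro Max_ge) auto
    have 4: "b' \<le> s" if "s \<in> S" "b \<le> s" for s
      unfolding b'_def using that S by (intro Min_le) auto
    have "{a'<..<b'} \<inter> S = {}"
    proof (rule ccontr)
      assume "{a'<..<b'} \<inter> S \<noteq> {}"
      then obtain s where s: "s \<in> S" "a' < s" "s < b'" by auto
      then have "a < s" "s < b" using 3[of s] 4[of s] by (meson not_le)+
      then show False using s ab(4) by auto
    qed
    then have "P a' b'" using P 1 2 ab by auto
    then show ?thesis using her 1 2 ab by auto
  qed
  then show "\<exists>S. finite S \<and> (\<forall>a b. 0 \<le> a \<and> a < b \<and> b \<le> 1 \<and> {a<..<b} \<inter> S = {} \<longrightarrow> P a b)"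
    using S(1) by blast
next
  assume "\<exists>S. finite S \<and> (\<forall>a b. 0 \<le> a \<and> a < b \<and> b \<le> 1 \<and> {a<..<b} \<inter> S = {} \<longrightarrow> P a b)"
  then obtain S where S: "finite S"
    and P: "\<And>a b. 0 \<le> a \<Longrightarrow> a < b \<Longrightarrow> b \<le> 1 \<Longrightarrow> {a<..<b} \<inter> S = {} \<Longrightarrow> P a b" by blast
  show "piecewise01 P"
    unfolding piecewise01_def
  proof (intro exI[of _ "(S \<inter> {0..1}) \<union> {0,1}"] conjI ballI impI)
    fix a b assume ab: "a \<in> S \<inter> {0..1} \<union> {0, 1}" "b \<in> S \<inter> {0..1} \<union> {0, 1}"
      "a < b \<and> {a<..<b} \<inter> (S \<inter> {0..1} \<union> {0, 1}) = {}"
    then have "0 \<le> a" "b \<le> 1" by auto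
    moreover have "{a<..<b} \<inter> S = {}"
      using ab(3) calculation by (auto simp: set_eq_iff)
    ultimately show "P a b" using ab P by blast
  qed (use S in auto)
qed

text \<open>For a real function \<open>A\<close> is \<open>UNIV\<close>. For a coordinate map along a curve,
  \<open>A\<close> consists of the parameters at which the curve is in the domain of the chart.\<close>

definition C1_piece :: "(real \<Rightarrow> 'a::real_normed_vector) \<Rightarrow> real set \<Rightarrow> real \<Rightarrow> real \<Rightarrow> bool" where
  "C1_piece F A a b \<longleftrightarrow> (\<exists>D.
     (\<forall>t\<in>{a..b}. t \<in> A \<longrightarrow> (F has_vector_derivative D t) (at t within {a..b})) \<and>
     continuous_on {t\<in>{a..b}. t \<in> A} D)"

lemma C1_piece_subinterval:
  assumes "C1_piece F A a b" "a \<le> a'" "b' \<le> b"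
  shows "C1_piece F A a' b'"
proof -
  obtain D where D: "\<forall>t\<in>{a..b}. t \<in> A \<longrightarrow> (F has_vector_derivative D t) (at t within {a..b})"
    "continuous_on {t\<in>{a..b}. t \<in> A} D" using assms unfolding C1_piece_def by blast
  show ?thesis unfolding C1_piece_def
  proof (intro exI[of _ D] conjI ballI impI)
    fix t assume "t \<in> {a'..b'}" "t \<in> A"
    then show "(F has_vector_derivative D t) (at t within {a'..b'})"
      using D(1) assms by (auto intro: has_vector_derivative_within_subset[of F "D t" t "{a..b}"])
  next
    show "continuous_on {t \<in> {a'..b'}. t \<in> A} D"
      by (rule continuous_on_subset[OF D(2)]) (use assms in auto)
  qed
qed

lemma C1_piece_affine:
  assumes "C1_piece F A (k*a+m) (k*b+m)" "k > 0"
  shows "C1_piece (\<lambda>t. F (k*t+m)) {t. k*t+m \<in> A} a b"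
proof -
  let ?l = "\<lambda>t. k*t+m"
  obtain D where D: "\<And>t. t\<in>{?l a..?l b} \<Longrightarrow> t \<in> A \<Longrightarrow> (F has_vector_derivative D t) (at t within {?l a..?l b})"
    "continuous_on {t\<in>{?l a..?l b}. t \<in> A} D" using assms unfolding C1_piece_def by blast
  have im: "?l ` {a..b} \<subseteq> {?l a..?l b}" using assms(2) by auto
  show ?thesis unfolding C1_piece_def
  proof (intro exI[of _ "\<lambda>t. k *\<^sub>R D (?l t)"] conjI ballI impI)
    fix t assume t: "t \<in> {a..b}" "t \<in> {t. k*t+m \<in> A}"
    have "(?l has_vector_derivative k) (at t within {a..b})"
      by (auto intro!: derivative_eq_intros)
    moreover have "(F has_vector_derivative D (?l t)) (at (?l t) within ?l ` {a..b})"
      by (rule has_vector_derivative_within_subset[OF D(1) im]) (use t im assms(2) in \<open>auto simp: image_subset_iff\<close>)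
    ultimately show "((\<lambda>t. F (?l t)) has_vector_derivative k *\<^sub>R D (?l t)) (at t within {a..b})"
      using vector_diff_chain_within[of ?l k t "{a..b}" F] by (simp add: o_def)
  next
    show "continuous_on {t \<in> {a..b}. t \<in> {t. k*t+m \<in> A}} (\<lambda>t. k *\<^sub>R D (?l t))"
      by (intro continuous_intros continuous_on_compose2[OF D(2)]) (use im assms(2) in \<open>auto simp: image_subset_iff\<close>)
  qed
qed

lemma C1_piece_cong:
  assumes "C1_piece F A a b" "\<And>t. t \<in> {a..b} \<Longrightarrow> F t = G t" "\<And>t. t \<in> {a..b} \<Longrightarrow> t \<in> A \<longleftrightarrow> t \<in> B"
  shows "C1_piece G B a b"
proof -
  obtain D where D: "\<And>t. t\<in>{a..b} \<Longrightarrow> t \<in> A \<Longrightarrow> (F has_vector_derivative D t) (at t within {a..b})"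
    "continuous_on {t\<in>{a..b}. t \<in> A} D" using assms unfolding C1_piece_def by blast
  have e: "{t\<in>{a..b}. t \<in> B} = {t\<in>{a..b}. t \<in> A}" using assms by auto
  show ?thesis unfolding C1_piece_def e
    by (intro exI[of _ D] conjI ballI impI D)
       (metis has_vector_derivative_transform[of _ "{a..b}" G F] D(1) assms(2,3))
qed

lemma C1_piece_UNIV: "C1_piece F UNIV a b \<longleftrightarrow> (\<exists>D.
     (\<forall>t\<in>{a..b}. (F has_vector_derivative D t) (at t within {a..b})) \<and> continuous_on {a..b} D)"
  unfolding C1_piece_def by (simp only: UNIV_I simp_thms Collect_mem_eq)

lemma pw_C1_real_def2: "pw_C1_real \<rho> \<longleftrightarrow> piecewise01 (C1_piece \<rho> UNIV)"
  unfolding pw_C1_real_def C1_piece_UNIV ..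

lemma pw_C1_real_iff: "pw_C1_real \<rho> \<longleftrightarrow>
    (\<exists>S. finite S \<and> (\<forall>a b. 0 \<le> a \<and> a < b \<and> b \<le> 1 \<and> {a<..<b} \<inter> S = {} \<longrightarrow> C1_piece \<rho> UNIV a b))"
  unfolding pw_C1_real_def2
  by (rule piecewise01_iff) (blast intro: C1_piece_subinterval)

text \<open>The end points are exempt because derivatives and speeds are unspecified at breakpoints.\<close>

definition cont_piece :: "(real \<Rightarrow> real) \<Rightarrow> real \<Rightarrow> real \<Rightarrow> bool" where
  "cont_piece G a b \<longleftrightarrow> (\<exists>H. continuous_on {a..b} H \<and> (\<forall>t\<in>{a<..<b}. G t = H t))"

definition pw_cont :: "(real \<Rightarrow> real) \<Rightarrow> bool" where
  "pw_cont G \<longleftrightarrow> (\<exists>S. finite S \<and>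
     (\<forall>a b. 0 \<le> a \<and> a < b \<and> b \<le> 1 \<and> {a<..<b} \<inter> S = {} \<longrightarrow> cont_piece G a b))"

lemma pw_cont_continuous:
  assumes "continuous_on {0..1} G" shows "pw_cont G"
  unfolding pw_cont_def cont_piece_def
  by (intro exI[of _ "{}"]) (auto intro!: exI[of _ G] continuous_on_subset[OF assms])

lemma pw_cont_map2:
  assumes "pw_cont G1" "pw_cont G2" "continuous_on UNIV (\<lambda>(x,y). F x y :: real)"
  shows "pw_cont (\<lambda>t. F (G1 t) (G2 t))"
proof -
  obtain S1 where S1: "finite S1"
     "\<And>a b. 0 \<le> a \<and> a < b \<and> b \<le> 1 \<and> {a<..<b} \<inter> S1 = {} \<Longrightarrow> cont_piece G1 a b"
    using assms unfolding pw_cont_def by blast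
  obtain S2 where S2: "finite S2"
     "\<And>a b. 0 \<le> a \<and> a < b \<and> b \<le> 1 \<and> {a<..<b} \<inter> S2 = {} \<Longrightarrow> cont_piece G2 a b"
    using assms unfolding pw_cont_def by blast
  show ?thesis unfolding pw_cont_def
  proof (intro exI[of _ "S1 \<union> S2"] conjI allI impI)
    fix a b assume ab: "0 \<le> a \<and> a < b \<and> b \<le> 1 \<and> {a<..<b} \<inter> (S1 \<union> S2) = {}"
    obtain H1 where H1: "continuous_on {a..b} H1" "\<forall>t\<in>{a<..<b}. G1 t = H1 t"
      using S1(2)[of a b] ab unfolding cont_piece_def by blast
    obtain H2 where H2: "continuous_on {a..b} H2" "\<forall>t\<in>{a<..<b}. G2 t = H2 t"
      using S2(2)[of a b] ab unfolding cont_piece_def by blast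
    have "continuous_on {a..b} (\<lambda>t. (\<lambda>(x,y). F x y) (H1 t, H2 t))"
      by (rule continuous_on_compose2[OF assms(3)]) (auto intro!: continuous_intros H1 H2)
    then show "cont_piece (\<lambda>t. F (G1 t) (G2 t)) a b"
      unfolding cont_piece_def using H1 H2 by (intro exI[of _ "\<lambda>t. F (H1 t) (H2 t)"]) auto
  qed (use S1 S2 in auto)
qed

lemma pw_cont_const [simp]: "pw_cont (\<lambda>t. c)"
  by (rule pw_cont_continuous) auto

lemma pw_cont_add: "pw_cont G1 \<Longrightarrow> pw_cont G2 \<Longrightarrow> pw_cont (\<lambda>t. G1 t + G2 t)"
  by (rule pw_cont_map2[where F="\<lambda>x y. x + y"]) (auto simp: case_prod_unfold intro!: continuous_intros)

lemma pw_cont_mult: "pw_cont G1 \<Longrightarrow> pw_cont G2 \<Longrightarrow> pw_cont (\<lambda>t. G1 t * G2 t)"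
  by (rule pw_cont_map2[where F="\<lambda>x y. x * y"]) (auto simp: case_prod_unfold intro!: continuous_intros)

lemma pw_cont_power2: "pw_cont G \<Longrightarrow> pw_cont (\<lambda>t. (G t)\<^sup>2)"
  unfolding power2_eq_square by (rule pw_cont_mult)

lemma pw_cont_sqrt: "pw_cont G \<Longrightarrow> pw_cont (\<lambda>t. sqrt (G t))"
  by (rule pw_cont_map2[where F="\<lambda>x y. sqrt x" and ?G2.0="G"]) (auto simp: case_prod_unfold intro!: continuous_intros)

lemma pw_cont_abs: "pw_cont G \<Longrightarrow> pw_cont (\<lambda>t. \<bar>G t\<bar>)"
  by (rule pw_cont_map2[where F="\<lambda>x y. \<bar>x\<bar>" and ?G2.0="G"]) (auto simp: case_prod_unfold intro!: continuous_intros)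

lemmas pw_cont_intros = pw_cont_const pw_cont_add pw_cont_mult pw_cont_power2 pw_cont_sqrt pw_cont_abs

text \<open>Near any point, at most that point itself is a breakpoint, so the two sides of it are pieces and
  Bolzano's bisection principle applies.\<close>

lemma pieces_induct:
  fixes S :: "real set"
  assumes S: "finite S"
    and piece: "\<And>a b. 0 \<le> a \<Longrightarrow> a < b \<Longrightarrow> b \<le> 1 \<Longrightarrow> {a<..<b} \<inter> S = {} \<Longrightarrow> P a b"
    and trans: "\<And>a b c. P a b \<Longrightarrow> P b c \<Longrightarrow> a \<le> b \<Longrightarrow> b \<le> c \<Longrightarrow> P a c"
    and refl: "\<And>a. P a a"
    and ab: "0 \<le> a" "a \<le> b" "b \<le> 1"
  shows "P a b"
proof -
  let ?Q = "\<lambda>a b. 0 \<le> a \<and> b \<le> 1 \<longrightarrow> P a b"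
  have "?Q a b"
  proof (rule Bolzano[OF ab(2), where P="?Q"])
    fix a b c assume "?Q a b" "?Q b c" "a \<le> b" "b \<le> c"
    then show "?Q a c" using assms(3)[of a b c] by auto
  next
    fix x assume "a \<le> x" "x \<le> b"
    obtain d where d: "d > 0" "\<forall>s\<in>S. s \<noteq> x \<longrightarrow> d \<le> dist x s"
      using finite_set_avoid[OF S] by blast
    show "\<exists>d>0. \<forall>a b. a \<le> x \<and> x \<le> b \<and> b - a < d \<longrightarrow> ?Q a b"
    proof (intro exI[of _ d] conjI allI impI d)
      fix a b assume h: "a \<le> x \<and> x \<le> b \<and> b - a < d" "0 \<le> a \<and> b \<le> 1"
      have "{a<..<x} \<inter> S = {}" "{x<..<b} \<inter> S = {}"
        using d(2) h by (force simp: dist_real_def)+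
      then have "P a x" "P x b" using piece[of a x] piece[of x b] refl h
        by (cases "a = x"; cases "x = b"; auto)+
      then show "P a b" using assms(3) h by auto
    qed
  qed
  then show ?thesis using ab by auto
qed

lemma pw_cont_integrable:
  assumes "pw_cont G" "0 \<le> a" "b \<le> 1" shows "G integrable_on {a..b}"
proof (cases "a \<le> b")
  case True
  obtain S where S: "finite S"
     "\<And>a b. 0 \<le> a \<and> a < b \<and> b \<le> 1 \<and> {a<..<b} \<inter> S = {} \<Longrightarrow> cont_piece G a b"
    using assms unfolding pw_cont_def by blast
  show ?thesis
  proof (rule pieces_induct[OF S(1), where P="\<lambda>a b. G integrable_on {a..b}"])
    fix a b :: real assume "0 \<le> a" "a < b" "b \<le> 1" "{a<..<b} \<inter> S = {}"
    then obtain H where H: "continuous_on {a..b} H" "\<forall>t\<in>{a<..<b}. G t = H t"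
      using S(2)[of a b] unfolding cont_piece_def by blast
    show "G integrable_on {a..b}"
      using integrable_spike_interior[of a b G H] H integrable_continuous_real by auto
  next
    fix a b c :: real assume "G integrable_on {a..b}" "G integrable_on {b..c}" "a \<le> b" "b \<le> c"
    then show "G integrable_on {a..c}" using Henstock_Kurzweil_Integration.integrable_combine[where a=a and c=b and b=c and f=G] by simp
  next
    show "G integrable_on {a..a}" for a :: real using integrable_on_refl[of G a] by simp
  qed (use assms True in auto)
qed auto

lemma integral_spike_finite01:
  assumes "finite E" "\<And>t. t \<in> {a..b} - E \<Longrightarrow> G t = G' t"
  shows "integral {a..b} G = integral {a..b} (G'::real\<Rightarrow>real)"
  by (rule integral_spike[of E]) (use assms in \<open>auto intro: negligible_finite\<close>)

lemma integral_mono_finite: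
  fixes G G' :: "real \<Rightarrow> real"
  assumes "finite E" "G integrable_on {a..b}" "G' integrable_on {a..b}"
    "\<And>t. t \<in> {a..b} - E \<Longrightarrow> G t \<le> G' t"
  shows "integral {a..b} G \<le> integral {a..b} G'"
proof -
  let ?H = "\<lambda>t. if t \<in> E then G' t else G t"
  have "?H integrable_on {a..b}" by (rule integrable_spike_finite[OF assms(1) _ assms(2)]) auto
  then have "integral {a..b} ?H \<le> integral {a..b} G'"
    by (rule integral_le) (use assms in auto)
  moreover have "integral {a..b} ?H = integral {a..b} G"
    by (rule integral_spike_finite01[OF assms(1)]) auto
  ultimately show ?thesis by simp
qed

text \<open>Arc length functions and total variations arise in this way.\<close>

lemma pw_C1_integral:
  assumes "pw_cont G"
  shows "pw_C1_real (\<lambda>u. integral {0..u} G)"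
    and "\<exists>E. finite E \<and> (\<forall>t\<in>{0..1}-E. vd (\<lambda>u. integral {0..u} G) t = G t)"
proof -
  let ?\<Gamma> = "\<lambda>u. integral {0..u} G"
  obtain S where S: "finite S"
     "\<And>a b. 0 \<le> a \<and> a < b \<and> b \<le> 1 \<and> {a<..<b} \<inter> S = {} \<Longrightarrow> cont_piece G a b"
    using assms unfolding pw_cont_def by blast
  have key: "\<exists>H. continuous_on {a..b} H \<and> (\<forall>t\<in>{a<..<b}. G t = H t) \<and>
     (\<forall>t\<in>{a..b}. (?\<Gamma> has_vector_derivative H t) (at t within {a..b}))"
    if ab: "0 \<le> a \<and> a < b \<and> b \<le> 1 \<and> {a<..<b} \<inter> S = {}" for a b
  proof -
    obtain H where H: "continuous_on {a..b} H" "\<forall>t\<in>{a<..<b}. G t = H t"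
      using S(2)[of a b] ab unfolding cont_piece_def by blast
    have e: "?\<Gamma> u = ?\<Gamma> a + integral {a..u} H" if u: "u \<in> {a..b}" for u
    proof -
      have "?\<Gamma> u = ?\<Gamma> a + integral {a..u} G"
        using Henstock_Kurzweil_Integration.integral_combine[of 0 a u G] u ab pw_cont_integrable[OF assms, of 0 u] by auto
      moreover have "integral {a..u} G = integral {a..u} H"
        by (rule integral_spike_finite01[of "{a,u}"]) (use H u in auto)
      ultimately show ?thesis by simp
    qed
    have "(?\<Gamma> has_vector_derivative H t) (at t within {a..b})" if t: "t \<in> {a..b}" for t
    proof (rule has_vector_derivative_transform[OF t])
      show "((\<lambda>u. ?\<Gamma> a + integral {a..u} H) has_vector_derivative H t) (at t within {a..b})"
        using has_vector_derivative_add[OF has_vector_derivative_const integral_has_vector_derivative[OF H(1) t]]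
        by simp
    qed (erule e)
    then show ?thesis using H by blast
  qed
  show "pw_C1_real ?\<Gamma>"
    unfolding pw_C1_real_iff C1_piece_UNIV using S(1) key by (intro exI[of _ S]) blast
  show "\<exists>E. finite E \<and> (\<forall>t\<in>{0..1}-E. vd ?\<Gamma> t = G t)"
  proof (intro exI[of _ "S \<union> {0,1}"] conjI ballI)
    fix t :: real assume t: "t \<in> {0..1} - (S \<union> {0,1})"
    obtain d where d: "d > 0" "\<forall>s\<in>S \<union> {0,1}. s \<noteq> t \<longrightarrow> d \<le> dist t s"
      using finite_set_avoid[of "S \<union> {0,1}"] S(1) by blast
    have free: "{t-d<..<t+d} \<inter> S = {}" "0 \<le> t-d" "t+d \<le> 1"
      using d t by (force simp: dist_real_def)+
    then obtain H where H: "\<forall>t\<in>{t-d<..<t+d}. G t = H t"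
      "\<forall>u\<in>{t-d..t+d}. (?\<Gamma> has_vector_derivative H u) (at u within {t-d..t+d})"
      using key[of "t-d" "t+d"] d(1) by auto
    have "(?\<Gamma> has_vector_derivative H t) (at t within {t-d..t+d})" using H(2) d by auto
    then have "(?\<Gamma> has_vector_derivative H t) (at t)"
      by (subst (asm) at_within_Icc_at) (use d in auto)
    then have "vd ?\<Gamma> t = H t" by (rule vector_derivative_at_within_ivl) (use t in auto)
    then show "vd ?\<Gamma> t = G t" using H(1) d by auto
  qed (use S in auto)
qed

lemma pw_C1_vd:
  assumes "pw_C1_real \<rho>"
  shows "pw_cont (vd \<rho>)" and "continuous_on {0..1} \<rho>"
    and "\<exists>E. finite E \<and> {0,1} \<subseteq> E \<and> (\<forall>t\<in>{0..1}-E. (\<rho> has_vector_derivative vd \<rho> t) (at t))"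
proof -
  obtain S where S: "finite S"
     "\<And>a b. 0 \<le> a \<and> a < b \<and> b \<le> 1 \<and> {a<..<b} \<inter> S = {} \<Longrightarrow> C1_piece \<rho> UNIV a b"
    using assms unfolding pw_C1_real_iff by blast
  have key: "\<exists>D. continuous_on {a..b} D \<and>
     (\<forall>t\<in>{a..b}. (\<rho> has_vector_derivative D t) (at t within {a..b})) \<and>
     (\<forall>t\<in>{a<..<b}. vd \<rho> t = D t \<and> (\<rho> has_vector_derivative vd \<rho> t) (at t))"
    if ab: "0 \<le> a \<and> a < b \<and> b \<le> 1 \<and> {a<..<b} \<inter> S = {}" for a b
  proof -
    obtain D where D: "continuous_on {a..b} D"
      "\<forall>t\<in>{a..b}. (\<rho> has_vector_derivative D t) (at t within {a..b})"
      using S(2)[OF ab] unfolding C1_piece_UNIV by auto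
    have V: "\<forall>t\<in>{a<..<b}. vd \<rho> t = D t \<and> (\<rho> has_vector_derivative vd \<rho> t) (at t)"
    proof
      fix t assume t: "t \<in> {a<..<b}"
      have "(\<rho> has_vector_derivative D t) (at t within {a..b})" using D(2) t by simp
      then have "(\<rho> has_vector_derivative D t) (at t)"
        by (subst (asm) at_within_Icc_at) (use t in auto)
      moreover have "vd \<rho> t = D t"
        by (rule vector_derivative_at_within_ivl[OF calculation]) (use t ab in auto)
      ultimately show "vd \<rho> t = D t \<and> (\<rho> has_vector_derivative vd \<rho> t) (at t)" by simp
    qed
    show ?thesis using D V by (intro exI[of _ D] conjI)
  qed
  show "pw_cont (vd \<rho>)"
    unfolding pw_cont_def
  proof (intro exI[of _ S] conjI allI impI S(1))
    fix a b assume "0 \<le> a \<and> a < b \<and> b \<le> 1 \<and> {a<..<b} \<inter> S = {}"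
    from key[OF this] obtain D where "continuous_on {a..b} D" "\<forall>t\<in>{a<..<b}. vd \<rho> t = D t" by auto
    then show "cont_piece (vd \<rho>) a b" unfolding cont_piece_def by blast
  qed
  show "continuous_on {0..1} \<rho>"
  proof (rule pieces_induct[OF S(1), where P="\<lambda>a b. continuous_on {a..b} \<rho>"])
    fix a b :: real assume "0 \<le> a" "a < b" "b \<le> 1" "{a<..<b} \<inter> S = {}"
    then show "continuous_on {a..b} \<rho>"
      using key[of a b] by (blast intro: continuous_on_vector_derivative)
  next
    fix a b c :: real assume h: "continuous_on {a..b} \<rho>" "continuous_on {b..c} \<rho>" "a \<le> b" "b \<le> c"
    then have "{a..c} = {a..b} \<union> {b..c}" by auto
    then show "continuous_on {a..c} \<rho>" using h by (auto intro: continuous_on_closed_Un)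
  qed auto
  show "\<exists>E. finite E \<and> {0,1} \<subseteq> E \<and> (\<forall>t\<in>{0..1}-E. (\<rho> has_vector_derivative vd \<rho> t) (at t))"
  proof (intro exI[of _ "S \<union> {0,1}"] conjI ballI)
    fix t :: real assume t: "t \<in> {0..1} - (S \<union> {0,1})"
    obtain d where d: "d > 0" "\<forall>s\<in>S \<union> {0,1}. s \<noteq> t \<longrightarrow> d \<le> dist t s"
      using finite_set_avoid[of "S \<union> {0,1}"] S(1) by blast
    have free: "{t-d<..<t+d} \<inter> S = {}" "0 \<le> t-d" "t+d \<le> 1"
      using d t by (force simp: dist_real_def)+
    have ab: "0 \<le> t-d \<and> t-d < t+d \<and> t+d \<le> 1 \<and> {t-d<..<t+d} \<inter> S = {}" using free d(1) by auto
    from key[OF ab] obtain D where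
      "\<forall>u\<in>{t-d<..<t+d}. vd \<rho> u = D u \<and> (\<rho> has_vector_derivative vd \<rho> u) (at u)"
      by (elim exE conjE) (rule that)
    then have "vd \<rho> t = D t \<and> (\<rho> has_vector_derivative vd \<rho> t) (at t)"
      by (rule bspec) (use d in simp)
    then show "(\<rho> has_vector_derivative vd \<rho> t) (at t)" by (rule conjunct2)
  qed (use S in auto)
qed

lemma pw_C1_ftc:
  assumes "pw_C1_real \<rho>" "0 \<le> a" "a \<le> b" "b \<le> 1"
  shows "(vd \<rho> has_integral (\<rho> b - \<rho> a)) {a..b}"
proof -
  obtain E where E: "finite E" "\<forall>t\<in>{0..1}-E. (\<rho> has_vector_derivative vd \<rho> t) (at t)"
    using pw_C1_vd(3)[OF assms(1)] by blast
  show ?thesis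
    by (rule fundamental_theorem_of_calculus_interior_strong[OF E(1) assms(3)])
       (use E assms in \<open>auto intro!: continuous_on_subset[OF pw_C1_vd(2)[OF assms(1)]]\<close>)
qed

lemma pw_C1_single:
  assumes "\<And>t. t \<in> {0..1} \<Longrightarrow> (\<rho> has_vector_derivative D t) (at t within {0..1})" "continuous_on {0..1} D"
  shows "pw_C1_real \<rho>"
  unfolding pw_C1_real_iff
proof (intro exI[of _ "{}"] conjI allI impI)
  fix a b :: real assume "0 \<le> a \<and> a < b \<and> b \<le> 1 \<and> {a<..<b} \<inter> {} = {}"
  moreover have "C1_piece \<rho> UNIV 0 1" unfolding C1_piece_UNIV using assms by blast
  ultimately show "C1_piece \<rho> UNIV a b" using C1_piece_subinterval by blast
qed auto

lemma pw_C1_affine [simp]: "pw_C1_real (\<lambda>t. a + b * t)"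
  by (rule pw_C1_single[of _ "\<lambda>_. b"]) (auto intro!: derivative_eq_intros)

lemma vd_affine [simp]: "t \<in> {0..1} \<Longrightarrow> vd (\<lambda>t. a + b * t) t = b"
  by (rule vector_derivative_at_within_ivl[where a=0 and b=1]) (auto intro!: derivative_eq_intros)

lemma pw_C1_const [simp]: "pw_C1_real (\<lambda>t. a)"
  using pw_C1_affine[of a 0] by simp

lemma vd_const [simp]: "t \<in> {0..1} \<Longrightarrow> vd (\<lambda>t. a) t = 0"
  using vd_affine[of t a 0] by simp

lemma pw_C1_cmult:
  assumes "pw_C1_real \<rho>" shows "pw_C1_real (\<lambda>t. \<rho> t * c)"
proof -
  obtain S where S: "finite S"
     "\<And>a b. 0 \<le> a \<and> a < b \<and> b \<le> 1 \<and> {a<..<b} \<inter> S = {} \<Longrightarrow> C1_piece \<rho> UNIV a b"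
    using assms unfolding pw_C1_real_iff by blast
  show ?thesis unfolding pw_C1_real_iff
  proof (intro exI[of _ S] conjI allI impI S(1))
    fix a b assume ab: "0 \<le> a \<and> a < b \<and> b \<le> 1 \<and> {a<..<b} \<inter> S = {}"
    then obtain D where D: "continuous_on {a..b} D"
      "\<forall>t\<in>{a..b}. (\<rho> has_vector_derivative D t) (at t within {a..b})"
      using S(2)[OF ab] unfolding C1_piece_UNIV by auto
    show "C1_piece (\<lambda>t. \<rho> t * c) UNIV a b" unfolding C1_piece_UNIV
      using D by (intro exI[of _ "\<lambda>t. D t * c"])
        (auto intro!: continuous_intros has_vector_derivative_mult_left)
  qed
qed

section \<open>Monotone reparametrization\<close>

text \<open>Monotonicity keeps the number of pieces finite: for a breakpoint \<open>s\<close> of the outer function,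
  one point of the fibre over \<open>s\<close> suffices as a breakpoint of the composition, because the
  inner function then maps any piece to one side of \<open>s\<close>.\<close>

lemma pw_C1_compose:
  assumes \<rho>: "pw_C1_real \<rho>" and \<phi>: "pw_C1_real \<phi>" and mono: "mono_on {0..1} \<phi>"
    and range: "\<phi> ` {0..1} \<subseteq> {0..1}"
  shows "pw_C1_real (\<rho> \<circ> \<phi>)"
proof -
  obtain S1 where S1: "finite S1"
     "\<And>a b. 0 \<le> a \<and> a < b \<and> b \<le> 1 \<and> {a<..<b} \<inter> S1 = {} \<Longrightarrow> C1_piece \<rho> UNIV a b"
    using \<rho> unfolding pw_C1_real_iff by auto
  obtain S2 where S2: "finite S2"
     "\<And>a b. 0 \<le> a \<and> a < b \<and> b \<le> 1 \<and> {a<..<b} \<inter> S2 = {} \<Longrightarrow> C1_piece \<phi> UNIV a b"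
    using \<phi> unfolding pw_C1_real_iff by auto
  \<comment> \<open>One point in each nonempty fibre of \<open>\<phi>\<close>.\<close>
  define w where "w = (\<lambda>s. SOME t. t \<in> {0..1} \<and> \<phi> t = s)"
  have w: "w s \<in> {0..1} \<and> \<phi> (w s) = s" if "t \<in> {0..1}" "\<phi> t = s" for s t
    unfolding w_def by (rule someI[of _ t]) (use that in simp)
  show ?thesis unfolding pw_C1_real_iff
  proof (intro exI[of _ "S2 \<union> w ` S1"] conjI allI impI)
    show "finite (S2 \<union> w ` S1)" using S1 S2 by auto
  next
    fix a b assume ab: "0 \<le> a \<and> a < b \<and> b \<le> 1 \<and> {a<..<b} \<inter> (S2 \<union> w ` S1) = {}"
    have m: "\<phi> s \<le> \<phi> t" if "a \<le> s" "s \<le> t" "t \<le> b" for s t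
      using mono_onD[OF mono] that ab by auto
    have C\<phi>: "C1_piece \<phi> UNIV a b" by (rule S2(2)) (use ab in auto)
    show "C1_piece (\<rho> \<circ> \<phi>) UNIV a b"
    proof (cases "\<phi> a = \<phi> b")
      case True
      have "C1_piece (\<lambda>t. \<rho> (\<phi> a)) UNIV a b"
        unfolding C1_piece_UNIV by (intro exI[of _ "\<lambda>_. 0"]) auto
      then show ?thesis
        by (rule C1_piece_cong) (use m[of a] m[of _ b] True in \<open>auto intro!: arg_cong[of _ _ \<rho>] antisym\<close>)
    next
      case False
      then have lt: "\<phi> a < \<phi> b" using m[of a b] ab by auto
      have im: "\<phi> ` {a..b} \<subseteq> {\<phi> a..\<phi> b}" using m by auto
      have free: "{\<phi> a<..<\<phi> b} \<inter> S1 = {}"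
      proof (rule ccontr)
        assume "{\<phi> a<..<\<phi> b} \<inter> S1 \<noteq> {}"
        then obtain s where s: "s \<in> S1" "\<phi> a < s" "s < \<phi> b" by auto
        have "continuous_on {a..b} \<phi>"
          using continuous_on_subset[OF pw_C1_vd(2)[OF \<phi>]] ab by auto
        then obtain t where t: "a \<le> t" "t \<le> b" "\<phi> t = s"
          using IVT'[of \<phi> a s b] s ab by auto
        have ws: "w s \<in> {0..1}" "\<phi> (w s) = s" using w[of t s] t ab by auto
        have "a < w s" "w s < b"
          using mono_onD[OF mono, of "w s" a] mono_onD[OF mono, of b "w s"] ws s ab
          by (auto simp: not_le[symmetric])
        then show False using ab s by auto
      qed
      have "0 \<le> \<phi> a" "\<phi> b \<le> 1" using range ab by (auto simp: image_subset_iff)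
      then have "C1_piece \<rho> UNIV (\<phi> a) (\<phi> b)" using S1(2) lt free by auto
      then obtain D where D: "continuous_on {\<phi> a..\<phi> b} D"
        "\<forall>t\<in>{\<phi> a..\<phi> b}. (\<rho> has_vector_derivative D t) (at t within {\<phi> a..\<phi> b})"
        unfolding C1_piece_UNIV by auto
      obtain D' where D': "continuous_on {a..b} D'"
        "\<forall>t\<in>{a..b}. (\<phi> has_vector_derivative D' t) (at t within {a..b})"
        using C\<phi> unfolding C1_piece_UNIV by auto
      show ?thesis unfolding C1_piece_UNIV
      proof (intro exI[of _ "\<lambda>t. D' t * D (\<phi> t)"] conjI ballI)
        fix t assume t: "t \<in> {a..b}"
        then have "\<phi> t \<in> {\<phi> a..\<phi> b}" using im by blast
        then have "(\<rho> has_vector_derivative D (\<phi> t)) (at (\<phi> t) within \<phi> ` {a..b})"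
          using has_vector_derivative_within_subset[OF bspec[OF D(2)] im] by blast
        then show "(\<rho> \<circ> \<phi> has_vector_derivative D' t * D (\<phi> t)) (at t within {a..b})"
          using vector_diff_chain_within[of \<phi> "D' t" t "{a..b}" \<rho> "D (\<phi> t)"] D'(2) t by simp
      next
        have "continuous_on {a..b} \<phi>"
          using continuous_on_subset[OF pw_C1_vd(2)[OF \<phi>]] ab by auto
        then show "continuous_on {a..b} (\<lambda>t. D' t * D (\<phi> t))"
          by (intro continuous_intros D'(1) continuous_on_compose2[OF D(1)]) (use im in auto)
      qed
    qed
  qed
qed

text \<open>The level sets of a monotone function are intervals, so off their end points the function is locally
  constant. This covers the parameters at which a reparametrization rests at a breakpoint of the outer
  function: there the chain rule holds because both sides vanish.\<close>

lemma mono_level_sets: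
  assumes mono: "mono_on {0..1::real} (\<phi> :: real \<Rightarrow> real)" and E: "finite E"
  shows "\<exists>B. finite B \<and> (\<forall>t\<in>{0..1}-B. \<phi> t \<in> E \<longrightarrow>
     (\<exists>t1 t2. 0 \<le> t1 \<and> t1 < t \<and> t < t2 \<and> t2 \<le> 1 \<and> (\<forall>u\<in>{t1..t2}. \<phi> u = \<phi> t)))"
proof -
  let ?I = "\<lambda>e. {t\<in>{0..1}. \<phi> t = e}"
  show ?thesis
  proof (intro exI[of _ "(\<lambda>e. Inf (?I e)) ` E \<union> (\<lambda>e. Sup (?I e)) ` E"] conjI ballI impI)
    fix t assume t: "t \<in> {0..1} - ((\<lambda>e. Inf (?I e)) ` E \<union> (\<lambda>e. Sup (?I e)) ` E)" and e: "\<phi> t \<in> E"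
    let ?J = "?I (\<phi> t)"
    have J: "t \<in> ?J" "bdd_below ?J" "bdd_above ?J" using t by auto
    have "Inf ?J \<in> (\<lambda>e. Inf (?I e)) ` E" "Sup ?J \<in> (\<lambda>e. Sup (?I e)) ` E" using e by blast+
    moreover have "t \<notin> (\<lambda>e. Inf (?I e)) ` E" "t \<notin> (\<lambda>e. Sup (?I e)) ` E" using t by blast+
    ultimately have ne: "Inf ?J \<noteq> t" "Sup ?J \<noteq> t" by metis+
    have "Inf ?J < t" using cInf_lower[OF J(1,2)] ne by linarith
    then obtain t1 where t1: "t1 \<in> ?J" "t1 < t" using cInf_lessD[of ?J t] J(1) by blast
    have "t < Sup ?J" using cSup_upper[OF J(1,3)] ne by linarith
    then obtain t2 where t2: "t2 \<in> ?J" "t < t2" using less_cSupD[of ?J t] J(1) by blast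
    have t12: "0 \<le> t1" "t2 \<le> 1" "\<phi> t1 = \<phi> t" "\<phi> t2 = \<phi> t" using t1(1) t2(1) by auto
    have "\<phi> u = \<phi> t" if "u \<in> {t1..t2}" for u
      using mono_onD[OF mono, of t1 u] mono_onD[OF mono, of u t2] t12 t1(2) t2(2) that by simp
    then show "\<exists>t1 t2. 0 \<le> t1 \<and> t1 < t \<and> t < t2 \<and> t2 \<le> 1 \<and> (\<forall>u\<in>{t1..t2}. \<phi> u = \<phi> t)"
      using t12 t1(2) t2(2) by blast
  qed (use E in auto)
qed

lemma vd_locally_const:
  assumes "t1 < t" "t < t2" "0 \<le> t1" "t2 \<le> 1" "\<And>u. u \<in> {t1..t2} \<Longrightarrow> F u = c"
  shows "vd F t = 0"
proof -
  have "((\<lambda>_. c) has_vector_derivative 0) (at t)" by auto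
  then have "(F has_vector_derivative 0) (at t)"
    by (rule has_vector_derivative_transform_within_open[of _ _ _ "{t1<..<t2}"]) (use assms in auto)
  then show ?thesis by (rule vector_derivative_at_within_ivl) (use assms in auto)
qed

lemma vd_compose:
  assumes \<rho>: "pw_C1_real \<rho>" and \<phi>: "pw_C1_real \<phi>" and mono: "mono_on {0..1} \<phi>"
    and range: "\<phi> ` {0..1} \<subseteq> {0..1}"
  shows "\<exists>E. finite E \<and> (\<forall>t\<in>{0..1}-E. vd (\<rho> \<circ> \<phi>) t = vd \<rho> (\<phi> t) * vd \<phi> t)"
proof -
  obtain E1 where E1: "finite E1" "\<forall>t\<in>{0..1}-E1. (\<rho> has_vector_derivative vd \<rho> t) (at t)"
    using pw_C1_vd(3)[OF \<rho>] by auto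
  obtain E2 where E2: "finite E2" "\<forall>t\<in>{0..1}-E2. (\<phi> has_vector_derivative vd \<phi> t) (at t)"
    using pw_C1_vd(3)[OF \<phi>] by auto
  obtain B where B: "finite B" "\<forall>t\<in>{0..1}-B. \<phi> t \<in> E1 \<longrightarrow>
     (\<exists>t1 t2. 0 \<le> t1 \<and> t1 < t \<and> t < t2 \<and> t2 \<le> 1 \<and> (\<forall>u\<in>{t1..t2}. \<phi> u = \<phi> t))"
    using mono_level_sets[OF mono E1(1)] by auto
  show ?thesis
  proof (intro exI[of _ "B \<union> E2"] conjI ballI)
    fix t assume t: "t \<in> {0..1} - (B \<union> E2)"
    show "vd (\<rho> \<circ> \<phi>) t = vd \<rho> (\<phi> t) * vd \<phi> t"
    proof (cases "\<phi> t \<in> E1")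
      case True
      then obtain t1 t2 where h: "0 \<le> t1" "t1 < t" "t < t2" "t2 \<le> 1" "\<forall>u\<in>{t1..t2}. \<phi> u = \<phi> t"
        using B(2) t True by blast
      have "vd (\<rho> \<circ> \<phi>) t = 0"
        by (rule vd_locally_const[OF h(2,3,1,4), of _ "\<rho> (\<phi> t)"]) (auto intro!: arg_cong[of _ _ \<rho>] bspec[OF h(5)])
      moreover have "vd \<phi> t = 0"
        by (rule vd_locally_const[OF h(2,3,1,4)]) (rule bspec[OF h(5)])
      ultimately show ?thesis by simp
    next
      case False
      have "(\<rho> has_vector_derivative vd \<rho> (\<phi> t)) (at (\<phi> t))"
        using E1(2) range t False by blast
      moreover have "(\<phi> has_vector_derivative vd \<phi> t) (at t)" using E2(2) t by auto
      ultimately have "(\<rho> \<circ> \<phi> has_vector_derivative vd \<phi> t * vd \<rho> (\<phi> t)) (at t)"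
        using vector_diff_chain_at[of \<phi> "vd \<phi> t" t \<rho> "vd \<rho> (\<phi> t)"] by simp
      then have "vd (\<rho> \<circ> \<phi>) t = vd \<phi> t * vd \<rho> (\<phi> t)"
        by (rule vector_derivative_at_within_ivl) (use t in auto)
      then show ?thesis by simp
    qed
  qed (use B E2 in auto)
qed

text \<open>The fundamental theorem of calculus for the composition of \<open>\<phi>\<close> with the indefinite
  integral of \<open>G\<close>.\<close>

lemma integral_substitution_mono:
  assumes G: "pw_cont G" and \<phi>: "pw_C1_real \<phi>" and mono: "mono_on {0..1} \<phi>"
    and range: "\<phi> ` {0..1} \<subseteq> {0..1}"
  shows "((\<lambda>t. G (\<phi> t) * vd \<phi> t) has_integral integral {\<phi> 0..\<phi> 1} G) {0..1}"
proof -
  let ?\<Gamma> = "\<lambda>u. integral {0..u} G"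
  obtain E1 where E1: "finite E1" "\<forall>t\<in>{0..1}-E1. vd ?\<Gamma> t = G t"
    using pw_C1_integral(2)[OF G] by auto
  obtain E2 where E2: "finite E2" "\<forall>t\<in>{0..1}-E2. vd (?\<Gamma> \<circ> \<phi>) t = vd ?\<Gamma> (\<phi> t) * vd \<phi> t"
    using vd_compose[OF pw_C1_integral(1)[OF G] \<phi> mono range] by auto
  obtain B where B: "finite B" "\<forall>t\<in>{0..1}-B. \<phi> t \<in> E1 \<longrightarrow>
     (\<exists>t1 t2. 0 \<le> t1 \<and> t1 < t \<and> t < t2 \<and> t2 \<le> 1 \<and> (\<forall>u\<in>{t1..t2}. \<phi> u = \<phi> t))"
    using mono_level_sets[OF mono E1(1)] by auto
  have e: "G (\<phi> t) * vd \<phi> t = vd (?\<Gamma> \<circ> \<phi>) t" if t: "t \<in> {0..1} - (E2 \<union> B)" for t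
  proof (cases "\<phi> t \<in> E1")
    case True
    then obtain t1 t2 where h: "0 \<le> t1" "t1 < t" "t < t2" "t2 \<le> 1" "\<forall>u\<in>{t1..t2}. \<phi> u = \<phi> t"
      using B(2) t True by blast
    have "vd \<phi> t = 0"
      by (rule vd_locally_const[OF h(2,3,1,4)]) (rule bspec[OF h(5)])
    then show ?thesis using E2(2) t by simp
  next
    case False
    then have "vd ?\<Gamma> (\<phi> t) = G (\<phi> t)" using E1(2) range t by blast
    then show ?thesis using E2(2) t by simp
  qed
  have "(vd (?\<Gamma> \<circ> \<phi>) has_integral ((?\<Gamma> \<circ> \<phi>) 1 - (?\<Gamma> \<circ> \<phi>) 0)) {0..1}"
    by (rule pw_C1_ftc[OF pw_C1_compose[OF pw_C1_integral(1)[OF G] \<phi> mono range]]) auto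
  then have hI: "((\<lambda>t. G (\<phi> t) * vd \<phi> t) has_integral ((?\<Gamma> \<circ> \<phi>) 1 - (?\<Gamma> \<circ> \<phi>) 0)) {0..1}"
    by (rule has_integral_spike_finite[of "E2 \<union> B", rotated 2]) (use e B E2 in auto)
  have "?\<Gamma> (\<phi> 0) + integral {\<phi> 0..\<phi> 1} G = ?\<Gamma> (\<phi> 1)"
  proof -
    have "0 \<le> \<phi> 0" "\<phi> 1 \<le> 1" "\<phi> 0 \<le> \<phi> 1"
      using range mono_onD[OF mono, of 0 1] by (auto simp: image_subset_iff)
    then show ?thesis
      by (intro Henstock_Kurzweil_Integration.integral_combine) (use pw_cont_integrable[OF G] in auto)
  qed
  then have eq: "integral {\<phi> 0..\<phi> 1} G = (?\<Gamma> \<circ> \<phi>) 1 - (?\<Gamma> \<circ> \<phi>) 0" by simp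
  show ?thesis using hI unfolding eq .
qed

text \<open>The lower bound on the derivative makes the inverse Lipschitz. On each piece the difference quotients of
  the inverse are the reciprocals of those of \<open>\<sigma>\<close>, which gives the one-sided
  derivatives at the end points as well.\<close>

lemma pw_C1_inverse:
  assumes \<sigma>: "pw_C1_real \<sigma>" "\<sigma> 0 = 0" "\<sigma> 1 = 1" and E: "finite E" and c: "c > 0"
    "\<And>t. t \<in> {0..1} - E \<Longrightarrow> c \<le> vd \<sigma> t"
  shows "\<exists>\<psi>. pw_C1_real \<psi> \<and> mono_on {0..1} \<psi> \<and> \<psi> ` {0..1} \<subseteq> {0..1} \<and> \<psi> 0 = 0 \<and> \<psi> 1 = 1 \<and>
     (\<forall>s\<in>{0..1}. \<sigma> (\<psi> s) = s)"
proof -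
  have grow: "c * (b - a) \<le> \<sigma> b - \<sigma> a" if "0 \<le> a" "a \<le> b" "b \<le> 1" for a b
  proof -
    have "integral {a..b} (\<lambda>_. c) \<le> integral {a..b} (vd \<sigma>)"
      by (rule integral_mono_finite[OF E]) (use c that pw_cont_integrable[OF pw_C1_vd(1)[OF \<sigma>(1)]] in auto)
    then show ?thesis using integral_unique[OF pw_C1_ftc[OF \<sigma>(1) that]] that by (simp add: mult.commute)
  qed
  have smono: "\<sigma> a < \<sigma> b" if "0 \<le> a" "a < b" "b \<le> 1" for a b
    using grow[of a b] that c by (smt (verit) mult_pos_pos)
  have inj: "a = b" if "\<sigma> a = \<sigma> b" "a \<in> {0..1}" "b \<in> {0..1}" for a b
    using smono[of a b] smono[of b a] that by (cases a b rule: linorder_cases) auto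
  have ex: "\<exists>t. t \<in> {0..1} \<and> \<sigma> t = s" if "s \<in> {0..1}" for s
    using IVT'[of \<sigma> 0 s 1] \<sigma> that pw_C1_vd(2)[OF \<sigma>(1)] by auto
  define \<psi> where "\<psi> = (\<lambda>s. SOME t. t \<in> {0..1} \<and> \<sigma> t = s)"
  have \<psi>: "\<psi> s \<in> {0..1}" "\<sigma> (\<psi> s) = s" if "s \<in> {0..1}" for s
    using someI_ex[OF ex[OF that]] unfolding \<psi>_def by auto
  have \<sigma>r: "\<sigma> t \<in> {0..1}" if "t \<in> {0..1}" for t
    using grow[of 0 t] grow[of t 1] that c \<sigma> by (smt (verit) atLeastAtMost_iff mult_nonneg_nonneg)
  have \<psi>\<sigma>: "\<psi> (\<sigma> t) = t" if "t \<in> {0..1}" for t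
    using inj \<psi>[OF \<sigma>r[OF that]] that by auto
  have \<psi>m: "\<psi> u < \<psi> v" if "u \<in> {0..1}" "v \<in> {0..1}" "u < v" for u v
  proof (rule ccontr)
    assume "\<not> \<psi> u < \<psi> v"
    then have "\<psi> v \<le> \<psi> u" by simp
    moreover have "\<psi> v \<in> {0..1}" "\<psi> u \<in> {0..1}" "\<sigma> (\<psi> u) = u" "\<sigma> (\<psi> v) = v" using \<psi> that by blast+
    ultimately show False using grow[of "\<psi> v" "\<psi> u"] c(1) that(3)
      by (smt (verit) atLeastAtMost_iff mult_nonneg_nonneg)
  qed
  have \<psi>mono: "mono_on {0..1} \<psi>"
    by (rule mono_onI) (metis \<psi>m less_eq_real_def)
  have lip: "\<bar>\<psi> u - \<psi> v\<bar> \<le> (1/c) * \<bar>u - v\<bar>" if "u \<in> {0..1}" "v \<in> {0..1}" for u v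
  proof -
    have *: "\<bar>\<psi> u - \<psi> v\<bar> \<le> (1/c) * \<bar>u - v\<bar>" if "u \<in> {0..1}" "v \<in> {0..1}" "u \<le> v" for u v
      using grow[of "\<psi> u" "\<psi> v"] \<psi>[OF that(1)] \<psi>[OF that(2)] mono_onD[OF \<psi>mono that] c(1) that
      by (auto simp: field_simps)
    show ?thesis using *[of u v] *[of v u] that by (cases "u \<le> v") (auto simp: abs_minus_commute)
  qed
  have cont: "continuous_on {0..1} \<psi>"
    by (rule lipschitz_on_continuous_on[of "1/c"])
       (use lip c in \<open>auto simp: lipschitz_on_def dist_real_def\<close>)
  obtain S where S: "finite S"
     "\<And>a b. 0 \<le> a \<and> a < b \<and> b \<le> 1 \<and> {a<..<b} \<inter> S = {} \<Longrightarrow> C1_piece \<sigma> UNIV a b"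
    using \<sigma>(1) unfolding pw_C1_real_iff by auto
  have "pw_C1_real \<psi>" unfolding pw_C1_real_iff
  proof (intro exI[of _ "\<sigma> ` S"] conjI allI impI)
    fix u v assume uv: "0 \<le> u \<and> u < v \<and> v \<le> 1 \<and> {u<..<v} \<inter> \<sigma> ` S = {}"
    let ?a = "\<psi> u" and ?b = "\<psi> v"
    have ab: "?a \<in> {0..1}" "?b \<in> {0..1}" "?a < ?b" "\<sigma> ?a = u" "\<sigma> ?b = v"
      using \<psi> \<psi>m uv by auto
    have "{?a<..<?b} \<inter> S = {}"
    proof (rule ccontr)
      assume "{?a<..<?b} \<inter> S \<noteq> {}"
      then obtain s where s: "s \<in> S" "?a < s" "s < ?b" by auto
      then have "u < \<sigma> s" "\<sigma> s < v" using smono[of ?a s] smono[of s ?b] ab by auto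
      then show False using uv s by auto
    qed
    then have "C1_piece \<sigma> UNIV ?a ?b" using S(2) ab by auto
    then obtain D where D: "continuous_on {?a..?b} D"
        "\<forall>t\<in>{?a..?b}. (\<sigma> has_vector_derivative D t) (at t within {?a..?b})"
      unfolding C1_piece_UNIV by auto
    have lim: "((\<lambda>y. (\<sigma> y - \<sigma> t) / (y - t)) \<longlongrightarrow> D t) (at t within {?a..?b})" if "t \<in> {?a..?b}" for t
      using D(2) that
      by (simp add: has_real_derivative_iff_has_vector_derivative[symmetric] has_field_derivative_iff)
    have Dpos: "c \<le> D t" if t: "t \<in> {?a..?b}" for t
    proof (rule tendsto_lowerbound[OF lim[OF t]])
      show "\<forall>\<^sub>F y in at t within {?a..?b}. c \<le> (\<sigma> y - \<sigma> t) / (y - t)"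
        unfolding eventually_at_topological
      proof (intro exI[of _ UNIV] conjI ballI impI)
        fix y assume y: "y \<noteq> t" "y \<in> {?a..?b}"
        show "c \<le> (\<sigma> y - \<sigma> t) / (y - t)"
          using grow[of t y] grow[of y t] t y ab by (cases "y < t") (auto simp: field_simps)
      qed auto
      show "at t within {?a..?b} \<noteq> bot"
        using t ab trivial_limit_within[of t "{?a..?b}"] islimpt_Icc[of ?a ?b t] by simp
    qed
    have im: "\<psi> ` {u..v} \<subseteq> {?a..?b}"
      using mono_onD[OF \<psi>mono] uv by auto
    have contuv: "continuous_on {u..v} \<psi>" using continuous_on_subset[OF cont] uv by auto
    show "C1_piece \<psi> UNIV u v" unfolding C1_piece_UNIV
    proof (intro exI[of _ "\<lambda>s. inverse (D (\<psi> s))"] conjI ballI)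
      fix s assume s: "s \<in> {u..v}"
      have t: "\<psi> s \<in> {?a..?b}" using im s by blast
      have "filterlim \<psi> (at (\<psi> s) within {?a..?b}) (at s within {u..v})"
        unfolding filterlim_at
      proof (intro conjI)
        show "\<forall>\<^sub>F x in at s within {u..v}. \<psi> x \<in> {?a..?b} \<and> \<psi> x \<noteq> \<psi> s"
          unfolding eventually_at_topological
        proof (intro exI[of _ UNIV] conjI ballI impI)
          fix x assume x: "x \<noteq> s" "x \<in> {u..v}"
          then show "\<psi> x \<in> {?a..?b}" using im by blast
          show "\<psi> x \<noteq> \<psi> s" using x s uv \<psi>[of x] \<psi>[of s] by auto
        qed auto
        show "(\<psi> \<longlongrightarrow> \<psi> s) (at s within {u..v})"
          using contuv s by (auto simp: continuous_on_def)
      qed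
      from filterlim_compose[OF lim[OF t] this]
      have "((\<lambda>x. (\<sigma> (\<psi> x) - \<sigma> (\<psi> s)) / (\<psi> x - \<psi> s)) \<longlongrightarrow> D (\<psi> s)) (at s within {u..v})" by simp
      from tendsto_inverse[OF this]
      have "((\<lambda>x. inverse ((\<sigma> (\<psi> x) - \<sigma> (\<psi> s)) / (\<psi> x - \<psi> s))) \<longlongrightarrow> inverse (D (\<psi> s))) (at s within {u..v})"
        using Dpos[OF t] c by auto
      then have "((\<lambda>x. (\<psi> x - \<psi> s) / (x - s)) \<longlongrightarrow> inverse (D (\<psi> s))) (at s within {u..v})"
      proof (rule Lim_transform_eventually)
        show "\<forall>\<^sub>F x in at s within {u..v}.
          inverse ((\<sigma> (\<psi> x) - \<sigma> (\<psi> s)) / (\<psi> x - \<psi> s)) = (\<psi> x - \<psi> s) / (x - s)"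
          unfolding eventually_at_topological
          by (intro exI[of _ UNIV] conjI ballI impI) (use s uv \<psi> in auto)
      qed
      then show "(\<psi> has_vector_derivative inverse (D (\<psi> s))) (at s within {u..v})"
        by (simp add: has_real_derivative_iff_has_vector_derivative[symmetric] has_field_derivative_iff)
    next
      show "continuous_on {u..v} (\<lambda>s. inverse (D (\<psi> s)))"
        by (intro continuous_intros continuous_on_compose2[OF D(1)] contuv im)
           (use Dpos im c in force)
    qed
  qed (use S in auto)
  moreover have "\<psi> 0 = 0" "\<psi> 1 = 1" using \<psi>\<sigma>[of 0] \<psi>\<sigma>[of 1] \<sigma> by auto
  ultimately show ?thesis using \<psi> \<psi>mono by (intro exI[of _ \<psi>]) auto
qed

section \<open>Joining curves\<close>

definition join_paths :: "(real \<Rightarrow> 'a) \<Rightarrow> (real \<Rightarrow> 'a) \<Rightarrow> real \<Rightarrow> 'a" where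
  "join_paths c1 c2 t = (if t \<le> 1/2 then c1 (2*t) else c2 (2*t - 1))"

lemma join_paths_ends [simp]: "join_paths c1 c2 0 = c1 0" "join_paths c1 c2 1 = c2 1"
  by (auto simp: join_paths_def)

text \<open>The two halves are pieces of different curves, hence the separate conditions \<open>P1\<close> and
  \<open>P2\<close>.\<close>

lemma join_pieces:
  assumes S1: "finite S1" "\<And>a b. 0 \<le> a \<and> a < b \<and> b \<le> 1 \<and> {a<..<b} \<inter> S1 = {} \<Longrightarrow> P1 a b"
    and S2: "finite S2" "\<And>a b. 0 \<le> a \<and> a < b \<and> b \<le> 1 \<and> {a<..<b} \<inter> S2 = {} \<Longrightarrow> P2 a b"
    and 1: "\<And>a b. 0 \<le> a \<Longrightarrow> a < b \<Longrightarrow> b \<le> 1/2 \<Longrightarrow> P1 (2*a) (2*b) \<Longrightarrow> P a b"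
    and 2: "\<And>a b. 1/2 \<le> a \<Longrightarrow> a < b \<Longrightarrow> b \<le> 1 \<Longrightarrow> P2 (2*a-1) (2*b-1) \<Longrightarrow> P a b"
  shows "\<exists>S. finite S \<and> (\<forall>a b. 0 \<le> a \<and> a < b \<and> b \<le> (1::real) \<and> {a<..<b} \<inter> S = {} \<longrightarrow> P a b)"
proof (intro exI[of _ "{1/2} \<union> (\<lambda>s. s/2) ` S1 \<union> (\<lambda>s. (s+1)/2) ` S2"] conjI allI impI)
  fix a b :: real
  assume ab: "0 \<le> a \<and> a < b \<and> b \<le> 1 \<and> {a<..<b} \<inter> ({1/2} \<union> (\<lambda>s. s/2) ` S1 \<union> (\<lambda>s. (s+1)/2) ` S2) = {}"
  then consider "b \<le> 1/2" | "1/2 \<le> a" by force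
  then show "P a b"
  proof cases
    case 1
    have "{2*a<..<2*b} \<inter> S1 = {}"
    proof (rule ccontr)
      assume "{2*a<..<2*b} \<inter> S1 \<noteq> {}"
      then obtain s where "s \<in> S1" "2*a < s" "s < 2*b" by auto
      then have "s/2 \<in> {a<..<b} \<inter> ((\<lambda>s. s/2) ` S1)" by auto
      then show False using ab by blast
    qed
    then show ?thesis using assms(5) S1(2)[of "2*a" "2*b"] ab 1 by auto
  next
    case 2
    have "{2*a-1<..<2*b-1} \<inter> S2 = {}"
    proof (rule ccontr)
      assume "{2*a-1<..<2*b-1} \<inter> S2 \<noteq> {}"
      then obtain s where "s \<in> S2" "2*a-1 < s" "s < 2*b-1" by auto
      then have "(s+1)/2 \<in> {a<..<b} \<inter> ((\<lambda>s. (s+1)/2) ` S2)" by auto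
      then show False using ab by blast
    qed
    then show ?thesis using assms(6) S2(2)[of "2*a-1" "2*b-1"] ab 2 by auto
  qed
qed (use S1 S2 in auto)

lemma C1_piece_join1:
  assumes "C1_piece F1 A1 (2*a) (2*b)" "b \<le> 1/2"
  shows "C1_piece (join_paths F1 F2) {t. if t \<le> 1/2 then 2*t \<in> A1 else X t} a b"
  by (rule C1_piece_cong[OF C1_piece_affine[of F1 A1 2 a 0 b]]) (use assms in \<open>auto simp: join_paths_def\<close>)

lemma C1_piece_join2:
  assumes "C1_piece F2 A2 (2*a-1) (2*b-1)" "1/2 \<le> a" "F1 1 = F2 0" "1 \<in> A1 \<longleftrightarrow> 0 \<in> A2"
  shows "C1_piece (join_paths F1 F2) {t. if t \<le> 1/2 then 2*t \<in> A1 else 2*t-1 \<in> A2} a b"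
proof (rule C1_piece_cong[OF C1_piece_affine[of F2 A2 2 a "-1" b]])
  fix t assume t: "t \<in> {a..b}"
  show "F2 (2*t + -1) = join_paths F1 F2 t"
  proof (cases "t = 1/2")
    case True show ?thesis by (simp add: join_paths_def True assms(3))
  next
    case False then show ?thesis using t assms by (simp add: join_paths_def)
  qed
  show "t \<in> {t. 2*t + -1 \<in> A2} \<longleftrightarrow> t \<in> {t. if t \<le> 1/2 then 2*t \<in> A1 else 2*t-1 \<in> A2}"
  proof (cases "t = 1/2")
    case True show ?thesis by (simp add: True assms(4))
  next
    case False then show ?thesis using t assms by simp
  qed
qed (use assms in auto)

lemma pw_C1_join:
  assumes "pw_C1_real \<rho>1" "pw_C1_real \<rho>2" "\<rho>1 1 = \<rho>2 0"
  shows "pw_C1_real (join_paths \<rho>1 \<rho>2)"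
proof -
  obtain S1 where S1: "finite S1"
     "\<And>a b. 0 \<le> a \<and> a < b \<and> b \<le> 1 \<and> {a<..<b} \<inter> S1 = {} \<Longrightarrow> C1_piece \<rho>1 UNIV a b"
    using assms(1) unfolding pw_C1_real_iff by auto
  obtain S2 where S2: "finite S2"
     "\<And>a b. 0 \<le> a \<and> a < b \<and> b \<le> 1 \<and> {a<..<b} \<inter> S2 = {} \<Longrightarrow> C1_piece \<rho>2 UNIV a b"
    using assms(2) unfolding pw_C1_real_iff by auto
  show ?thesis unfolding pw_C1_real_iff
  proof (rule join_pieces[OF S1 S2])
    fix a b :: real assume "b \<le> 1/2" "C1_piece \<rho>1 UNIV (2*a) (2*b)"
    from C1_piece_join1[OF this(2,1), of \<rho>2 "\<lambda>_. True"]
    show "C1_piece (join_paths \<rho>1 \<rho>2) UNIV a b" by (simp only: UNIV_I if_cancel Collect_const simp_thms if_True)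
  next
    fix a b :: real assume "1/2 \<le> a" "C1_piece \<rho>2 UNIV (2*a-1) (2*b-1)"
    from C1_piece_join2[of \<rho>2 UNIV a b \<rho>1 UNIV, OF this(2,1) assms(3)]
    show "C1_piece (join_paths \<rho>1 \<rho>2) UNIV a b" by (simp only: UNIV_I if_cancel Collect_const simp_thms if_True)
  qed auto
qed

lemma has_derivative_join:
  assumes "t \<in> {0<..<1} - {1/2}"
    "t < 1/2 \<Longrightarrow> (F1 has_vector_derivative D1) (at (2*t))"
    "t > 1/2 \<Longrightarrow> (F2 has_vector_derivative D2) (at (2*t - 1))"
  shows "(join_paths F1 F2 has_vector_derivative (2 *\<^sub>R (if t < 1/2 then D1 else D2))) (at t)"
proof (cases "t < 1/2")
  case True
  have "((F1 \<circ> (\<lambda>t. 2*t)) has_vector_derivative 2 *\<^sub>R D1) (at t)"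
    by (rule vector_diff_chain_at) (use True assms in \<open>auto intro!: derivative_eq_intros\<close>)
  then have "(join_paths F1 F2 has_vector_derivative 2 *\<^sub>R D1) (at t)"
    by (rule has_vector_derivative_transform_within_open[of _ _ _ "{..<1/2}"])
       (use True in \<open>auto simp: join_paths_def\<close>)
  then show ?thesis using True by simp
next
  case False
  then have t: "t > 1/2" using assms by auto
  have "((F2 \<circ> (\<lambda>t. 2*t - 1)) has_vector_derivative 2 *\<^sub>R D2) (at t)"
    by (rule vector_diff_chain_at) (use t assms in \<open>auto intro!: derivative_eq_intros\<close>)
  then have "(join_paths F1 F2 has_vector_derivative 2 *\<^sub>R D2) (at t)"
    by (rule has_vector_derivative_transform_within_open[of _ _ _ "{1/2<..}"])
       (use t in \<open>auto simp: join_paths_def\<close>)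
  then show ?thesis using t by simp
qed

text \<open>Exceptional parameters of the two halves, seen in the parameter of the joined curve. The parameter
  \<open>1/2\<close>, where the halves meet, is exceptional too.\<close>

lemma join_exceptional:
  fixes E1 E2 :: "real set"
  assumes "finite E1" "finite E2"
  shows "\<exists>E. finite E \<and> {0,1/2,1} \<subseteq> E \<and> (\<forall>t\<in>{0..1}-E. (t < 1/2 \<longrightarrow> 2*t \<in> {0..1} - E1) \<and>
    (t > 1/2 \<longrightarrow> 2*t-1 \<in> {0..1} - E2))"
proof (intro exI[of _ "{0,1/2,1::real} \<union> (\<lambda>s. s/2) ` E1 \<union> (\<lambda>s. (s+1)/2) ` E2"] conjI ballI impI)
  fix t :: real assume t: "t \<in> {0..1} - ({0,1/2,1} \<union> (\<lambda>s. s/2) ` E1 \<union> (\<lambda>s. (s+1)/2) ` E2)"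
  show "2*t \<in> {0..1} - E1" if "t < 1/2"
    using t that image_eqI[of t "\<lambda>s. s/2" "2*t" E1] by auto
  show "2*t-1 \<in> {0..1} - E2" if "t > 1/2"
    using t that image_eqI[of t "\<lambda>s. (s+1)/2" "2*t-1" E2] by auto
qed (use assms in auto)

lemma vd_join:
  assumes "pw_C1_real \<rho>1" "pw_C1_real \<rho>2"
  shows "\<exists>E. finite E \<and> (\<forall>t\<in>{0..1}-E. (t < 1/2 \<longrightarrow> vd (join_paths \<rho>1 \<rho>2) t = 2 * vd \<rho>1 (2*t)) \<and>
    (t > 1/2 \<longrightarrow> vd (join_paths \<rho>1 \<rho>2) t = 2 * vd \<rho>2 (2*t-1)))"
proof -
  obtain E1 where E1: "finite E1" "\<forall>t\<in>{0..1}-E1. (\<rho>1 has_vector_derivative vd \<rho>1 t) (at t)"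
    using pw_C1_vd(3)[OF assms(1)] by auto
  obtain E2 where E2: "finite E2" "\<forall>t\<in>{0..1}-E2. (\<rho>2 has_vector_derivative vd \<rho>2 t) (at t)"
    using pw_C1_vd(3)[OF assms(2)] by auto
  obtain E where E: "finite E" "{0,1/2,1} \<subseteq> E" "\<forall>t\<in>{0..1}-E. (t < 1/2 \<longrightarrow> 2*t \<in> {0..1} - E1) \<and>
    (t > 1/2 \<longrightarrow> 2*t-1 \<in> {0..1} - E2)" using join_exceptional[OF E1(1) E2(1)] by auto
  show ?thesis
  proof (intro exI[of _ E] conjI ballI E(1))
    fix t assume t: "t \<in> {0..1} - E"
    have "0 \<in> E" "1/2 \<in> E" "1 \<in> E" using E(2) by auto
    then have tn: "t \<noteq> 0" "t \<noteq> 1/2" "t \<noteq> 1" using t by blast+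
    have "(join_paths \<rho>1 \<rho>2 has_vector_derivative
       (2 *\<^sub>R (if t < 1/2 then vd \<rho>1 (2*t) else vd \<rho>2 (2*t-1)))) (at t)"
      by (rule has_derivative_join) (use t tn E(3) E1(2) E2(2) in force)+
    then have "vd (join_paths \<rho>1 \<rho>2) t = 2 *\<^sub>R (if t < 1/2 then vd \<rho>1 (2*t) else vd \<rho>2 (2*t-1))"
      by (rule vector_derivative_at_within_ivl) (use t in auto)
    then show "t < 1/2 \<longrightarrow> vd (join_paths \<rho>1 \<rho>2) t = 2 * vd \<rho>1 (2*t)"
      "t > 1/2 \<longrightarrow> vd (join_paths \<rho>1 \<rho>2) t = 2 * vd \<rho>2 (2*t-1)" by auto
  qed
qed

text \<open>Each half is traversed at double speed in half the time, hence lengths add.\<close>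

lemma integral_join:
  assumes G: "pw_cont G" and E: "finite E"
    and 1: "\<And>t. t \<in> {0..1} - E \<Longrightarrow> t < 1/2 \<Longrightarrow> G t = 2 * G1 (2*t)"
    and 2: "\<And>t. t \<in> {0..1} - E \<Longrightarrow> t > 1/2 \<Longrightarrow> G t = 2 * G2 (2*t-1)"
  shows "integral {0..1} G = integral {0..1} G1 + integral {0..1} G2"
proof -
  have "integral {0..1} (\<lambda>t. G (0 + (1/2) * t) * vd (\<lambda>t. 0 + (1/2)*t) t) =
      integral {0 + (1/2)*0 .. 0 + (1/2)*1} G"
    by (rule integral_unique[OF integral_substitution_mono[OF G pw_C1_affine]]) (auto intro!: mono_onI)
  moreover have "integral {0..1} (\<lambda>t. G (0 + (1/2) * t) * vd (\<lambda>t. 0 + (1/2)*t) t) = integral {0..1} G1"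
  proof (rule integral_spike_finite01[of "insert 1 ((\<lambda>s. 2 * s) ` E)"])
    fix t :: real assume t: "t \<in> {0..1} - insert 1 ((\<lambda>s. 2 * s) ` E)"
    then have "t/2 \<notin> E" by force
    then show "G (0 + (1/2) * t) * vd (\<lambda>t. 0 + (1/2)*t) t = G1 t"
      using 1[of "t/2"] t vd_affine[of t 0 "1/2"] by auto
  qed (use E in auto)
  ultimately have a: "integral {0..1/2} G = integral {0..1} G1" by simp
  have "integral {0..1} (\<lambda>t. G (1/2 + (1/2) * t) * vd (\<lambda>t. 1/2 + (1/2)*t) t) =
      integral {1/2 + (1/2)*0 .. 1/2 + (1/2)*1} G"
    by (rule integral_unique[OF integral_substitution_mono[OF G pw_C1_affine]]) (auto intro!: mono_onI)
  moreover have "integral {0..1} (\<lambda>t. G (1/2 + (1/2) * t) * vd (\<lambda>t. 1/2 + (1/2)*t) t) = integral {0..1} G2"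
  proof (rule integral_spike_finite01[of "insert 0 ((\<lambda>s. 2 * s - 1) ` E)"])
    fix t :: real assume t: "t \<in> {0..1} - insert 0 ((\<lambda>s. 2 * s - 1) ` E)"
    have "(t+1)/2 \<notin> E"
    proof
      assume "(t+1)/2 \<in> E"
      then have "2 * ((t+1)/2) - 1 \<in> (\<lambda>s. 2 * s - 1) ` E" by (rule imageI)
      moreover have "2 * ((t+1)/2) - 1 = t" by (simp add: field_simps)
      ultimately show False using t by auto
    qed
    then show "G (1/2 + (1/2) * t) * vd (\<lambda>t. 1/2 + (1/2)*t) t = G2 t"
      using 2[of "(t+1)/2"] t vd_affine[of t "1/2" "1/2"] by (auto simp: field_simps)
  qed (use E in auto)
  ultimately have b: "integral {1/2..1} G = integral {0..1} G2" by simp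
  show ?thesis
    using Henstock_Kurzweil_Integration.integral_combine[of 0 "1/2" 1 G] pw_cont_integrable[OF G] a b by auto
qed

section \<open>Lifting paths and homotopies\<close>

lemma covering_map_sheets:
  assumes "covering_map T B p" "b \<in> topspace B"
  obtains U \<V> where "openin B U" "b \<in> U" "\<Union>\<V> = {a\<in>topspace T. p a \<in> U}"
    "\<forall>V\<in>\<V>. openin T V" "pairwise disjnt \<V>"
    "\<forall>V\<in>\<V>. homeomorphic_map (subtopology T V) (subtopology B U) p"
proof -
  have "\<exists>U. b \<in> U \<and> openin B U \<and>
        (\<exists>\<V>. \<Union>\<V> = {a\<in>topspace T. p a \<in> U} \<and> (\<forall>V\<in>\<V>. openin T V) \<and> pairwise disjnt \<V> \<and>
             (\<forall>V\<in>\<V>. homeomorphic_map (subtopology T V) (subtopology B U) p))"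
    using assms unfolding covering_map_def by simp
  then obtain U \<V> where "b \<in> U" "openin B U" "\<Union>\<V> = {a\<in>topspace T. p a \<in> U}"
    "\<forall>V\<in>\<V>. openin T V" "pairwise disjnt \<V>"
    "\<forall>V\<in>\<V>. homeomorphic_map (subtopology T V) (subtopology B U) p"
    by (elim exE conjE)
  then show ?thesis by (intro that[of U \<V>]) simp_all
qed

text \<open>Distinct sheets over an evenly covered set are disjoint. Hence the set where the lifts agree and the set
  where they differ are both open.\<close>

lemma covering_lift_unique:
  assumes cov: "covering_map T B p" and X: "connected_space X"
    and f1: "continuous_map X T f1" and f2: "continuous_map X T f2"
    and eq: "\<And>x. x \<in> topspace X \<Longrightarrow> p (f1 x) = p (f2 x)"
    and a: "a \<in> topspace X" "f1 a = f2 a" and x: "x \<in> topspace X"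
  shows "f1 x = f2 x"
proof -
  have pc: "continuous_map T B p" using cov unfolding covering_map_def by simp
  let ?A = "{x\<in>topspace X. f1 x = f2 x}" and ?N = "{x\<in>topspace X. f1 x \<noteq> f2 x}"
  have loc: "\<exists>W. openin X W \<and> x \<in> W \<and> (W \<subseteq> ?A \<or> W \<subseteq> ?N)" if x: "x \<in> topspace X" for x
  proof -
    have f1x: "f1 x \<in> topspace T" and f2x: "f2 x \<in> topspace T"
      using continuous_map_image_subset_topspace[OF f1] continuous_map_image_subset_topspace[OF f2] x by auto
    then have "p (f1 x) \<in> topspace B" using continuous_map_image_subset_topspace[OF pc] by auto
    from this obtain U \<V> where
      U: "openin B U" "p (f1 x) \<in> U" "\<Union>\<V> = {a\<in>topspace T. p a \<in> U}"
      "\<forall>V\<in>\<V>. openin T V" "pairwise disjnt \<V>"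
      "\<forall>V\<in>\<V>. homeomorphic_map (subtopology T V) (subtopology B U) p"
      by (rule covering_map_sheets[OF cov])
    have "f1 x \<in> \<Union>\<V>" "f2 x \<in> \<Union>\<V>" using U(2,3) f1x f2x eq[OF x] by auto
    then obtain V V' where V: "V \<in> \<V>" "f1 x \<in> V" "V' \<in> \<V>" "f2 x \<in> V'" by blast
    let ?W = "{x\<in>topspace X. f1 x \<in> V} \<inter> {x\<in>topspace X. f2 x \<in> V'}"
    have "openin X ?W"
      using openin_continuous_map_preimage[OF f1 U(4)[rule_format, OF V(1)]]
        openin_continuous_map_preimage[OF f2 U(4)[rule_format, OF V(3)]] by blast
    moreover have "?W \<subseteq> ?A \<or> ?W \<subseteq> ?N"
    proof (cases "V = V'")
      case True
      have "inj_on p (topspace (subtopology T V))"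
        by (rule homeomorphic_imp_injective_map[OF U(6)[rule_format, OF V(1)]])
      then have "inj_on p V" using openin_subset[OF U(4)[rule_format, OF V(1)]] by (simp add: inf_absorb2)
      then show ?thesis using True eq by (auto dest: inj_onD)
    next
      case False
      then have "V \<inter> V' = {}" using U(5) V by (auto simp: pairwise_def disjnt_def)
      then show ?thesis by auto
    qed
    ultimately show ?thesis using x V by (intro exI[of _ ?W]) auto
  qed
  have "openin X ?A"
  proof (subst openin_subopen, intro ballI)
    fix y assume y: "y \<in> ?A"
    then obtain W where "openin X W" "y \<in> W" "W \<subseteq> ?A \<or> W \<subseteq> ?N" using loc[of y] by auto
    then show "\<exists>T. openin X T \<and> y \<in> T \<and> T \<subseteq> ?A" using y by (intro exI[of _ W]) auto
  qed
  moreover have "openin X ?N"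
  proof (subst openin_subopen, intro ballI)
    fix y assume y: "y \<in> ?N"
    then obtain W where "openin X W" "y \<in> W" "W \<subseteq> ?A \<or> W \<subseteq> ?N" using loc[of y] by auto
    then show "\<exists>T. openin X T \<and> y \<in> T \<and> T \<subseteq> ?N" using y by (intro exI[of _ W]) auto
  qed
  moreover have "?N = topspace X - ?A" by auto
  ultimately have "openin X ?A \<and> closedin X ?A" unfolding closedin_def by auto
  then have "?A = {} \<or> ?A = topspace X" using X unfolding connected_space_clopen_in by blast
  then show ?thesis using a x by auto
qed

lemma continuous_map_paste:
  fixes A C :: "'k::topological_space set"
  assumes "closed A" "closed C"
    and "continuous_map (top_of_set A) T f1" "continuous_map (top_of_set C) T f2"
    and "\<And>x. x \<in> A \<Longrightarrow> x \<in> C \<Longrightarrow> f1 x = f2 x"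
  shows "continuous_map (top_of_set (A \<union> C)) T (\<lambda>x. if x \<in> A then f1 x else f2 x)"
proof (rule pasting_lemma_closed[where I="UNIV::bool set" and T="\<lambda>b. if b then A else C"
      and f="\<lambda>b. if b then f1 else f2"])
  show "closedin (top_of_set (A \<union> C)) (if i then A else C)" for i
    using assms(1,2) by (auto simp: closedin_closed)
  show "continuous_map (subtopology (top_of_set (A \<union> C)) (if i then A else C)) T (if i then f1 else f2)" for i
    using assms(3,4) by (auto simp: subtopology_subtopology inf_absorb2)
  show "(if i then f1 else f2) x = (if j then f1 else f2) x"
    if "x \<in> topspace (top_of_set (A \<union> C)) \<inter> (if i then A else C) \<inter> (if j then A else C)" for i j x
    using that assms(5) by (auto split: if_splits)
  show "\<exists>j. j \<in> UNIV \<and> x \<in> (if j then A else C) \<and> (if x \<in> A then f1 x else f2 x) = (if j then f1 else f2) x"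
    if "x \<in> topspace (top_of_set (A \<union> C))" for x
    using that by (intro exI[of _ "x \<in> A"]) auto
qed auto

lemma pathin_join:
  assumes "pathin T c1" "pathin T c2" "c1 1 = c2 0"
  shows "pathin T (join_paths c1 c2)"
proof -
  have a: "continuous_map (top_of_set {0..1/2}) T (c1 \<circ> (\<lambda>t. 2*t))"
    using assms(1) unfolding pathin_def
    by (intro continuous_map_compose[of _ "top_of_set {0..1}"]) (auto intro!: continuous_intros)
  have b: "continuous_map (top_of_set {1/2..1}) T (c2 \<circ> (\<lambda>t. 2*t-1))"
    using assms(2) unfolding pathin_def
    by (intro continuous_map_compose[of _ "top_of_set {0..1}"]) (auto intro!: continuous_intros)
  have "continuous_map (top_of_set ({0..1/2} \<union> {1/2..1})) T
     (\<lambda>t. if t \<in> {0..1/2} then (c1 \<circ> (\<lambda>t. 2*t)) t else (c2 \<circ> (\<lambda>t. 2*t-1)) t)"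
  proof (rule continuous_map_paste[OF _ _ a b])
    fix x :: real assume "x \<in> {0..1/2}" "x \<in> {1/2..1}"
    then have x: "x = 1/2" by auto
    show "(c1 \<circ> (\<lambda>t. 2*t)) x = (c2 \<circ> (\<lambda>t. 2*t-1)) x" by (simp add: x assms(3))
  qed auto
  moreover have "{0..1/2} \<union> {1/2..1} = {0..1::real}" by auto
  ultimately have "continuous_map (top_of_set {0..1}) T
     (\<lambda>t. if t \<in> {0..1/2} then (c1 \<circ> (\<lambda>t. 2*t)) t else (c2 \<circ> (\<lambda>t. 2*t-1)) t)" by simp
  then show ?thesis unfolding pathin_def
    by (rule continuous_map_eq) (auto simp: join_paths_def)
qed

lemma pathin_reverse:
  assumes "pathin T c" shows "pathin T (\<lambda>t. c (1 - t))"
proof -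
  have "continuous_map (top_of_set {0..1}) T (c \<circ> (\<lambda>t. 1 - t))"
    using assms unfolding pathin_def
    by (intro continuous_map_compose[of _ "top_of_set {0..1}"]) (auto intro!: continuous_intros)
  then show ?thesis unfolding pathin_def by (simp add: o_def)
qed

abbreviation unit_square :: "(real \<times> real) set" where "unit_square \<equiv> {0..1} \<times> {0..1}"

text \<open>Lifts are required for a prescribed value at an arbitrary point of \<open>A\<close>, so that a lift on
  one piece can be continued from a point that it shares with the next.\<close>

definition liftable_on ::
  "'a topology \<Rightarrow> 'b topology \<Rightarrow> ('a \<Rightarrow> 'b) \<Rightarrow> (real \<times> real \<Rightarrow> 'b) \<Rightarrow> (real \<times> real) set \<Rightarrow> bool" where
  "liftable_on T B p H A \<longleftrightarrow> closed A \<and> connected A \<and>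
     (\<forall>a\<in>A. \<forall>e\<in>topspace T. p e = H a \<longrightarrow>
        (\<exists>L. continuous_map (top_of_set A) T L \<and> L a = e \<and> (\<forall>z\<in>A. p (L z) = H z)))"

text \<open>Start the second lift from a value of the first one at a point of the intersection. Uniqueness on the
  connected intersection makes the two lifts agree there, and closed pieces can be pasted.\<close>

lemma liftable_on_Un:
  assumes cov: "covering_map T B p" and A: "liftable_on T B p H A" and C: "liftable_on T B p H C"
    and AC: "connected (A \<inter> C)" "A \<inter> C \<noteq> {}"
  shows "liftable_on T B p H (A \<union> C)"
proof -
  have half: "\<exists>L. continuous_map (top_of_set (A \<union> C)) T L \<and> L a = e \<and> (\<forall>z\<in>A \<union> C. p (L z) = H z)"
    if A: "liftable_on T B p H A" and C: "liftable_on T B p H C"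
      and AC: "connected (A \<inter> C)" "A \<inter> C \<noteq> {}" and a: "a \<in> A" "e \<in> topspace T" "p e = H a" for A C a e
  proof -
    obtain L1 where L1: "continuous_map (top_of_set A) T L1" "L1 a = e" "\<And>z. z\<in>A \<Longrightarrow> p (L1 z) = H z"
      using A a unfolding liftable_on_def by metis
    obtain k where k: "k \<in> A" "k \<in> C" using AC(2) by auto
    have "L1 k \<in> topspace T" using continuous_map_image_subset_topspace[OF L1(1)] k by auto
    then obtain L2 where L2: "continuous_map (top_of_set C) T L2" "L2 k = L1 k" "\<And>z. z\<in>C \<Longrightarrow> p (L2 z) = H z"
      using C k L1(3)[OF k(1)] unfolding liftable_on_def by metis
    have agree: "L1 x = L2 x" if "x \<in> A" "x \<in> C" for x
    proof (rule covering_lift_unique[OF cov, of "top_of_set (A \<inter> C)" L1 L2 k x])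
      show "connected_space (top_of_set (A \<inter> C))"
        using AC(1) connected_space_subtopology connectedin_iff_connected by blast
      show "continuous_map (top_of_set (A \<inter> C)) T L1"
        by (rule continuous_map_from_subtopology_mono[OF L1(1)]) auto
      show "continuous_map (top_of_set (A \<inter> C)) T L2"
        by (rule continuous_map_from_subtopology_mono[OF L2(1)]) auto
    qed (use L1 L2 k that in auto)
    have "closed A" "closed C" using A C unfolding liftable_on_def by auto
    from continuous_map_paste[OF this L1(1) L2(1) agree]
    show ?thesis
      by (intro exI[of _ "\<lambda>x. if x \<in> A then L1 x else L2 x"]) (use L1 L2 a in auto)
  qed
  show ?thesis unfolding liftable_on_def
  proof (intro conjI ballI impI)
    show "closed (A \<union> C)" using A C unfolding liftable_on_def by auto
    show "connected (A \<union> C)" using A C AC(2) unfolding liftable_on_def by (auto intro: connected_Un)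
  next
    fix a e assume a: "a \<in> A \<union> C" "e \<in> topspace T" "p e = H a"
    show "\<exists>L. continuous_map (top_of_set (A \<union> C)) T L \<and> L a = e \<and> (\<forall>z\<in>A \<union> C. p (L z) = H z)"
    proof (cases "a \<in> A")
      case True then show ?thesis using half[OF A C AC] a by blast
    next
      case False
      then have "a \<in> C" using a by auto
      then show ?thesis using half[OF C A, of a e] AC a by (simp add: Int_commute Un_commute)
    qed
  qed
qed

text \<open>By a Lebesgue number, small rectangles are mapped into evenly covered sets and can be lifted.
  Neighbouring rectangles meet in an edge, which is connected, so they are glued to rows and the rows to
  the square.\<close>

lemma covering_lift_square:
  assumes cov: "covering_map T B p" and H: "continuous_map (top_of_set unit_square) B H"
    and e: "e \<in> topspace T" "p e = H (0,0)"
  shows "\<exists>L. continuous_map (top_of_set unit_square) T L \<and> L (0,0) = e \<and>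
     (\<forall>z\<in>unit_square. p (L z) = H z)"
proof -
  let ?K = "unit_square"
  define ev where "ev U \<longleftrightarrow> openin B U \<and> (\<exists>\<V>. \<Union>\<V> = {a\<in>topspace T. p a \<in> U} \<and>
     (\<forall>V\<in>\<V>. openin T V \<and> homeomorphic_map (subtopology T V) (subtopology B U) p))" for U
  have evenly: "liftable_on T B p H A" if A: "closed A" "connected A" "A \<subseteq> ?K" "H ` A \<subseteq> U" and U: "ev U" for A U
    unfolding liftable_on_def
  proof (intro conjI ballI impI A)
    fix a e assume a: "a \<in> A" "e \<in> topspace T" "p e = H a"
    obtain \<V> where V: "\<Union>\<V> = {a\<in>topspace T. p a \<in> U}"
      "\<forall>V\<in>\<V>. openin T V \<and> homeomorphic_map (subtopology T V) (subtopology B U) p"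
      using U unfolding ev_def by auto
    have "e \<in> \<Union>\<V>" using V(1) a A(4) by auto
    then obtain V where V1: "V \<in> \<V>" "e \<in> V" by blast
    obtain s where s: "homeomorphic_maps (subtopology T V) (subtopology B U) p s"
      using V(2) V1 unfolding homeomorphic_map_maps by blast
    have "continuous_map (top_of_set A) B H"
      using continuous_map_from_subtopology_mono[OF H A(3)] .
    then have HA: "continuous_map (top_of_set A) (subtopology B U) H"
      using A(4) by (auto simp: continuous_map_in_subtopology)
    have sc: "continuous_map (subtopology B U) T s"
      using s unfolding homeomorphic_maps_def by (meson continuous_map_into_fulltopology)
    have UB: "U \<subseteq> topspace B" using U openin_subset[of B U] unfolding ev_def by simp
    show "\<exists>L. continuous_map (top_of_set A) T L \<and> L a = e \<and> (\<forall>z\<in>A. p (L z) = H z)"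
    proof (intro exI[of _ "s \<circ> H"] conjI ballI)
      show "continuous_map (top_of_set A) T (s \<circ> H)" by (rule continuous_map_compose[OF HA sc])
      have "\<forall>x\<in>topspace T \<inter> V. s (p x) = x" using s unfolding homeomorphic_maps_def by auto
      then have "s (p e) = e" using a(2) V1(2) by blast
      then show "(s \<circ> H) a = e" using a(3) by simp
      fix z assume "z \<in> A"
      then have "H z \<in> U" using A(4) by blast
      then show "p ((s \<circ> H) z) = H z" using s UB unfolding homeomorphic_maps_def by auto
    qed
  qed
  define \<G> where "\<G> = {G::(real\<times>real) set. open G \<and> (\<exists>U. ev U \<and> H ` (?K \<inter> G) \<subseteq> U)}"
  have cover: "?K \<subseteq> \<Union>\<G>"
  proof
    fix z assume z: "z \<in> ?K"
    then have "H z \<in> topspace B" using continuous_map_image_subset_topspace[OF H] by auto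
    from this obtain U \<V> where
      U: "openin B U" "H z \<in> U" "\<Union>\<V> = {a\<in>topspace T. p a \<in> U}"
      "\<forall>V\<in>\<V>. openin T V" "pairwise disjnt \<V>"
      "\<forall>V\<in>\<V>. homeomorphic_map (subtopology T V) (subtopology B U) p"
      by (rule covering_map_sheets[OF cov])
    then have "ev U" unfolding ev_def by (intro conjI exI[of _ \<V>]) auto
    moreover obtain G where "open G" "{x\<in>?K. H x \<in> U} = ?K \<inter> G"
      using openin_continuous_map_preimage[OF H U(1)] by (auto simp: openin_open)
    ultimately have "G \<in> \<G>" "z \<in> G" unfolding \<G>_def using z U(2) by auto
    then show "z \<in> \<Union>\<G>" by auto
  qed
  have "compact ?K" by (intro compact_Times) auto
  then obtain \<epsilon> where \<epsilon>: "\<epsilon> > 0" "\<And>x. x \<in> ?K \<Longrightarrow> \<exists>G\<in>\<G>. ball x \<epsilon> \<subseteq> G"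
    using Heine_Borel_lemma[of ?K \<G>] cover unfolding \<G>_def by blast
  have small: "liftable_on T B p H ({a..b} \<times> {c..d})"
    if "0 \<le> a" "a \<le> b" "b \<le> 1" "0 \<le> c" "c \<le> d" "d \<le> 1" "b - a < \<epsilon>/2" "d - c < \<epsilon>/2" for a b c d
  proof -
    have sub: "{a..b} \<times> {c..d} \<subseteq> ball (a,c) \<epsilon>"
    proof
      fix z assume z: "z \<in> {a..b} \<times> {c..d}"
      have "dist (a,c) z \<le> dist a (fst z) + dist c (snd z)"
        by (cases z) (simp add: dist_Pair_Pair sqrt_sum_squares_le_sum)
      also have "\<dots> < \<epsilon>" using z that by (auto simp: dist_real_def)
      finally show "z \<in> ball (a,c) \<epsilon>" by simp
    qed
    have "(a,c) \<in> unit_square" using that by auto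
    from \<epsilon>(2)[OF this] obtain G where G: "G \<in> \<G>" "ball (a,c) \<epsilon> \<subseteq> G" by blast
    then obtain U where U: "ev U" "H ` (?K \<inter> G) \<subseteq> U" unfolding \<G>_def by blast
    show ?thesis
    proof (rule evenly[OF _ _ _ _ U(1)])
      show "closed ({a..b} \<times> {c..d})" by (intro closed_Times) auto
      show "connected ({a..b} \<times> {c..d})" by (intro connected_Times) auto
      show K: "{a..b} \<times> {c..d} \<subseteq> ?K" using that by auto
      show "H ` ({a..b} \<times> {c..d}) \<subseteq> U" using K sub G U by blast
    qed
  qed
  have row: "liftable_on T B p H ({0..1} \<times> {c..d})"
    if cd: "0 \<le> c" "c \<le> d" "d \<le> 1" "d - c < \<epsilon>/2" for c d
  proof -
    let ?P = "\<lambda>a b. 0 \<le> a \<and> b \<le> 1 \<longrightarrow> liftable_on T B p H ({a..b} \<times> {c..d})"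
    have "?P 0 1"
    proof (rule Bolzano[where P="?P"])
      fix a b a' assume h: "?P a b" "?P b a'" "a \<le> b" "b \<le> a'"
      show "?P a a'"
      proof
        assume "0 \<le> a \<and> a' \<le> 1"
        then have L: "liftable_on T B p H ({a..b} \<times> {c..d})" "liftable_on T B p H ({b..a'} \<times> {c..d})"
          using h by auto
        have I: "({a..b} \<times> {c..d}) \<inter> ({b..a'} \<times> {c..d}) = {b} \<times> {c..d}" using h(3,4) by auto
        have "connected ({b} \<times> {c..d})" by (intro connected_Times) auto
        then have "liftable_on T B p H (({a..b} \<times> {c..d}) \<union> ({b..a'} \<times> {c..d}))"
          using cd by (intro liftable_on_Un[OF cov L]) (auto simp: I)
        moreover have "({a..b} \<times> {c..d}) \<union> ({b..a'} \<times> {c..d}) = {a..a'} \<times> {c..d}" using h(3,4) by auto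
        ultimately show "liftable_on T B p H ({a..a'} \<times> {c..d})" by simp
      qed
    next
      fix x :: real
      show "\<exists>\<delta>>0. \<forall>a b. a \<le> x \<and> x \<le> b \<and> b - a < \<delta> \<longrightarrow> ?P a b"
        using small cd \<epsilon>(1) by (intro exI[of _ "\<epsilon>/2"]) auto
    qed auto
    then show ?thesis by simp
  qed
  let ?P = "\<lambda>c d. 0 \<le> c \<and> d \<le> 1 \<longrightarrow> liftable_on T B p H ({0..1} \<times> {c..d})"
  have "?P 0 1"
  proof (rule Bolzano[where P="?P"])
    fix a b c assume h: "?P a b" "?P b c" "a \<le> b" "b \<le> c"
    show "?P a c"
    proof
      assume "0 \<le> a \<and> c \<le> 1"
      then have L: "liftable_on T B p H ({0..1} \<times> {a..b})" "liftable_on T B p H ({0..1} \<times> {b..c})"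
        using h by auto
      have I: "({0..1} \<times> {a..b}) \<inter> ({0..1} \<times> {b..c}) = {0..1::real} \<times> {b}" using h(3,4) by auto
      have "connected ({0..1::real} \<times> {b})" by (intro connected_Times) auto
      then have "liftable_on T B p H (({0..1} \<times> {a..b}) \<union> ({0..1} \<times> {b..c}))"
        by (intro liftable_on_Un[OF cov L]) (auto simp: I)
      moreover have "({0..1} \<times> {a..b}) \<union> ({0..1} \<times> {b..c}) = {0..1::real} \<times> {a..c}" using h(3,4) by auto
      ultimately show "liftable_on T B p H ({0..1} \<times> {a..c})" by simp
    qed
  next
    fix x :: real
    show "\<exists>\<delta>>0. \<forall>a b. a \<le> x \<and> x \<le> b \<and> b - a < \<delta> \<longrightarrow> ?P a b"
      using row \<epsilon>(1) by (intro exI[of _ "\<epsilon>/2"]) auto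
  qed auto
  then have "liftable_on T B p H ?K" by simp
  then show ?thesis using e unfolding liftable_on_def by auto
qed

lemma square_slices:
  assumes "continuous_map (top_of_set unit_square) T L" "s \<in> {0..1::real}"
  shows "pathin T (\<lambda>t. L (s,t))" "pathin T (\<lambda>t. L (t,s))"
proof -
  have "continuous_map (top_of_set {0..1}) T (L \<circ> (\<lambda>t. (s,t)))"
    by (rule continuous_map_compose[OF _ assms(1)]) (use assms(2) in \<open>auto intro!: continuous_intros\<close>)
  then show "pathin T (\<lambda>t. L (s,t))" by (simp add: pathin_def o_def)
  have "continuous_map (top_of_set {0..1}) T (L \<circ> (\<lambda>t. (t,s)))"
    by (rule continuous_map_compose[OF _ assms(1)]) (use assms(2) in \<open>auto intro!: continuous_intros\<close>)
  then show "pathin T (\<lambda>t. L (t,s))" by (simp add: pathin_def o_def)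
qed

lemma pathin_topspace: "pathin T c \<Longrightarrow> t \<in> {0..1} \<Longrightarrow> c t \<in> topspace T"
  unfolding pathin_def using continuous_map_image_subset_topspace[of "top_of_set {0..1}" T c] by auto

lemma pathin_constant: "a \<in> topspace T \<Longrightarrow> pathin T (\<lambda>t. a)"
  by (simp add: pathin_def)

lemma covering_lift_path:
  assumes cov: "covering_map T B p" and c: "pathin B c" and e: "e \<in> topspace T" "p e = c 0"
  obtains c' where "pathin T c'" "c' 0 = e" "\<And>t. t \<in> {0..1} \<Longrightarrow> p (c' t) = c t"
proof -
  have "continuous_map (top_of_set unit_square) B (c \<circ> snd)"
    by (rule continuous_map_compose[OF _ c[unfolded pathin_def]]) (auto intro!: continuous_intros)
  from covering_lift_square[OF cov this e(1)] e(2) obtain L where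
    L: "continuous_map (top_of_set unit_square) T L" "L (0,0) = e"
     "\<forall>z\<in>unit_square. p (L z) = (c \<circ> snd) z" by auto
  show ?thesis
    by (rule that[OF square_slices(1)[OF L(1), of 0]]) (use L in auto)
qed

lemma path_lift_unique:
  assumes cov: "covering_map T B p" and "pathin T c1" "pathin T c2"
    and "\<And>t. t \<in> {0..1} \<Longrightarrow> p (c1 t) = p (c2 t)" "s \<in> {0..1}" "c1 s = c2 s" "t \<in> {0..1}"
  shows "c1 t = c2 t"
proof (rule covering_lift_unique[OF cov, of "top_of_set {0..1}" c1 c2 s t])
  show "connected_space (top_of_set {0..1::real})"
    using connected_space_subtopology[of euclidean "{0..1::real}"] by simp
qed (use assms in \<open>auto simp: pathin_def\<close>)

lemma lift_of_constant_closed: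
  assumes cov: "covering_map T B p" and "pathin T c" "\<And>t. t \<in> {0..1} \<Longrightarrow> p (c t) = k"
  shows "c 0 = c 1"
  using path_lift_unique[OF cov assms(2) pathin_constant[of "c 0" T], of 0 1] assms(3)
    pathin_topspace[OF assms(2), of 0] by auto

text \<open>Whether a lift of a loop closes up depends only on the free homotopy class of the loop: the two vertical
  edges of the lifted square lift the same path, because every stage of the homotopy is a loop, and they
  agree at the end of the homotopy.\<close>

lemma lift_closed_homotopy:
  assumes cov: "covering_map T B p" and H: "continuous_map (top_of_set unit_square) B H"
    and loops: "\<And>s. s \<in> {0..1} \<Longrightarrow> H (s,0) = H (s,1)"
    and end1: "\<And>c. pathin T c \<Longrightarrow> (\<And>t. t \<in> {0..1} \<Longrightarrow> p (c t) = H (1,t)) \<Longrightarrow> c 0 = c 1"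
    and c: "pathin T c" "\<And>t. t \<in> {0..1} \<Longrightarrow> p (c t) = H (0,t)"
  shows "c 0 = c 1"
proof -
  obtain L where L: "continuous_map (top_of_set unit_square) T L" "L (0,0) = c 0"
     "\<And>z. z\<in>unit_square \<Longrightarrow> p (L z) = H z"
    using covering_lift_square[OF cov H, of "c 0"] pathin_topspace[OF c(1), of 0] c(2)[of 0] by auto
  have 0: "L (0,1) = c 1"
    by (rule path_lift_unique[OF cov square_slices(1)[OF L(1), of 0] c(1), of 0 1]) (use L c in auto)
  have 1: "L (1,0) = L (1,1)"
    by (rule end1[OF square_slices(1)[OF L(1), of 1]]) (use L(3) in auto)
  have "L (0,0) = L (0,1)"
    by (rule path_lift_unique[OF cov square_slices(2)[OF L(1), of 0] square_slices(2)[OF L(1), of 1], of 1 0])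
       (use L(3) loops 1 in auto)
  then show ?thesis using 0 L(2) by simp
qed

lemma simply_connected_contract:
  assumes "simply_connected_space T" "pathin T c" "c 0 = c 1"
  obtains K where "continuous_map (top_of_set unit_square) T K"
    "\<And>t. K (0,t) = c t" "\<And>t. K (1,t) = c 0" "\<And>s. s \<in> {0..1} \<Longrightarrow> K (s,0) = K (s,1)"
proof -
  have "pathin T (\<lambda>t. c 0)" using pathin_constant pathin_topspace[OF assms(2), of 0] by auto
  then have "homotopic_with (\<lambda>l. l 1 = l 0) (top_of_set {0..1}) T c (\<lambda>t. c 0)"
    using assms unfolding simply_connected_space_def by simp
  then obtain K where "continuous_map (prod_topology (top_of_set {0..1::real}) (top_of_set {0..1::real})) T K"
    "\<forall>t. K (0,t) = c t" "\<forall>t. K (1,t) = c 0" "\<forall>s\<in>{0..1}. K (s,1) = K (s,0)"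
    unfolding homotopic_with_def by (auto simp: image_def)
  then show ?thesis by (intro that[of K]) auto
qed

text \<open>The image of a loop of a simply connected space is freely homotopic to a constant loop.\<close>

lemma lift_of_loop_closed:
  assumes T: "simply_connected_space T" and \<pi>: "continuous_map T B \<pi>" and cov: "covering_map T' B p"
    and \<alpha>: "pathin T \<alpha>" "\<alpha> 0 = \<alpha> 1" and \<beta>: "pathin T' \<beta>" "\<And>t. t \<in> {0..1} \<Longrightarrow> p (\<beta> t) = \<pi> (\<alpha> t)"
  shows "\<beta> 0 = \<beta> 1"
proof -
  obtain K where K: "continuous_map (top_of_set unit_square) T K"
    "\<And>t. K (0,t) = \<alpha> t" "\<And>t. K (1,t) = \<alpha> 0" "\<And>s. s \<in> {0..1} \<Longrightarrow> K (s,0) = K (s,1)"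
    using simply_connected_contract[OF T \<alpha>] by metis
  show ?thesis
  proof (rule lift_closed_homotopy[OF cov continuous_map_compose[OF K(1) \<pi>]])
    fix c assume c: "pathin T' c" "\<And>t. t \<in> {0..1} \<Longrightarrow> p (c t) = (\<pi> \<circ> K) (1,t)"
    show "c 0 = c 1" by (rule lift_of_constant_closed[OF cov c(1), of "\<pi> (\<alpha> 0)"]) (simp add: c(2) K(3))
  qed (use K \<beta> in auto)
qed

section \<open>Linked points of two covers\<close>

text \<open>Both covers lie over the base of \<open>p\<close>, the first one through \<open>\<pi>\<close>. Linked
  pairs are joined by paths with the same image there. This relation replaces a lift of
  \<open>\<pi> \<circ> q\<close> to a map between the covers, and lifting paths is enough to work with it.\<close>

definition linked ::
  "'x topology \<Rightarrow> ('x \<Rightarrow> 'b) \<Rightarrow> 'c topology \<Rightarrow> ('c \<Rightarrow> 'n) \<Rightarrow> ('b \<Rightarrow> 'n) \<Rightarrow> 'x \<times> 'c \<Rightarrow> 'x \<times> 'c \<Rightarrow> bool" where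
  "linked TX q TN p \<pi> u v \<longleftrightarrow> (\<exists>\<alpha> \<beta>. pathin TX \<alpha> \<and> pathin TN \<beta> \<and>
     (\<forall>t\<in>{0..1}. p (\<beta> t) = \<pi> (q (\<alpha> t))) \<and> (\<alpha> 0, \<beta> 0) = u \<and> (\<alpha> 1, \<beta> 1) = v)"

lemma linkedI:
  assumes "pathin TX \<alpha>" "pathin TN \<beta>" "\<And>t. t \<in> {0..1} \<Longrightarrow> p (\<beta> t) = \<pi> (q (\<alpha> t))"
  shows "linked TX q TN p \<pi> (\<alpha> 0, \<beta> 0) (\<alpha> 1, \<beta> 1)"
  unfolding linked_def using assms by blast

lemma linked_sym:
  assumes "linked TX q TN p \<pi> u v" shows "linked TX q TN p \<pi> v u"
proof -
  obtain \<alpha> \<beta> where *: "pathin TX \<alpha>" "pathin TN \<beta>" "\<forall>t\<in>{0..1}. p (\<beta> t) = \<pi> (q (\<alpha> t))"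
     "(\<alpha> 0, \<beta> 0) = u" "(\<alpha> 1, \<beta> 1) = v" using assms unfolding linked_def by metis
  then show ?thesis unfolding linked_def
    by (intro exI[of _ "\<lambda>t. \<alpha> (1-t)"] exI[of _ "\<lambda>t. \<beta> (1-t)"]) (auto intro: pathin_reverse)
qed

lemma linked_trans:
  assumes "linked TX q TN p \<pi> u v" "linked TX q TN p \<pi> v w" shows "linked TX q TN p \<pi> u w"
proof -
  obtain \<alpha> \<beta> where 1: "pathin TX \<alpha>" "pathin TN \<beta>" "\<forall>t\<in>{0..1}. p (\<beta> t) = \<pi> (q (\<alpha> t))"
     "(\<alpha> 0, \<beta> 0) = u" "(\<alpha> 1, \<beta> 1) = v" using assms(1) unfolding linked_def by metis
  obtain \<alpha>' \<beta>' where 2: "pathin TX \<alpha>'" "pathin TN \<beta>'" "\<forall>t\<in>{0..1}. p (\<beta>' t) = \<pi> (q (\<alpha>' t))"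
     "(\<alpha>' 0, \<beta>' 0) = v" "(\<alpha>' 1, \<beta>' 1) = w" using assms(2) unfolding linked_def by metis
  have "\<alpha> 1 = \<alpha>' 0" "\<beta> 1 = \<beta>' 0" using 1 2 by auto
  then show ?thesis unfolding linked_def
    by (intro exI[of _ "join_paths \<alpha> \<alpha>'"] exI[of _ "join_paths \<beta> \<beta>'"] conjI pathin_join)
       (use 1 2 in \<open>auto simp: join_paths_def\<close>)
qed

text \<open>Deck transformations do not change the images in the base.\<close>

lemma linked_deck:
  assumes "linked TX q TN p \<pi> (x,y) (x',y')" "g \<in> deck TX q" "\<gamma> \<in> deck TN p"
  shows "linked TX q TN p \<pi> (g x, \<gamma> y) (g x', \<gamma> y')"
proof -
  obtain \<alpha> \<beta> where *: "pathin TX \<alpha>" "pathin TN \<beta>" "\<forall>t\<in>{0..1}. p (\<beta> t) = \<pi> (q (\<alpha> t))"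
     "(\<alpha> 0, \<beta> 0) = (x,y)" "(\<alpha> 1, \<beta> 1) = (x',y')" using assms(1) unfolding linked_def by metis
  have "pathin TX (g \<circ> \<alpha>)" "pathin TN (\<gamma> \<circ> \<beta>)"
    using assms(2,3) * by (auto simp: deck_def intro!: pathin_compose homeomorphic_imp_continuous_map)
  then show ?thesis unfolding linked_def
    by (intro exI[of _ "g \<circ> \<alpha>"] exI[of _ "\<gamma> \<circ> \<beta>"])
       (use * assms(2,3) pathin_topspace[OF *(1)] pathin_topspace[OF *(2)] in \<open>auto simp: deck_def\<close>)
qed

lemma linked_exists:
  assumes "covering_map TX BX q" "continuous_map BX BN \<pi>" "covering_map TN BN p" "path_connected_space TX"
    "x \<in> topspace TX" "x' \<in> topspace TX" "y \<in> topspace TN" "p y = \<pi> (q x)"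
  obtains y' where "linked TX q TN p \<pi> (x,y) (x',y')"
proof -
  obtain \<alpha> where \<alpha>: "pathin TX \<alpha>" "\<alpha> 0 = x" "\<alpha> 1 = x'"
    using assms(4,5,6) unfolding path_connected_space_def by metis
  have "pathin BN (\<pi> \<circ> (q \<circ> \<alpha>))"
    using assms(1,2) \<alpha>(1) by (auto simp: covering_map_def intro!: pathin_compose)
  from covering_lift_path[OF assms(3) this assms(7)] assms(8) \<alpha>(2)
  obtain \<beta> where \<beta>: "pathin TN \<beta>" "\<beta> 0 = y" "\<And>t. t \<in> {0..1} \<Longrightarrow> p (\<beta> t) = \<pi> (q (\<alpha> t))"
    by auto
  show ?thesis using that linkedI[of TX \<alpha> TN \<beta> p \<pi> q, OF \<alpha>(1) \<beta>(1,3)] \<alpha> \<beta> by auto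
qed

text \<open>A closed path of the simply connected first cover is contractible, so the paths of the second cover with
  the same image close up as well.\<close>

lemma linked_functional:
  assumes "covering_map TX BX q" "continuous_map BX BN \<pi>" "covering_map TN BN p"
    "simply_connected_space TX" "linked TX q TN p \<pi> (x,y) (x,y')"
  shows "y = y'"
proof -
  obtain \<alpha> \<beta> where *: "pathin TX \<alpha>" "pathin TN \<beta>" "\<forall>t\<in>{0..1}. p (\<beta> t) = \<pi> (q (\<alpha> t))"
     "\<alpha> 0 = x" "\<beta> 0 = y" "\<alpha> 1 = x" "\<beta> 1 = y'" using assms(5) unfolding linked_def by auto
  have \<pi>q: "continuous_map TX BN (\<pi> \<circ> q)"
    by (rule continuous_map_compose[OF _ assms(2)]) (use assms(1) in \<open>simp add: covering_map_def\<close>)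
  have "\<beta> 0 = \<beta> 1"
    by (rule lift_of_loop_closed[where \<alpha>=\<alpha> and \<beta>=\<beta>, OF assms(4) \<pi>q assms(3) *(1) _ *(2)]) (simp_all add: *)
  then show ?thesis using * by simp
qed

section \<open>Topology of the doubly warped product\<close>

abbreviation dw_pr :: "real \<times> 'n \<times> 'm option \<Rightarrow> 'n" where "dw_pr \<equiv> (\<lambda>(r, y, z). y)"

lemma topspace_cyl: "topspace (cyl_top TN TM) = {0..} \<times> topspace TN \<times> topspace TM"
  by (simp add: cyl_top_def)

lemma continuous_collapse: "continuous_map (cyl_top TN TM) (dw_top h TN TM) (collapse h)"
  by (rule quotient_imp_continuous_map[OF quotient_map_collapse])

lemma topspace_dw: "topspace (dw_top h TN TM) = collapse h ` ({0..} \<times> topspace TN \<times> topspace TM)"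
  using quotient_imp_surjective_map[OF quotient_map_collapse[of TN TM h]] topspace_cyl by metis

lemma continuous_dw_pr: "continuous_map (dw_top h TN TM) TN dw_pr"
proof (rule continuous_compose_quotient_map[OF quotient_map_collapse])
  have "continuous_map (cyl_top TN TM) TN (fst \<circ> snd)"
    unfolding cyl_top_def by (intro continuous_map_compose[OF continuous_map_snd continuous_map_fst])
  then show "continuous_map (cyl_top TN TM) TN (dw_pr \<circ> collapse h)"
    by (rule continuous_map_eq) (auto simp: collapse_def)
qed

lemma continuous_map_into_cyl:
  assumes "continuous_map S (top_of_set {0..}) u" "continuous_map S TN v" "continuous_map S TM w"
  shows "continuous_map S (dw_top h TN TM) (\<lambda>x. collapse h (u x, v x, w x))"
proof -
  have "continuous_map S (cyl_top TN TM) (\<lambda>x. (u x, v x, w x))"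
    unfolding cyl_top_def by (intro continuous_map_pairedI assms)
  from continuous_map_compose[OF this continuous_collapse] show ?thesis by (simp add: o_def)
qed

text \<open>The radial deformation of the warped product to the slice over \<open>r = 0\<close>, for the case in
  which the factor \<open>M\<close> is collapsed there.\<close>

definition dw_contract :: "(real \<times> real \<times> 'n \<times> 'm option) \<Rightarrow> real \<times> 'n \<times> 'm option" where
  "dw_contract = (\<lambda>(s, r, y, z). ((1-s)*r, y, if (1-s)*r = 0 then None else z))"

text \<open>Continuity is checked on the cylinder: the product of the collapsing map with the compact unit interval
  is again a quotient map.\<close>

lemma continuous_dw_contract:
  assumes "h 0 = 0"
  shows "continuous_map (prod_topology (top_of_set {0..1}) (dw_top h TN TM)) (dw_top h TN TM) dw_contract"
proof (rule continuous_compose_quotient_map)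
  show "quotient_map (prod_topology (top_of_set {0..1::real}) (cyl_top TN TM))
     (prod_topology (top_of_set {0..1}) (dw_top h TN TM)) (\<lambda>(x,y). (x, collapse h y))"
  proof (rule quotient_map_prod_right[OF _ _ quotient_map_collapse])
    have "compact_space (top_of_set {0..1::real})" by (simp add: compact_space_subtopology)
    then show "locally_compact_space (top_of_set {0..1::real})"
      by (rule compact_imp_locally_compact_space)
    show "Hausdorff_space (top_of_set {0..1::real}) \<or> regular_space (top_of_set {0..1::real})"
      by (simp add: Hausdorff_space_subtopology)
  qed
  let ?P = "prod_topology (top_of_set {0..1::real}) (cyl_top TN TM)"
  let ?G = "\<lambda>x. collapse h ((1 - fst x) * fst (snd x), fst (snd (snd x)), snd (snd (snd x)))"
  have s: "continuous_map ?P (top_of_set {0..1}) fst" by (rule continuous_map_fst)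
  have c: "continuous_map ?P (cyl_top TN TM) snd" by (rule continuous_map_snd)
  have r: "continuous_map ?P (top_of_set {0..}) (fst \<circ> snd)"
    using c unfolding cyl_top_def by (rule continuous_map_compose[OF _ continuous_map_fst])
  have yz: "continuous_map ?P (prod_topology TN TM) (snd \<circ> snd)"
    using c unfolding cyl_top_def by (rule continuous_map_compose[OF _ continuous_map_snd])
  have mult: "continuous_map (top_of_set ({0..1} \<times> {0..})) (top_of_set {0..}) (\<lambda>(s,r). (1-s)*r :: real)"
    by (auto simp: case_prod_unfold intro!: continuous_intros)
  have sr: "continuous_map ?P (top_of_set ({0..1} \<times> {0..})) (\<lambda>x. (fst x, (fst \<circ> snd) x))"
    using continuous_map_pairedI[OF s r] by simp
  have "continuous_map ?P (dw_top h TN TM) ?G"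
  proof (rule continuous_map_into_cyl)
    show "continuous_map ?P (top_of_set {0..}) (\<lambda>x. (1 - fst x) * fst (snd x))"
      using continuous_map_compose[OF sr mult] by (simp add: o_def case_prod_unfold)
    show "continuous_map ?P TN (\<lambda>x. fst (snd (snd x)))"
      using continuous_map_compose[OF yz continuous_map_fst] by (simp add: o_def)
    show "continuous_map ?P TM (\<lambda>x. snd (snd (snd x)))"
      using continuous_map_compose[OF yz continuous_map_snd] by (simp add: o_def)
  qed
  then show "continuous_map ?P (dw_top h TN TM) (dw_contract \<circ> (\<lambda>(x,y). (x, collapse h y)))"
    by (rule continuous_map_eq) (auto simp: dw_contract_def collapse_def assms)
qed

text \<open>This is the injectivity of the homomorphism from the fundamental group of the warped product to that of
  \<open>N\<close>, and the point where the hypothesis on \<open>M\<close> enters. If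
  \<open>h 0 = 0\<close>, a loop is first contracted radially to the slice over \<open>r = 0\<close>, a
  copy of \<open>N\<close>, and then inside that slice. Otherwise the warped product is homeomorphic to
  the cylinder, and the three coordinates of the loop are contracted separately.\<close>

lemma dw_loop_closed:
  assumes cov: "covering_map TX (dw_top h TN' TM) q" and covN: "covering_map TN TN' p"
    and sc: "simply_connected_space TN" and coll: "simply_connected_space TM \<or> h 0 = 0"
    and \<alpha>: "pathin TX \<alpha>" "q (\<alpha> 0) = q (\<alpha> 1)"
    and \<beta>: "pathin TN \<beta>" "\<beta> 0 = \<beta> 1" "\<And>t. t \<in> {0..1} \<Longrightarrow> p (\<beta> t) = dw_pr (q (\<alpha> t))"
  shows "\<alpha> 0 = \<alpha> 1"
proof -
  obtain K where K: "continuous_map (top_of_set unit_square) TN K"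
    "\<And>t. K (0,t) = \<beta> t" "\<And>t. K (1,t) = \<beta> 0" "\<And>s. s \<in> {0..1} \<Longrightarrow> K (s,0) = K (s,1)"
    using simply_connected_contract[OF sc \<beta>(1,2)] by metis
  have pc: "continuous_map TN TN' p" using covN unfolding covering_map_def by simp
  have pK: "continuous_map (top_of_set unit_square) TN' (\<lambda>x. p (K x))"
    using continuous_map_compose[OF K(1) pc] by (simp add: o_def)
  have qc: "continuous_map TX (dw_top h TN' TM) q" using cov unfolding covering_map_def by simp
  have q\<alpha>: "pathin (dw_top h TN' TM) (q \<circ> \<alpha>)" by (rule pathin_compose[OF \<alpha>(1) qc])
  show ?thesis
  proof (cases "h 0 = 0")
    case True
    have "q (\<alpha> 0) \<in> topspace (dw_top h TN' TM)" using pathin_topspace[OF q\<alpha>, of 0] by simp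
    then obtain z0 where z0: "z0 \<in> topspace TM" unfolding topspace_dw by auto
    let ?F = "\<lambda>x. dw_contract (fst x, q (\<alpha> (snd x)))"
    have F: "continuous_map (top_of_set unit_square) (dw_top h TN' TM) ?F"
    proof -
      have "continuous_map (top_of_set unit_square) (dw_top h TN' TM) ((q \<circ> \<alpha>) \<circ> snd)"
        by (rule continuous_map_compose[OF _ q\<alpha>[unfolded pathin_def]]) (auto intro!: continuous_intros)
      moreover have "continuous_map (top_of_set unit_square) (top_of_set {0..1::real}) fst"
        by (auto intro!: continuous_intros)
      ultimately have "continuous_map (top_of_set unit_square)
          (prod_topology (top_of_set {0..1}) (dw_top h TN' TM)) (\<lambda>x. (fst x, ((q \<circ> \<alpha>) \<circ> snd) x))"
        by (intro continuous_map_pairedI)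
      from continuous_map_compose[OF this continuous_dw_contract[where h=h, OF True]] show ?thesis
        by (simp add: o_def)
    qed
    show ?thesis
    proof (rule lift_closed_homotopy[OF cov F])
      fix t assume t: "t \<in> {0..1::real}"
      have "q (\<alpha> t) \<in> topspace (dw_top h TN' TM)" using pathin_topspace[OF q\<alpha> t] by simp
      then show "q (\<alpha> t) = dw_contract (fst (0, t), q (\<alpha> (snd (0, t))))"
        unfolding topspace_dw by (auto simp: dw_contract_def collapse_def True)
    next
      fix c assume c: "pathin TX c" "\<And>t. t \<in> {0..1} \<Longrightarrow> q (c t) = dw_contract (fst (1, t), q (\<alpha> (snd (1, t))))"
      \<comment> \<open>Over radius \<open>0\<close>, \<open>collapse\<close> sends every third coordinate to the same point.\<close>
      let ?E = "\<lambda>x. collapse h (0, p (K x), z0)"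
      have E: "continuous_map (top_of_set unit_square) (dw_top h TN' TM) ?E"
        by (rule continuous_map_into_cyl[OF _ pK]) (use z0 in auto)
      show "c 0 = c 1"
      proof (rule lift_closed_homotopy[OF cov E _ _ c(1)])
        fix c' assume c': "pathin TX c'" "\<And>t. t \<in> {0..1} \<Longrightarrow> q (c' t) = collapse h (0, p (K (1,t)), z0)"
        show "c' 0 = c' 1"
          by (rule lift_of_constant_closed[OF cov c'(1), of "collapse h (0, p (\<beta> 0), z0)"])
             (simp add: c'(2) K(3))
      next
        fix t assume t: "t \<in> {0..1::real}"
        show "q (c t) = collapse h (0, p (K (0,t)), z0)"
          using c(2)[OF t] \<beta>(3)[OF t] by (auto simp: dw_contract_def K(2) collapse_def True split: prod.splits)
      qed (use K(4) in auto)
    qed (use \<alpha> in auto)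
  next
    case False
    then have scM: "simply_connected_space TM" using coll by simp
    have "inj_on (collapse h) (topspace (cyl_top TN' TM))"
      by (auto simp: inj_on_def collapse_def False)
    then have "homeomorphic_map (cyl_top TN' TM) (dw_top h TN' TM) (collapse h)"
      unfolding homeomorphic_map_def using quotient_map_collapse by blast
    then obtain k where k: "homeomorphic_maps (cyl_top TN' TM) (dw_top h TN' TM) (collapse h) k"
      unfolding homeomorphic_map_maps by auto
    let ?w = "\<lambda>t. k (q (\<alpha> t))"
    have kc: "continuous_map (dw_top h TN' TM) (cyl_top TN' TM) k" using k unfolding homeomorphic_maps_def by simp
    have w: "pathin (cyl_top TN' TM) ?w"
      using pathin_compose[OF q\<alpha> kc] by (simp add: o_def)
    have ck: "collapse h (?w t) = q (\<alpha> t)" if "t \<in> {0..1}" for t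
      using k pathin_topspace[OF q\<alpha> that] unfolding homeomorphic_maps_def by simp
    have \<rho>: "pathin (top_of_set {0..}) (\<lambda>t. fst (?w t))"
      using pathin_compose[OF w[unfolded cyl_top_def] continuous_map_fst] by (simp add: o_def)
    have yz: "pathin (prod_topology TN' TM) (\<lambda>t. snd (?w t))"
      using pathin_compose[OF w[unfolded cyl_top_def] continuous_map_snd] by (simp add: o_def)
    have z: "pathin TM (\<lambda>t. snd (snd (?w t)))"
      using pathin_compose[OF yz continuous_map_snd] by (simp add: o_def)
    have "(\<lambda>t. snd (snd (?w t))) 0 = (\<lambda>t. snd (snd (?w t))) 1" using \<alpha>(2) by simp
    from simply_connected_contract[OF scM z this] obtain J where
      J: "continuous_map (top_of_set unit_square) TM J"
      "\<And>t. J (0,t) = snd (snd (?w t))" "\<And>t. J (1,t) = snd (snd (?w 0))" "\<And>s. s \<in> {0..1} \<Longrightarrow> J (s,0) = J (s,1)"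
      by metis
    let ?F = "\<lambda>x. collapse h ((1 - fst x) * fst (?w (snd x)), p (K x), J x)"
    have F: "continuous_map (top_of_set unit_square) (dw_top h TN' TM) ?F"
    proof (rule continuous_map_into_cyl[OF _ pK J(1)])
      have c\<rho>: "continuous_on {0..1} (\<lambda>t. fst (?w t))" "\<And>t. t \<in> {0..1} \<Longrightarrow> 0 \<le> fst (?w t)"
        using \<rho> by (auto simp: pathin_def)
      have "continuous_on unit_square (\<lambda>x. (1 - fst x) * fst (?w (snd x)))"
        by (intro continuous_intros continuous_on_compose2[OF c\<rho>(1)]) auto
      then show "continuous_map (top_of_set unit_square) (top_of_set {0..}) (\<lambda>x. (1 - fst x) * fst (?w (snd x)))"
        using c\<rho>(2) by auto
    qed
    show ?thesis
    proof (rule lift_closed_homotopy[OF cov F])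
      fix c assume c: "pathin TX c" "\<And>t. t \<in> {0..1} \<Longrightarrow>
        q (c t) = collapse h ((1 - fst (1::real, t)) * fst (?w (snd (1::real, t))), p (K (1, t)), J (1, t))"
      show "c 0 = c 1"
        by (rule lift_of_constant_closed[OF cov c(1), of "collapse h (0, p (\<beta> 0), J (1,0))"])
           (simp add: c(2) K(3) J(3))
    next
      fix t assume t: "t \<in> {0..1::real}"
      have "fst (snd (?w t)) = p (\<beta> t)"
      proof -
        have "dw_pr (collapse h (?w t)) = fst (snd (?w t))" by (cases "?w t") (simp add: collapse_def)
        then show ?thesis using ck[OF t] \<beta>(3)[OF t] by simp
      qed
      then have "?w t = ((1 - fst (0::real, t)) * fst (?w (snd (0::real, t))), p (K (0, t)), J (0, t))"
        by (cases "?w t") (simp add: K(2) J(2))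
      then show "q (\<alpha> t) = collapse h ((1 - fst (0::real, t)) * fst (?w (snd (0::real, t))), p (K (0, t)), J (0, t))"
        using ck[OF t] by simp
    qed (use \<alpha> K(4) J(4) in auto)
  qed
qed

text \<open>In the other direction this needs points of one fibre of \<open>q\<close>, so that the path between them
  projects to a loop of the warped product.\<close>

lemma linked_injective:
  assumes "covering_map TX (dw_top h TN' TM) q" "covering_map TN TN' p"
    "simply_connected_space TN" "simply_connected_space TM \<or> h 0 = 0"
    "linked TX q TN p dw_pr (x,y) (x',y)" "q x = q x'"
  shows "x = x'"
proof -
  obtain \<alpha> \<beta> where *: "pathin TX \<alpha>" "pathin TN \<beta>" "\<forall>t\<in>{0..1}. p (\<beta> t) = dw_pr (q (\<alpha> t))"
     "\<alpha> 0 = x" "\<beta> 0 = y" "\<alpha> 1 = x'" "\<beta> 1 = y" using assms(5) unfolding linked_def by auto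
  have "\<alpha> 0 = \<alpha> 1"
    by (rule dw_loop_closed[where \<alpha>=\<alpha> and \<beta>=\<beta>, OF assms(1-4) *(1) _ *(2)]) (use *(3) in \<open>simp_all add: *(4-7) assms(6)\<close>)
  then show ?thesis using * by simp
qed

section \<open>Curves in Riemannian manifolds\<close>

context
  fixes R :: "('p, 'e::real_inner) riem"
  assumes R: "riemannian_manifold R"
begin

lemma orthonormal_frame:
  obtains B :: "'e set" where "finite B" "\<forall>v. v = (\<Sum>b\<in>B. (v \<bullet> b) *\<^sub>R b)" "\<forall>b\<in>B. norm b = 1"
proof -
  obtain B :: "'e set" where B: "finite B" "pairwise orthogonal B" "\<forall>b\<in>B. norm b = 1" "span B = UNIV"
    using R unfolding riemannian_manifold_def by auto
  have "v = (\<Sum>b\<in>B. (v \<bullet> b) *\<^sub>R b)" for v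
    using orthonormal_basis_expand[OF B(2) _ _ B(1), of v] B(3,4) by auto
  then show ?thesis using that B by blast
qed

lemma chart_exists:
  assumes "x \<in> topspace (rtop R)" obtains U \<phi> where "(U, \<phi>) \<in> atlas R" "x \<in> U"
proof -
  have "(\<Union>(U, \<phi>)\<in>atlas R. U) = topspace (rtop R)" using R unfolding riemannian_manifold_def by simp
  then have "x \<in> (\<Union>(U, \<phi>)\<in>atlas R. U)" using assms by simp
  then show ?thesis using that by auto
qed

context
  fixes U \<phi> assumes U: "(U, \<phi>) \<in> atlas R"
begin

lemma chart_open: "openin (rtop R) U" "open (\<phi> ` U)"
  "homeomorphic_map (subtopology (rtop R) U) (top_of_set (\<phi> ` U)) \<phi>"
proof -
  have "\<forall>(U, \<phi>)\<in>atlas R. openin (rtop R) U \<and> open (\<phi> ` U) \<and>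
        homeomorphic_map (subtopology (rtop R) U) (top_of_set (\<phi> ` U)) \<phi>"
    using R unfolding riemannian_manifold_def by simp
  from bspec[OF this U] show "openin (rtop R) U" "open (\<phi> ` U)"
  "homeomorphic_map (subtopology (rtop R) U) (top_of_set (\<phi> ` U)) \<phi>" by auto
qed

lemma chart_subset: "U \<subseteq> topspace (rtop R)"
  by (rule openin_subset[OF chart_open(1)])

lemma chart_inj: "inj_on \<phi> U"
  using homeomorphic_imp_injective_map[OF chart_open(3)] chart_subset by (simp add: inf_absorb2)

lemma chart_inv [simp]: "x \<in> U \<Longrightarrow> inv_into U \<phi> (\<phi> x) = x"
  using chart_inj by simp

lemma chart_open_image: "openin (rtop R) O' \<Longrightarrow> open (\<phi> ` (U \<inter> O'))"
proof -
  assume "openin (rtop R) O'"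
  then have "openin (subtopology (rtop R) U) (U \<inter> O')"
    by (metis inf_commute openin_subtopology)
  then have "openin (top_of_set (\<phi> ` U)) (\<phi> ` (U \<inter> O'))"
    using homeomorphic_imp_open_map[OF chart_open(3)] unfolding open_map_def by blast
  then show ?thesis using chart_open(2) by (metis openin_open_trans open_openin)
qed

lemma chart_inv_continuous: "continuous_map (top_of_set (\<phi> ` U)) (rtop R) (inv_into U \<phi>)"
proof -
  obtain g where g: "homeomorphic_maps (subtopology (rtop R) U) (top_of_set (\<phi> ` U)) \<phi> g"
    using chart_open(3) unfolding homeomorphic_map_maps by auto
  have "continuous_map (top_of_set (\<phi> ` U)) (rtop R) g"
    using g unfolding homeomorphic_maps_def by (meson continuous_map_into_fulltopology)
  moreover have "g a = inv_into U \<phi> a" if a: "a \<in> \<phi> ` U" for a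
  proof -
    obtain x where x: "x \<in> U" "a = \<phi> x" using a by blast
    have "g (\<phi> x) = x" using g x(1) chart_subset unfolding homeomorphic_maps_def by auto
    then show ?thesis using x by simp
  qed
  ultimately show ?thesis by (rule continuous_map_eq) auto
qed

lemma chart_metric: "x \<in> U \<Longrightarrow> bilinear (metr R (U, \<phi>) x)"
  "x \<in> U \<Longrightarrow> u \<noteq> 0 \<Longrightarrow> metr R (U, \<phi>) x u u > 0"
proof -
  have a: "\<forall>(U, \<phi>)\<in>atlas R. \<forall>x\<in>U.
        bilinear (metr R (U, \<phi>) x) \<and>
        (\<forall>u v. metr R (U, \<phi>) x u v = metr R (U, \<phi>) x v u) \<and>
        (\<forall>u. u \<noteq> 0 \<longrightarrow> metr R (U, \<phi>) x u u > 0)"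
    using R unfolding riemannian_manifold_def by (elim conjE)
  then have b: "\<forall>x\<in>U. bilinear (metr R (U, \<phi>) x) \<and>
        (\<forall>u. u \<noteq> 0 \<longrightarrow> metr R (U, \<phi>) x u u > 0)"
    using bspec[OF a U] by simp
  show "x \<in> U \<Longrightarrow> bilinear (metr R (U, \<phi>) x)" using b by simp
  show "x \<in> U \<Longrightarrow> u \<noteq> 0 \<Longrightarrow> metr R (U, \<phi>) x u u > 0" using b by simp
qed

lemma chart_metric_nonneg: "x \<in> U \<Longrightarrow> metr R (U, \<phi>) x u u \<ge> 0"
  using chart_metric(2)[of x u] bilinear_lzero[OF chart_metric(1), of x 0] by (cases "u = 0") auto

lemma chart_metric_scale: "x \<in> U \<Longrightarrow> metr R (U, \<phi>) x (k *\<^sub>R u) (k *\<^sub>R u) = k\<^sup>2 * metr R (U, \<phi>) x u u"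
  by (simp add: bilinear_lmul[OF chart_metric(1)] bilinear_rmul[OF chart_metric(1)] power2_eq_square)

lemma chart_metric_continuous: "continuous_on (\<phi> ` U) (\<lambda>a. metr R (U, \<phi>) (inv_into U \<phi> a) u v)"
proof -
  have a: "\<forall>(U, \<phi>)\<in>atlas R. \<forall>u v.
        smooth_on (\<phi> ` U) (\<lambda>a. metr R (U, \<phi>) (inv_into U \<phi> a) u v)"
    using R unfolding riemannian_manifold_def by (elim conjE)
  have "smooth_on (\<phi> ` U) (\<lambda>a. metr R (U, \<phi>) (inv_into U \<phi> a) u v)"
    using bspec[OF a U] by simp
  then have "Ck_on 0 (\<lambda>a. metr R (U, \<phi>) (inv_into U \<phi> a) u v) (\<phi> ` U)" unfolding smooth_on_def by blast
  then show ?thesis by simp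
qed

lemma continuous_on_chart_curve:
  assumes "pathin (rtop R) c" "A \<subseteq> {0..1}"
  shows "continuous_on {t\<in>A. c t \<in> U} (\<lambda>t. \<phi> (c t))"
proof -
  have "continuous_map (top_of_set {t\<in>A. c t \<in> U}) (subtopology (rtop R) U) c"
    using continuous_map_from_subtopology_mono[OF assms(1)[unfolded pathin_def], of "{t\<in>A. c t \<in> U}"] assms(2)
    by (auto simp: continuous_map_in_subtopology)
  from continuous_map_compose[OF this homeomorphic_imp_continuous_map[OF chart_open(3)]]
  show ?thesis by (auto simp: o_def)
qed

lemma continuous_on_metric_along:
  assumes c: "pathin (rtop R) c" "A \<subseteq> {0..1}" and D: "continuous_on {t\<in>A. c t \<in> U} D"
  shows "continuous_on {t\<in>A. c t \<in> U} (\<lambda>t. metr R (U, \<phi>) (c t) (D t) (D t))"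
proof -
  obtain B :: "'e set" where B: "finite B" "\<forall>v. v = (\<Sum>b\<in>B. (v \<bullet> b) *\<^sub>R b)" "\<forall>b\<in>B. norm b = 1"
    by (rule orthonormal_frame)
  have "continuous_on {t\<in>A. c t \<in> U} (\<lambda>t. metr R (U, \<phi>) (inv_into U \<phi> (\<phi> (c t))) b b')" for b b'
    by (rule continuous_on_compose2[OF chart_metric_continuous continuous_on_chart_curve[OF c]]) auto
  then have m: "continuous_on {t\<in>A. c t \<in> U} (\<lambda>t. metr R (U, \<phi>) (c t) b b')" for b b'
    by (rule continuous_on_eq) simp
  have "continuous_on {t\<in>A. c t \<in> U}
     (\<lambda>t. \<Sum>(b,b')\<in>B\<times>B. (D t \<bullet> b) * ((D t \<bullet> b') * metr R (U, \<phi>) (c t) b b'))"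
    unfolding case_prod_unfold by (intro continuous_intros D m)
  then show ?thesis
  proof (rule continuous_on_eq)
    fix t assume t: "t \<in> {t\<in>A. c t \<in> U}"
    then have bl: "bilinear (metr R (U, \<phi>) (c t))" using chart_metric(1) by simp
    have "metr R (U, \<phi>) (c t) (D t) (D t) =
       metr R (U, \<phi>) (c t) (\<Sum>b\<in>B. (D t \<bullet> b) *\<^sub>R b) (\<Sum>b\<in>B. (D t \<bullet> b) *\<^sub>R b)"
      using arg_cong2[OF B(2)[rule_format, of "D t"] B(2)[rule_format, of "D t"], of "metr R (U, \<phi>) (c t)"] .
    also have "\<dots> = (\<Sum>(b,b')\<in>B\<times>B. (D t \<bullet> b) * ((D t \<bullet> b') * metr R (U, \<phi>) (c t) b b'))"
      unfolding bilinear_sum[OF bl] by (auto intro!: sum.cong simp: bilinear_lmul[OF bl] bilinear_rmul[OF bl])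
    finally show "(\<Sum>(b,b')\<in>B\<times>B. (D t \<bullet> b) * ((D t \<bullet> b') * metr R (U, \<phi>) (c t) b b')) =
       metr R (U, \<phi>) (c t) (D t) (D t)" by simp
  qed
qed

text \<open>In an orthonormal basis of the model space, the metric is given by finitely many continuous
  coefficients.\<close>

lemma chart_metric_bound:
  assumes "x \<in> U"
  shows "\<exists>e>0. \<exists>C\<ge>0. \<forall>y\<in>U. dist (\<phi> y) (\<phi> x) < e \<longrightarrow> (\<forall>u. metr R (U, \<phi>) y u u \<le> C * (norm u)\<^sup>2)"
proof -
  obtain B :: "'e set" where B: "finite B" "\<forall>v. v = (\<Sum>b\<in>B. (v \<bullet> b) *\<^sub>R b)" "\<forall>b\<in>B. norm b = 1"
    by (rule orthonormal_frame)
  let ?m = "\<lambda>a. \<Sum>(b,b')\<in>B\<times>B. \<bar>metr R (U, \<phi>) (inv_into U \<phi> a) b b'\<bar>"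
  have "continuous_on (\<phi> ` U) ?m"
    unfolding case_prod_unfold by (intro continuous_intros chart_metric_continuous)
  then obtain e where e: "e > 0" "\<forall>a\<in>\<phi> ` U. dist a (\<phi> x) < e \<longrightarrow> dist (?m a) (?m (\<phi> x)) < 1"
    using assms unfolding continuous_on_iff by (metis imageI zero_less_one)
  let ?C = "?m (\<phi> x) + 1"
  have "metr R (U, \<phi>) y u u \<le> ?C * (norm u)\<^sup>2" if y: "y \<in> U" "dist (\<phi> y) (\<phi> x) < e" for y u
  proof -
    have bl: "bilinear (metr R (U, \<phi>) y)" using chart_metric(1) y by simp
    have "metr R (U, \<phi>) y u u = metr R (U, \<phi>) y (\<Sum>b\<in>B. (u \<bullet> b) *\<^sub>R b) (\<Sum>b\<in>B. (u \<bullet> b) *\<^sub>R b)"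
      using arg_cong2[OF B(2)[rule_format, of u] B(2)[rule_format, of u], of "metr R (U, \<phi>) y"] .
    also have "\<dots> = (\<Sum>(b,b')\<in>B\<times>B. (u \<bullet> b) * ((u \<bullet> b') * metr R (U, \<phi>) y b b'))"
      unfolding bilinear_sum[OF bl] by (auto intro!: sum.cong simp: bilinear_lmul[OF bl] bilinear_rmul[OF bl])
    also have "\<dots> \<le> (\<Sum>(b,b')\<in>B\<times>B. (norm u)\<^sup>2 * \<bar>metr R (U, \<phi>) y b b'\<bar>)"
    proof (rule sum_mono, clarify)
      fix b b' assume b: "b \<in> B" "b' \<in> B"
      have "\<bar>u \<bullet> b\<bar> \<le> norm u" "\<bar>u \<bullet> b'\<bar> \<le> norm u"
        using Cauchy_Schwarz_ineq2[of u b] Cauchy_Schwarz_ineq2[of u b'] B(3) b by auto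
      then have "\<bar>u \<bullet> b\<bar> * \<bar>u \<bullet> b'\<bar> \<le> norm u * norm u" by (intro mult_mono) auto
      then have "\<bar>u \<bullet> b\<bar> * \<bar>u \<bullet> b'\<bar> * \<bar>metr R (U, \<phi>) y b b'\<bar> \<le> norm u * norm u * \<bar>metr R (U, \<phi>) y b b'\<bar>"
        by (intro mult_right_mono) auto
      moreover have "(u \<bullet> b) * ((u \<bullet> b') * metr R (U, \<phi>) y b b') \<le> \<bar>u \<bullet> b\<bar> * \<bar>u \<bullet> b'\<bar> * \<bar>metr R (U, \<phi>) y b b'\<bar>"
        using abs_ge_self[of "(u \<bullet> b) * ((u \<bullet> b') * metr R (U, \<phi>) y b b')"] by (simp add: abs_mult)
      ultimately show "(u \<bullet> b) * ((u \<bullet> b') * metr R (U, \<phi>) y b b') \<le> (norm u)\<^sup>2 * \<bar>metr R (U, \<phi>) y b b'\<bar>"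
        by (simp add: power2_eq_square)
    qed
    also have "\<dots> = ?m (\<phi> y) * (norm u)\<^sup>2"
      using y by (simp add: sum_distrib_left case_prod_unfold mult.commute)
    also have "\<dots> \<le> ?C * (norm u)\<^sup>2"
    proof (rule mult_right_mono)
      have "dist (?m (\<phi> y)) (?m (\<phi> x)) < 1" using e(2) y by blast
      then show "?m (\<phi> y) \<le> ?C" by (simp add: dist_real_def)
    qed simp
    finally show ?thesis .
  qed
  moreover have "0 \<le> ?m (\<phi> x)" by (intro sum_nonneg) auto
  then have "0 \<le> ?C" by simp
  ultimately show ?thesis using e(1) by blast
qed

end

text \<open>The derivative of a change of charts, and the transformation law of the metric in terms of it.\<close>

lemma transition_C1:
  assumes U: "(U, \<phi>) \<in> atlas R" and V: "(V, \<psi>) \<in> atlas R"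
  obtains D where "\<forall>a\<in>\<phi> ` (U \<inter> V). ((\<psi> \<circ> inv_into U \<phi>) has_derivative D a) (at a)"
    "\<forall>v. continuous_on (\<phi> ` (U \<inter> V)) (\<lambda>a. D a v)"
    "\<forall>x\<in>U \<inter> V. \<forall>u v. metr R (U, \<phi>) x u v = metr R (V, \<psi>) x (D (\<phi> x) u) (D (\<phi> x) v)"
proof -
  let ?\<tau> = "\<psi> \<circ> inv_into U \<phi>" and ?S = "\<phi> ` (U \<inter> V)"
  have S: "open ?S" by (rule chart_open_image[OF U chart_open(1)[OF V]])
  have a: "\<forall>(U, \<phi>)\<in>atlas R. \<forall>(V, \<psi>)\<in>atlas R. smooth_on (\<phi> ` (U \<inter> V)) (\<psi> \<circ> inv_into U \<phi>)"
    using R unfolding riemannian_manifold_def by (elim conjE)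
  have "smooth_on ?S ?\<tau>" using bspec[OF a U] V by auto
  then have "Ck_on (Suc 0) ?\<tau> ?S" unfolding smooth_on_def by blast
  then obtain D where D: "\<forall>x\<in>?S. (?\<tau> has_derivative D x) (at x within ?S)"
    "\<forall>v. continuous_on ?S (\<lambda>x. D x v)" by auto
  have D1: "(?\<tau> has_derivative D x) (at x)" if "x \<in> ?S" for x
  proof -
    have "(?\<tau> has_derivative D x) (at x within ?S)" using D(1) that by blast
    then show ?thesis unfolding at_within_open[OF that S] .
  qed
  have b: "\<forall>(U, \<phi>)\<in>atlas R. \<forall>(V, \<psi>)\<in>atlas R. \<forall>x\<in>U \<inter> V. \<forall>u v.
        metr R (U, \<phi>) x u v =
        (let D = frechet_derivative (\<psi> \<circ> inv_into U \<phi>) (at (\<phi> x))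
         in metr R (V, \<psi>) x (D u) (D v))"
    using R unfolding riemannian_manifold_def by (elim conjE)
  have b1: "\<forall>x\<in>U \<inter> V. \<forall>u v. metr R (U, \<phi>) x u v =
        (let D = frechet_derivative (\<psi> \<circ> inv_into U \<phi>) (at (\<phi> x))
         in metr R (V, \<psi>) x (D u) (D v))"
    using bspec[OF b U] V by auto
  show ?thesis
  proof (rule that[of D])
    show "\<forall>v. continuous_on ?S (\<lambda>a. D a v)" by (rule D(2))
    show "\<forall>a\<in>?S. (?\<tau> has_derivative D a) (at a)" using D1 by blast
    show "\<forall>x\<in>U \<inter> V. \<forall>u v. metr R (U, \<phi>) x u v = metr R (V, \<psi>) x (D (\<phi> x) u) (D (\<phi> x) v)"
    proof (intro ballI allI)
    fix x u v assume x: "x \<in> U \<inter> V"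
    have "D (\<phi> x) = frechet_derivative ?\<tau> (at (\<phi> x))"
      by (rule frechet_derivative_at[OF D1]) (use x in auto)
    then show "metr R (U, \<phi>) x u v = metr R (V, \<psi>) x (D (\<phi> x) u) (D (\<phi> x) v)"
      using b1 x by (simp add: Let_def)
    qed
  qed
qed

lemma eventually_in_open:
  assumes "pathin (rtop R) c" "openin (rtop R) W" "t \<in> {0..1}" "c t \<in> W" "S \<subseteq> {0..1}"
  shows "\<exists>G. open G \<and> t \<in> G \<and> (\<forall>s\<in>S \<inter> G. c s \<in> W)"
proof -
  have "openin (top_of_set {0..1}) {s \<in> topspace (top_of_set {0..1}). c s \<in> W}"
    using openin_continuous_map_preimage[OF assms(1)[unfolded pathin_def] assms(2)] .
  then obtain G where "open G" "{s\<in>{0..1}. c s \<in> W} = {0..1} \<inter> G" by (auto simp: openin_open)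
  then show ?thesis using assms by (intro exI[of _ G]) auto
qed

text \<open>By the chain rule the two coordinate velocities correspond under the derivative of the change of charts.
  One-sided derivatives are allowed, since they occur at the ends of a piece.\<close>

lemma velocity_norm_invariant:
  assumes U: "(U, \<phi>) \<in> atlas R" and V: "(V, \<psi>) \<in> atlas R" and c: "pathin (rtop R) c"
    and t: "t \<in> S" "S \<subseteq> {0..1}" "at t within S \<noteq> bot" "c t \<in> U" "c t \<in> V"
    and u: "((\<phi> \<circ> c) has_vector_derivative u) (at t within S)"
    and v: "((\<psi> \<circ> c) has_vector_derivative v) (at t within S)"
  shows "metr R (U, \<phi>) (c t) u u = metr R (V, \<psi>) (c t) v v"
proof -
  obtain D where D: "\<forall>a\<in>\<phi> ` (U \<inter> V). ((\<psi> \<circ> inv_into U \<phi>) has_derivative D a) (at a)"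
    "\<forall>v. continuous_on (\<phi> ` (U \<inter> V)) (\<lambda>a. D a v)"
    "\<forall>x\<in>U \<inter> V. \<forall>u v. metr R (U, \<phi>) x u v = metr R (V, \<psi>) x (D (\<phi> x) u) (D (\<phi> x) v)"
    by (rule transition_C1[OF U V])
  have tU: "c t \<in> U \<inter> V" using t by simp
  have d: "((\<psi> \<circ> inv_into U \<phi>) has_derivative D (\<phi> (c t))) (at (\<phi> (c t)))"
    by (rule bspec[OF D(1)]) (use tU in auto)
  have "(((\<psi> \<circ> inv_into U \<phi>) \<circ> (\<phi> \<circ> c)) has_derivative (D (\<phi> (c t)) \<circ> (\<lambda>h. h *\<^sub>R u))) (at t within S)"
    by (rule diff_chain_within[OF u[unfolded has_vector_derivative_def]])
       (use has_derivative_at_withinI[OF d] in simp)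
  then have "((\<psi> \<circ> c) has_derivative (D (\<phi> (c t)) \<circ> (\<lambda>h. h *\<^sub>R u))) (at t within S)"
  proof (rule has_derivative_transform_eventually)
    obtain G where "open G" "t \<in> G" "\<forall>s\<in>S \<inter> G. c s \<in> U"
      using eventually_in_open[OF c chart_open(1)[OF U] subsetD[OF t(2,1)] t(4) t(2)] t(1) by auto
    then show "\<forall>\<^sub>F x' in at t within S. ((\<psi> \<circ> inv_into U \<phi>) \<circ> (\<phi> \<circ> c)) x' = (\<psi> \<circ> c) x'"
      unfolding eventually_at_topological
      by (intro exI[of _ G]) (auto simp: chart_inv[OF U])
  qed (use t chart_inv[OF U] in auto)
  moreover have "D (\<phi> (c t)) \<circ> (\<lambda>h. h *\<^sub>R u) = (\<lambda>h. h *\<^sub>R D (\<phi> (c t)) u)"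
    using linear_scale[OF has_derivative_linear[OF d]] by (auto simp: o_def)
  ultimately have "((\<psi> \<circ> c) has_vector_derivative D (\<phi> (c t)) u) (at t within S)"
    unfolding has_vector_derivative_def by simp
  from vector_derivative_unique_within[OF t(3) this v] have "D (\<phi> (c t)) u = v" .
  then show ?thesis using D(3)[rule_format, OF tU] by simp
qed

lemma Icc_not_bot: "a < b \<Longrightarrow> t \<in> {a..b} \<Longrightarrow> at t within {a..b::real} \<noteq> bot"
  using trivial_limit_within[of t "{a..b}"] islimpt_Icc[of a b t] by simp

text \<open>Hence the definite description in \<open>speed\<close> denotes wherever some chart sees a velocity.\<close>

lemma speed_eq:
  assumes c: "pathin (rtop R) c" and t: "t \<in> {0..1}" and U: "(U, \<phi>) \<in> atlas R" "c t \<in> U"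
    and v: "((\<phi> \<circ> c) has_vector_derivative v) (at t within {0..1})"
  shows "speed R c t = sqrt (metr R (U, \<phi>) (c t) v v)"
  unfolding speed_def
proof (rule the_equality)
  show "\<exists>(V, \<psi>)\<in>atlas R. \<exists>w. c t \<in> V \<and>
     ((\<psi> \<circ> c) has_vector_derivative w) (at t within {0..1}) \<and>
     sqrt (metr R (U, \<phi>) (c t) v v) = sqrt (metr R (V, \<psi>) (c t) w w)"
    using U v by (intro bexI[OF _ U(1)]) auto
next
  fix s assume "\<exists>(U, \<phi>)\<in>atlas R. \<exists>v. c t \<in> U \<and>
     ((\<phi> \<circ> c) has_vector_derivative v) (at t within {0..1}) \<and>
     s = sqrt (metr R (U, \<phi>) (c t) v v)"
  then obtain V \<psi> w where V: "(V, \<psi>) \<in> atlas R" "c t \<in> V"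
    "((\<psi> \<circ> c) has_vector_derivative w) (at t within {0..1})" "s = sqrt (metr R (V, \<psi>) (c t) w w)"
    by auto
  show "s = sqrt (metr R (U, \<phi>) (c t) v v)"
    using velocity_norm_invariant[OF U(1) V(1) c t _ _ U(2) V(2) v V(3)] Icc_not_bot[of 0 1 t] t V(4) by simp
qed

definition curve_piece :: "(real \<Rightarrow> 'p) \<Rightarrow> real \<Rightarrow> real \<Rightarrow> bool" where
  "curve_piece c a b \<longleftrightarrow> (\<forall>(U, \<phi>)\<in>atlas R. C1_piece (\<phi> \<circ> c) {t. c t \<in> U} a b)"

lemma curve_pieceD: "curve_piece c a b \<Longrightarrow> (U, \<phi>) \<in> atlas R \<Longrightarrow> C1_piece (\<phi> \<circ> c) {t. c t \<in> U} a b"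
  unfolding curve_piece_def by auto

lemma pw_C1_curve_iff: "pw_C1_curve R c \<longleftrightarrow> pathin (rtop R) c \<and>
   (\<exists>S. finite S \<and> (\<forall>a b. 0 \<le> a \<and> a < b \<and> b \<le> 1 \<and> {a<..<b} \<inter> S = {} \<longrightarrow> curve_piece c a b))"
proof -
  have "pw_C1_curve R c \<longleftrightarrow> pathin (rtop R) c \<and> piecewise01 (curve_piece c)"
    unfolding pw_C1_curve_def curve_piece_def C1_piece_def mem_Collect_eq ..
  moreover have "piecewise01 (curve_piece c) \<longleftrightarrow>
    (\<exists>S. finite S \<and> (\<forall>a b. 0 \<le> a \<and> a < b \<and> b \<le> 1 \<and> {a<..<b} \<inter> S = {} \<longrightarrow> curve_piece c a b))"
    by (rule piecewise01_iff) (auto simp: curve_piece_def intro: C1_piece_subinterval)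
  ultimately show ?thesis by simp
qed

text \<open>Continuity is local, and near each parameter a single chart computes the speed. The chart is chosen
  pointwise, which is harmless by \<open>velocity_norm_invariant\<close>.\<close>

lemma speed_piece:
  assumes c: "pathin (rtop R) c" and p: "curve_piece c a b" and ab: "0 \<le> a" "a < b" "b \<le> 1"
  shows "cont_piece (speed R c) a b"
    and "\<And>t U \<phi>. t \<in> {a<..<b} \<Longrightarrow> (U, \<phi>) \<in> atlas R \<Longrightarrow> c t \<in> U \<Longrightarrow>
      \<exists>v. ((\<phi> \<circ> c) has_vector_derivative v) (at t)"
proof -
  have "\<forall>X\<in>atlas R. \<exists>D. (\<forall>t\<in>{a..b}. c t \<in> fst X \<longrightarrow> ((snd X \<circ> c) has_vector_derivative D t) (at t within {a..b})) \<and>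
     continuous_on {t\<in>{a..b}. c t \<in> fst X} D"
    using p unfolding curve_piece_def C1_piece_def mem_Collect_eq by (simp add: case_prod_unfold)
  then have "\<exists>D. \<forall>X\<in>atlas R. (\<forall>t\<in>{a..b}. c t \<in> fst X \<longrightarrow> ((snd X \<circ> c) has_vector_derivative D X t) (at t within {a..b})) \<and>
     continuous_on {t\<in>{a..b}. c t \<in> fst X} (D X)" by (rule bchoice)
  then obtain D where D0: "\<forall>X\<in>atlas R. (\<forall>t\<in>{a..b}. c t \<in> fst X \<longrightarrow> ((snd X \<circ> c) has_vector_derivative D X t) (at t within {a..b})) \<and>
     continuous_on {t\<in>{a..b}. c t \<in> fst X} (D X)" by (elim exE)
  have D1: "((\<phi> \<circ> c) has_vector_derivative D (U,\<phi>) t) (at t within {a..b})"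
    if "(U,\<phi>) \<in> atlas R" "t \<in> {a..b}" "c t \<in> U" for U \<phi> t
    using bspec[OF D0 that(1)] that by simp
  have D2: "continuous_on {t\<in>{a..b}. c t \<in> U} (D (U,\<phi>))" if "(U,\<phi>) \<in> atlas R" for U \<phi>
    using bspec[OF D0 that(1)] by simp
  have ab01: "{a..b} \<subseteq> {0..1}" using ab by auto
  define \<Phi> where "\<Phi> = (\<lambda>t. SOME X. X \<in> atlas R \<and> c t \<in> fst X)"
  have \<Phi>: "\<Phi> t \<in> atlas R" "c t \<in> fst (\<Phi> t)" if "t \<in> {a..b}" for t
  proof -
    have "c t \<in> topspace (rtop R)" using pathin_topspace[OF c] that ab by auto
    then obtain U \<phi> where "(U, \<phi>) \<in> atlas R" "c t \<in> U" by (rule chart_exists)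
    then have "\<exists>X. X \<in> atlas R \<and> c t \<in> fst X" by (intro exI[of _ "(U,\<phi>)"]) simp
    then have "\<Phi> t \<in> atlas R \<and> c t \<in> fst (\<Phi> t)" unfolding \<Phi>_def by (rule someI_ex)
    then show "\<Phi> t \<in> atlas R" "c t \<in> fst (\<Phi> t)" by auto
  qed
  define H where "H = (\<lambda>t. sqrt (metr R (\<Phi> t) (c t) (D (\<Phi> t) t) (D (\<Phi> t) t)))"
  have H: "H t = sqrt (metr R (U,\<phi>) (c t) (D (U,\<phi>) t) (D (U,\<phi>) t))"
    if "(U,\<phi>) \<in> atlas R" "t \<in> {a..b}" "c t \<in> U" for U \<phi> t
  proof -
    obtain V \<psi> where V: "\<Phi> t = (V,\<psi>)" by (cases "\<Phi> t")
    then have V': "(V,\<psi>) \<in> atlas R" "c t \<in> V" using \<Phi>[OF that(2)] by auto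
    show ?thesis unfolding H_def V
      using velocity_norm_invariant[OF V'(1) that(1) c that(2) ab01 Icc_not_bot[OF ab(2) that(2)] V'(2) that(3)
        D1[OF V'(1) that(2) V'(2)] D1[OF that(1,2,3)]] by simp
  qed
  have "continuous_on {a..b} H"
    unfolding continuous_on_eq_continuous_within
  proof
    fix t assume t: "t \<in> {a..b}"
    obtain U \<phi> where V: "\<Phi> t = (U,\<phi>)" by (cases "\<Phi> t")
    then have U: "(U,\<phi>) \<in> atlas R" "c t \<in> U" using \<Phi>[OF t] by auto
    obtain G where G: "open G" "t \<in> G" "\<forall>s\<in>{a..b} \<inter> G. c s \<in> U"
      using eventually_in_open[OF c chart_open(1)[OF U(1)] _ U(2) ab01] t ab01 by auto
    have "continuous_on {t\<in>{a..b}. c t \<in> U} H"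
    proof (rule continuous_on_eq)
      show "continuous_on {t\<in>{a..b}. c t \<in> U} (\<lambda>t. sqrt (metr R (U,\<phi>) (c t) (D (U,\<phi>) t) (D (U,\<phi>) t)))"
        by (intro continuous_on_real_sqrt continuous_on_metric_along[OF U(1) c ab01] D2 U(1))
    qed (use H[OF U(1)] in auto)
    then have "continuous_on ({a..b} \<inter> G) H" by (rule continuous_on_subset) (use G(3) in auto)
    then have "continuous (at t within {a..b} \<inter> G) H"
      using t G(2) by (simp add: continuous_on_eq_continuous_within)
    moreover have "at t within {a..b} \<inter> G = at t within {a..b}"
      by (rule at_within_nhd[OF G(2,1)]) auto
    ultimately show "continuous (at t within {a..b}) H" by simp
  qed
  moreover have "speed R c t = H t" if t: "t \<in> {a<..<b}" for t
  proof -
    have t': "t \<in> {a..b}" "t \<in> {0..1}" using t ab by auto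
    obtain U \<phi> where V: "\<Phi> t = (U,\<phi>)" by (cases "\<Phi> t")
    then have U: "(U,\<phi>) \<in> atlas R" "c t \<in> U" using \<Phi>[OF t'(1)] by auto
    have "at t within {a..b} = at t" "at t within {0..1} = at t"
      using t ab by (auto intro: at_within_Icc_at)
    then have "((\<phi> \<circ> c) has_vector_derivative D (U,\<phi>) t) (at t within {0..1})"
      using D1[OF U(1) t'(1) U(2)] by simp
    from speed_eq[OF c t'(2) U this] H[OF U(1) t'(1) U(2)] show ?thesis by simp
  qed
  ultimately show "cont_piece (speed R c) a b" unfolding cont_piece_def by blast
  fix t U \<phi> assume t: "t \<in> {a<..<b}" "(U, \<phi>) \<in> atlas R" "c t \<in> U"
  have "at t within {a..b} = at t" using t by (auto intro: at_within_Icc_at)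
  then show "\<exists>v. ((\<phi> \<circ> c) has_vector_derivative v) (at t)"
    using D1[OF t(2) _ t(3)] t(1) by auto
qed

lemma pw_cont_speed:
  assumes "pw_C1_curve R c" shows "pw_cont (speed R c)"
proof -
  have c: "pathin (rtop R) c" using assms unfolding pw_C1_curve_iff by simp
  obtain S where S: "finite S" "\<And>a b. 0 \<le> a \<and> a < b \<and> b \<le> 1 \<and> {a<..<b} \<inter> S = {} \<Longrightarrow> curve_piece c a b"
    using assms unfolding pw_C1_curve_iff by auto
  show ?thesis unfolding pw_cont_def
    by (intro exI[of _ S] conjI allI impI S(1) speed_piece(1)[OF c S(2)]) auto
qed

lemma regular_points:
  assumes "pw_C1_curve R c"
  shows "\<exists>E. finite E \<and> {0,1} \<subseteq> E \<and> (\<forall>t\<in>{0..1}-E. \<exists>(U,\<phi>)\<in>atlas R. \<exists>v. c t \<in> U \<and>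
    ((\<phi> \<circ> c) has_vector_derivative v) (at t) \<and> speed R c t = sqrt (metr R (U,\<phi>) (c t) v v) \<and> 0 \<le> speed R c t)"
proof -
  have c: "pathin (rtop R) c" using assms unfolding pw_C1_curve_iff by simp
  obtain S where S: "finite S" "\<And>a b. 0 \<le> a \<and> a < b \<and> b \<le> 1 \<and> {a<..<b} \<inter> S = {} \<Longrightarrow> curve_piece c a b"
    using assms unfolding pw_C1_curve_iff by auto
  show ?thesis
  proof (intro exI[of _ "S \<union> {0,1}"] conjI ballI)
    fix t :: real assume t: "t \<in> {0..1} - (S \<union> {0,1})"
    obtain d where d: "d > 0" "\<forall>s\<in>S \<union> {0,1}. s \<noteq> t \<longrightarrow> d \<le> dist t s"
      using finite_set_avoid[of "S \<union> {0,1}"] S(1) by blast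
    have free: "{t-d<..<t+d} \<inter> S = {}" "0 \<le> t-d" "t+d \<le> 1"
      using d t by (force simp: dist_real_def)+
    have p: "curve_piece c (t-d) (t+d)" by (rule S(2)) (use free d in auto)
    have "c t \<in> topspace (rtop R)" using pathin_topspace[OF c] t by auto
    then obtain U \<phi> where U: "(U, \<phi>) \<in> atlas R" "c t \<in> U" by (rule chart_exists)
    obtain v where v: "((\<phi> \<circ> c) has_vector_derivative v) (at t)"
      using speed_piece(2)[OF c p free(2) _ free(3) _ U] d(1) by auto
    have sp: "speed R c t = sqrt (metr R (U,\<phi>) (c t) v v)"
      by (rule speed_eq[OF c _ U has_vector_derivative_at_within[OF v]]) (use t in auto)
    show "\<exists>(U,\<phi>)\<in>atlas R. \<exists>v. c t \<in> U \<and>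
      ((\<phi> \<circ> c) has_vector_derivative v) (at t) \<and> speed R c t = sqrt (metr R (U,\<phi>) (c t) v v) \<and> 0 \<le> speed R c t"
      by (intro bexI[OF _ U(1)]) (use U v sp chart_metric_nonneg[OF U] in auto)
  qed (use S in auto)
qed

lemma speed_nonneg:
  assumes "pw_C1_curve R c" shows "\<exists>E. finite E \<and> (\<forall>t\<in>{0..1}-E. 0 \<le> speed R c t)"
proof -
  obtain E where E: "finite E" "\<forall>t\<in>{0..1}-E. \<exists>(U,\<phi>)\<in>atlas R. \<exists>v. c t \<in> U \<and>
    ((\<phi> \<circ> c) has_vector_derivative v) (at t) \<and> speed R c t = sqrt (metr R (U,\<phi>) (c t) v v) \<and> 0 \<le> speed R c t"
    using regular_points[OF assms] by auto
  have "\<forall>t\<in>{0..1}-E. 0 \<le> speed R c t" using E(2) by fastforce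
  then show ?thesis using E(1) by blast
qed

lemma riem_length_nonneg:
  assumes "pw_C1_curve R c" shows "0 \<le> riem_length R c"
proof -
  obtain E where E: "finite E" "\<forall>t\<in>{0..1}-E. 0 \<le> speed R c t" using speed_nonneg[OF assms] by auto
  have "integral {0..1::real} (\<lambda>_. 0) \<le> integral {0..1} (speed R c)"
    by (rule integral_mono_finite[OF E(1)]) (use E pw_cont_integrable[OF pw_cont_speed[OF assms]] in auto)
  then show ?thesis unfolding riem_length_def by simp
qed

lemma pw_C1_curve_cong:
  assumes "pw_C1_curve R c" "\<And>t. t \<in> {0..1} \<Longrightarrow> c t = c' t"
  shows "pw_C1_curve R c'"
proof -
  obtain S where S: "finite S" "\<And>a b. 0 \<le> a \<and> a < b \<and> b \<le> 1 \<and> {a<..<b} \<inter> S = {} \<Longrightarrow> curve_piece c a b"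
    using assms unfolding pw_C1_curve_iff by auto
  have "pathin (rtop R) c'"
    using assms unfolding pw_C1_curve_iff pathin_def by (auto intro: continuous_map_eq)
  moreover have "curve_piece c' a b" if ab: "0 \<le> a \<and> a < b \<and> b \<le> 1 \<and> {a<..<b} \<inter> S = {}" for a b
    unfolding curve_piece_def
  proof (clarify)
    fix U \<phi> assume U: "(U, \<phi>) \<in> atlas R"
    show "C1_piece (\<phi> \<circ> c') {t. c' t \<in> U} a b"
      by (rule C1_piece_cong[OF curve_pieceD[OF S(2)[OF ab] U]]) (use assms(2) ab in auto)
  qed
  ultimately show ?thesis unfolding pw_C1_curve_iff using S(1) by blast
qed

lemma pw_C1_curve_join:
  assumes c1: "pw_C1_curve R c1" and c2: "pw_C1_curve R c2" and eq: "c1 1 = c2 0"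
  shows "pw_C1_curve R (join_paths c1 c2)"
proof -
  obtain S1 where S1: "finite S1" "\<And>a b. 0 \<le> a \<and> a < b \<and> b \<le> 1 \<and> {a<..<b} \<inter> S1 = {} \<Longrightarrow> curve_piece c1 a b"
    using c1 unfolding pw_C1_curve_iff by auto
  obtain S2 where S2: "finite S2" "\<And>a b. 0 \<le> a \<and> a < b \<and> b \<le> 1 \<and> {a<..<b} \<inter> S2 = {} \<Longrightarrow> curve_piece c2 a b"
    using c2 unfolding pw_C1_curve_iff by auto
  have "pathin (rtop R) (join_paths c1 c2)"
    using c1 c2 eq unfolding pw_C1_curve_iff by (auto intro: pathin_join)
  moreover have j: "\<phi> \<circ> join_paths c1 c2 = join_paths (\<phi> \<circ> c1) (\<phi> \<circ> c2)" for \<phi> :: "'p \<Rightarrow> 'e"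
    by (auto simp: join_paths_def)
  have jU: "{t. join_paths c1 c2 t \<in> U} = {t. if t \<le> 1/2 then 2*t \<in> {t. c1 t \<in> U} else 2*t-1 \<in> {t. c2 t \<in> U}}" for U
    by (auto simp: join_paths_def split: if_splits)
  have "\<exists>S. finite S \<and> (\<forall>a b. 0 \<le> a \<and> a < b \<and> b \<le> 1 \<and> {a<..<b} \<inter> S = {} \<longrightarrow> curve_piece (join_paths c1 c2) a b)"
  proof (rule join_pieces[OF S1 S2])
    fix a b :: real assume h: "b \<le> 1/2" "curve_piece c1 (2*a) (2*b)"
    show "curve_piece (join_paths c1 c2) a b"
      unfolding curve_piece_def
    proof clarify
      fix U \<phi> assume U: "(U, \<phi>) \<in> atlas R"
      show "C1_piece (\<phi> \<circ> join_paths c1 c2) {t. join_paths c1 c2 t \<in> U} a b"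
        unfolding j jU by (rule C1_piece_join1[OF curve_pieceD[OF h(2) U] h(1)])
    qed
  next
    fix a b :: real assume h: "1/2 \<le> a" "curve_piece c2 (2*a-1) (2*b-1)"
    show "curve_piece (join_paths c1 c2) a b"
      unfolding curve_piece_def
    proof clarify
      fix U \<phi> assume U: "(U, \<phi>) \<in> atlas R"
      show "C1_piece (\<phi> \<circ> join_paths c1 c2) {t. join_paths c1 c2 t \<in> U} a b"
        unfolding j jU
        by (rule C1_piece_join2[OF curve_pieceD[OF h(2) U] h(1)]) (use eq in auto)
    qed
  qed auto
  ultimately show ?thesis unfolding pw_C1_curve_iff by blast
qed

lemma speed_join:
  assumes c1: "pw_C1_curve R c1" and c2: "pw_C1_curve R c2" and eq: "c1 1 = c2 0"
  shows "\<exists>E. finite E \<and> (\<forall>t\<in>{0..1}-E. t \<noteq> 1/2 \<and> (t < 1/2 \<longrightarrow> speed R (join_paths c1 c2) t = 2 * speed R c1 (2*t)) \<and>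
    (t > 1/2 \<longrightarrow> speed R (join_paths c1 c2) t = 2 * speed R c2 (2*t-1)))"
proof -
  have j: "\<phi> \<circ> join_paths c1 c2 = join_paths (\<phi> \<circ> c1) (\<phi> \<circ> c2)" for \<phi> :: "'p \<Rightarrow> 'e"
    by (auto simp: join_paths_def)
  have pj: "pathin (rtop R) (join_paths c1 c2)"
    using pw_C1_curve_join[OF assms] unfolding pw_C1_curve_iff by simp
  let ?reg = "\<lambda>c t. \<exists>(U,\<phi>)\<in>atlas R. \<exists>v. c t \<in> U \<and>
    ((\<phi> \<circ> c) has_vector_derivative v) (at t) \<and> speed R c t = sqrt (metr R (U,\<phi>) (c t) v v) \<and> 0 \<le> speed R c t"
  obtain E1 where E1: "finite E1" "\<forall>t\<in>{0..1}-E1. ?reg c1 t" using regular_points[OF c1] by auto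
  obtain E2 where E2: "finite E2" "\<forall>t\<in>{0..1}-E2. ?reg c2 t" using regular_points[OF c2] by auto
  obtain E where E: "finite E" "{0,1/2,1} \<subseteq> E" "\<forall>t\<in>{0..1}-E. (t < 1/2 \<longrightarrow> 2*t \<in> {0..1} - E1) \<and>
    (t > 1/2 \<longrightarrow> 2*t-1 \<in> {0..1} - E2)" using join_exceptional[OF E1(1) E2(1)] by auto
  show ?thesis
  proof (intro exI[of _ E] conjI ballI E(1) impI)
    fix t assume t: "t \<in> {0..1} - E"
    have "0 \<in> E" "1/2 \<in> E" "1 \<in> E" using E(2) by auto
    then have tn: "t \<noteq> 0" "t \<noteq> 1/2" "t \<noteq> 1" using t by blast+
    show "t \<noteq> 1/2" by (rule tn(2))
    { assume lt: "t < 1/2"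
      then have "?reg c1 (2*t)" using E(3) E1(2) t by blast
      then obtain U \<phi> v where U: "(U,\<phi>) \<in> atlas R" "c1 (2*t) \<in> U" "((\<phi> \<circ> c1) has_vector_derivative v) (at (2*t))"
        "speed R c1 (2*t) = sqrt (metr R (U,\<phi>) (c1 (2*t)) v v)" by auto
      have jt: "join_paths c1 c2 t = c1 (2*t)" using lt by (simp add: join_paths_def)
      have "((\<phi> \<circ> join_paths c1 c2) has_vector_derivative (2 *\<^sub>R (if t < 1/2 then v else undefined))) (at t)"
        unfolding j by (rule has_derivative_join) (use lt tn t U in auto)
      then have d: "((\<phi> \<circ> join_paths c1 c2) has_vector_derivative (2 *\<^sub>R v)) (at t within {0..1})"
        using lt has_vector_derivative_at_within by auto
      have "speed R (join_paths c1 c2) t = sqrt (metr R (U,\<phi>) (c1 (2*t)) (2 *\<^sub>R v) (2 *\<^sub>R v))"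
        using speed_eq[OF pj _ U(1) _ d] t U(2) jt by simp
      then show "speed R (join_paths c1 c2) t = 2 * speed R c1 (2*t)"
        using U(4) chart_metric_scale[OF U(1,2), of 2 v] by (simp add: real_sqrt_mult) }
    { assume gt: "t > 1/2"
      then have "?reg c2 (2*t-1)" using E(3) E2(2) t by blast
      then obtain U \<phi> v where U: "(U,\<phi>) \<in> atlas R" "c2 (2*t-1) \<in> U" "((\<phi> \<circ> c2) has_vector_derivative v) (at (2*t-1))"
        "speed R c2 (2*t-1) = sqrt (metr R (U,\<phi>) (c2 (2*t-1)) v v)" by auto
      have jt: "join_paths c1 c2 t = c2 (2*t-1)" using gt by (simp add: join_paths_def)
      have "((\<phi> \<circ> join_paths c1 c2) has_vector_derivative (2 *\<^sub>R (if t < 1/2 then undefined else v))) (at t)"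
        unfolding j by (rule has_derivative_join) (use gt tn t U in auto)
      then have d: "((\<phi> \<circ> join_paths c1 c2) has_vector_derivative (2 *\<^sub>R v)) (at t within {0..1})"
        using gt has_vector_derivative_at_within by auto
      have "speed R (join_paths c1 c2) t = sqrt (metr R (U,\<phi>) (c2 (2*t-1)) (2 *\<^sub>R v) (2 *\<^sub>R v))"
        using speed_eq[OF pj _ U(1) _ d] t U(2) jt by simp
      then show "speed R (join_paths c1 c2) t = 2 * speed R c2 (2*t-1)"
        using U(4) chart_metric_scale[OF U(1,2), of 2 v] by (simp add: real_sqrt_mult) }
  qed
qed

lemma pw_C1_curve_const:
  assumes "x \<in> topspace (rtop R)" shows "pw_C1_curve R (\<lambda>t. x)"
proof -
  have "curve_piece (\<lambda>t. x) a b" for a b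
    unfolding curve_piece_def C1_piece_def by (clarify, intro exI[of _ "\<lambda>_. 0"]) (auto simp: o_def)
  then show ?thesis unfolding pw_C1_curve_iff using pathin_constant[OF assms] by auto
qed

lemma speed_const:
  assumes "x \<in> topspace (rtop R)" "t \<in> {0..1}" shows "speed R (\<lambda>t. x) t = 0"
proof -
  obtain U \<phi> where U: "(U, \<phi>) \<in> atlas R" "x \<in> U" by (rule chart_exists[OF assms(1)])
  have "speed R (\<lambda>t. x) t = sqrt (metr R (U,\<phi>) x 0 0)"
    by (rule speed_eq[OF pathin_constant[OF assms(1)] assms(2) U]) (simp add: o_def)
  then show ?thesis using bilinear_lzero[OF chart_metric(1)[OF U], of 0] by simp
qed

section \<open>Connecting points by curves of bounded speed\<close>

text \<open>A bound for the speed instead of the length, because it bounds the integrand of the warped length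
  directly.\<close>

definition bounded_speed :: "real \<Rightarrow> (real \<Rightarrow> 'p) \<Rightarrow> bool" where
  "bounded_speed C c \<longleftrightarrow> pw_C1_curve R c \<and> (\<exists>E. finite E \<and> (\<forall>t\<in>{0..1}-E. speed R c t \<le> C))"

lemma bounded_speed_join:
  assumes "bounded_speed C1 c1" "bounded_speed C2 c2" "c1 1 = c2 0" "2*C1 \<le> C" "2*C2 \<le> C"
  shows "bounded_speed C (join_paths c1 c2)"
proof -
  have c: "pw_C1_curve R c1" "pw_C1_curve R c2" using assms unfolding bounded_speed_def by auto
  obtain E1 where E1: "finite E1" "\<forall>t\<in>{0..1}-E1. speed R c1 t \<le> C1" using assms(1) unfolding bounded_speed_def by auto
  obtain E2 where E2: "finite E2" "\<forall>t\<in>{0..1}-E2. speed R c2 t \<le> C2" using assms(2) unfolding bounded_speed_def by auto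
  obtain E where E: "finite E" "\<forall>t\<in>{0..1}-E. (t < 1/2 \<longrightarrow> 2*t \<in> {0..1} - E1) \<and>
    (t > 1/2 \<longrightarrow> 2*t-1 \<in> {0..1} - E2)" using join_exceptional[OF E1(1) E2(1)] by auto
  obtain E' where E': "finite E'" "\<forall>t\<in>{0..1}-E'. t \<noteq> 1/2 \<and> (t < 1/2 \<longrightarrow> speed R (join_paths c1 c2) t = 2 * speed R c1 (2*t)) \<and>
    (t > 1/2 \<longrightarrow> speed R (join_paths c1 c2) t = 2 * speed R c2 (2*t-1))"
    using speed_join[OF c assms(3)] by auto
  have "speed R (join_paths c1 c2) t \<le> C" if t: "t \<in> {0..1} - (E \<union> E')" for t
  proof (cases "t < 1/2")
    case True
    then have "speed R c1 (2*t) \<le> C1" using E(2) E1(2) t by blast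
    then show ?thesis using E'(2) t True assms(4) by auto
  next
    case False
    then have gt: "t > 1/2" using E'(2) t by force
    then have "speed R c2 (2*t-1) \<le> C2" using E(2) E2(2) t by blast
    then show ?thesis using E'(2) t gt assms(5) by auto
  qed
  then show ?thesis unfolding bounded_speed_def using pw_C1_curve_join[OF c assms(3)] E(1) E'(1) by blast
qed

lemma bounded_speed_mono: "bounded_speed C c \<Longrightarrow> C \<le> C' \<Longrightarrow> bounded_speed C' c"
  unfolding bounded_speed_def by (meson order_trans)

text \<open>Straight segments in a small coordinate ball, where the metric is dominated by a multiple of the
  Euclidean one.\<close>

lemma local_segments:
  assumes x: "x \<in> topspace (rtop R)" "openin (rtop R) O'" "x \<in> O'"
  shows "\<exists>W C. openin (rtop R) W \<and> x \<in> W \<and> 0 \<le> C \<and>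
    (\<forall>w\<in>W. \<forall>w'\<in>W. \<exists>c. bounded_speed C c \<and> c ` {0..1} \<subseteq> O' \<and> c 0 = w \<and> c 1 = w')"
proof -
  obtain U \<phi> where U: "(U, \<phi>) \<in> atlas R" "x \<in> U" by (rule chart_exists[OF x(1)])
  obtain e C where e: "e > 0" "C \<ge> 0"
    "\<forall>y\<in>U. dist (\<phi> y) (\<phi> x) < e \<longrightarrow> (\<forall>u. metr R (U, \<phi>) y u u \<le> C * (norm u)\<^sup>2)"
    using chart_metric_bound[OF U] by auto
  have "open (\<phi> ` (U \<inter> O'))" by (rule chart_open_image[OF U(1) x(2)])
  then obtain e' where e': "e' > 0" "ball (\<phi> x) e' \<subseteq> \<phi> ` (U \<inter> O')"
    using U x(3) open_contains_ball by (metis IntI imageI)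
  define d where "d = min e e'"
  have d: "d > 0" "ball (\<phi> x) d \<subseteq> \<phi> ` (U \<inter> O')" using e e' by (auto simp: d_def)
  let ?W = "{w\<in>U. \<phi> w \<in> ball (\<phi> x) d}"
  have phic: "continuous_map (subtopology (rtop R) U) euclidean \<phi>"
    using homeomorphic_imp_continuous_map[OF chart_open(3)[OF U(1)]]
    by (meson continuous_map_into_fulltopology)
  have "openin (subtopology (rtop R) U) {w\<in>topspace (subtopology (rtop R) U). \<phi> w \<in> ball (\<phi> x) d}"
    by (rule openin_continuous_map_preimage[OF phic]) simp
  moreover have "{w\<in>topspace (subtopology (rtop R) U). \<phi> w \<in> ball (\<phi> x) d} = ?W"
    using chart_subset[OF U(1)] by auto
  ultimately have W: "openin (rtop R) ?W"
    using chart_open(1)[OF U(1)] openin_trans_full by metis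
  have seg: "\<exists>c. bounded_speed (sqrt (C * (2*d)\<^sup>2)) c \<and> c ` {0..1} \<subseteq> O' \<and> c 0 = w \<and> c 1 = w'"
    if w: "w \<in> ?W" "w' \<in> ?W" for w w'
  proof -
    let ?v = "\<phi> w' - \<phi> w"
    define l where "l = (\<lambda>t. \<phi> w + t *\<^sub>R ?v)"
    have lb: "l t \<in> ball (\<phi> x) d" if t: "t \<in> {0..1}" for t
    proof -
      have "l t = (1 - t) *\<^sub>R \<phi> w + t *\<^sub>R \<phi> w'" unfolding l_def by (simp add: algebra_simps)
      then show ?thesis using convexD_alt[OF convex_ball[of "\<phi> x" d], of "\<phi> w" "\<phi> w'" t] w t by auto
    qed
    define c where "c = (\<lambda>t. inv_into U \<phi> (l t))"
    have c: "c t \<in> U \<inter> O'" "\<phi> (c t) = l t" if t: "t \<in> {0..1}" for t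
    proof -
      obtain y where y: "y \<in> U \<inter> O'" "l t = \<phi> y" using lb[OF t] d(2) by blast
      then have "c t = y" unfolding c_def using chart_inv[OF U(1), of y] by simp
      then show "c t \<in> U \<inter> O'" "\<phi> (c t) = l t" using y by auto
    qed
    have lc: "continuous_on A l" for A unfolding l_def by (intro continuous_intros)
    have ld: "(l has_vector_derivative ?v) (at t within A)" for t A
      unfolding l_def by (auto intro!: derivative_eq_intros)
    have "l ` {0..1} \<subseteq> \<phi> ` U" using lb d(2) by blast
    then have "continuous_map (top_of_set {0..1}) (top_of_set (\<phi> ` U)) l" using lc by auto
    from continuous_map_compose[OF this chart_inv_continuous[OF U(1)]]
    have pc: "pathin (rtop R) c" unfolding pathin_def c_def by (simp add: o_def)
    have piece: "curve_piece c a b" if ab: "0 \<le> a" "a < b" "b \<le> 1" for a b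
      unfolding curve_piece_def
    proof clarify
      fix V \<psi> assume V: "(V, \<psi>) \<in> atlas R"
      obtain D where D: "\<forall>a\<in>\<phi> ` (U \<inter> V). ((\<psi> \<circ> inv_into U \<phi>) has_derivative D a) (at a)"
        "\<forall>v. continuous_on (\<phi> ` (U \<inter> V)) (\<lambda>a. D a v)"
        "\<forall>x\<in>U \<inter> V. \<forall>u v. metr R (U, \<phi>) x u v = metr R (V, \<psi>) x (D (\<phi> x) u) (D (\<phi> x) v)"
        by (rule transition_C1[OF U(1) V])
      have lUV: "l t \<in> \<phi> ` (U \<inter> V)" if "t \<in> {a..b}" "c t \<in> V" for t
      proof -
        have "t \<in> {0..1}" using that(1) ab by auto
        from c[OF this] that(2) have "c t \<in> U \<inter> V" "l t = \<phi> (c t)" by auto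
        then show ?thesis by blast
      qed
      show "C1_piece (\<psi> \<circ> c) {t. c t \<in> V} a b"
        unfolding C1_piece_def mem_Collect_eq
      proof (intro exI[of _ "\<lambda>t. D (l t) ?v"] conjI ballI impI)
        fix t assume t: "t \<in> {a..b}" "c t \<in> V"
        have d: "((\<psi> \<circ> inv_into U \<phi>) has_derivative D (l t)) (at (l t))" by (rule bspec[OF D(1) lUV[OF t]])
        have "(((\<psi> \<circ> inv_into U \<phi>) \<circ> l) has_derivative (D (l t) \<circ> (\<lambda>h. h *\<^sub>R ?v))) (at t within {a..b})"
          by (rule diff_chain_within[OF ld[unfolded has_vector_derivative_def]])
             (use has_derivative_at_withinI[OF d] in simp)
        moreover have "D (l t) \<circ> (\<lambda>h. h *\<^sub>R ?v) = (\<lambda>h. h *\<^sub>R D (l t) ?v)"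
          using linear_scale[OF has_derivative_linear[OF d]] by (auto simp: o_def)
        moreover have "(\<psi> \<circ> inv_into U \<phi>) \<circ> l = \<psi> \<circ> c" by (auto simp: c_def)
        ultimately show "((\<psi> \<circ> c) has_vector_derivative D (l t) ?v) (at t within {a..b})"
          unfolding has_vector_derivative_def by simp
      next
        show "continuous_on {t\<in>{a..b}. c t \<in> V} (\<lambda>t. D (l t) ?v)"
          by (rule continuous_on_compose2[OF D(2)[rule_format] lc]) (use lUV in auto)
      qed
    qed
    have pw: "pw_C1_curve R c"
      unfolding pw_C1_curve_iff using pc piece by auto
    have "speed R c t \<le> sqrt (C * (2*d)\<^sup>2)" if t: "t \<in> {0..1}" for t
    proof -
      have "((\<phi> \<circ> c) has_vector_derivative ?v) (at t within {0..1})"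
        by (rule has_vector_derivative_transform[OF t _ ld]) (simp add: c(2))
      then have sp: "speed R c t = sqrt (metr R (U, \<phi>) (c t) ?v ?v)"
        using speed_eq[OF pc t U(1)] c(1)[OF t] by blast
      have "metr R (U, \<phi>) (c t) ?v ?v \<le> C * (norm ?v)\<^sup>2"
        using e(3) c[OF t] lb[OF t] by (auto simp: d_def dist_commute)
      also have "norm ?v \<le> 2*d"
      proof -
        have "dist (\<phi> w') (\<phi> w) \<le> dist (\<phi> x) (\<phi> w') + dist (\<phi> x) (\<phi> w)"
          by (metis dist_commute dist_triangle)
        then show ?thesis using w by (simp add: dist_norm)
      qed
      then have "C * (norm ?v)\<^sup>2 \<le> C * (2*d)\<^sup>2" using e(2) by (intro mult_left_mono power_mono) auto
      finally show ?thesis using sp by simp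
    qed
    then have "bounded_speed (sqrt (C * (2*d)\<^sup>2)) c" unfolding bounded_speed_def using pw by auto
    moreover have "c ` {0..1} \<subseteq> O'" using c(1) by blast
    moreover have "c 0 = w" "c 1 = w'" unfolding c_def l_def using w chart_inv[OF U(1)] by auto
    ultimately show ?thesis by blast
  qed
  show ?thesis
    by (intro exI[of _ ?W] exI[of _ "sqrt (C * (2*d)\<^sup>2)"] conjI ballI seg W)
       (use U(2) d(1) e(2) in auto)
qed

text \<open>The points related to \<open>a\<close> form an open set, and so do the remaining ones.\<close>

lemma connected_space_chain:
  assumes T: "connected_space T" and loc: "\<And>x. x \<in> topspace T \<Longrightarrow> \<exists>W. openin T W \<and> x \<in> W \<and> (\<forall>u\<in>W. \<forall>v\<in>W. Q u v)"
    and trans: "\<And>u v w. Q u v \<Longrightarrow> Q v w \<Longrightarrow> Q u w" and a: "a \<in> topspace T" and b: "b \<in> topspace T"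
  shows "Q a b"
proof -
  let ?S = "{x\<in>topspace T. Q a x}"
  have "openin T ?S"
  proof (subst openin_subopen, intro ballI)
    fix x assume x: "x \<in> ?S"
    then obtain W where W: "openin T W" "x \<in> W" "\<forall>u\<in>W. \<forall>v\<in>W. Q u v" using loc[of x] by auto
    then have "W \<subseteq> ?S" using x trans openin_subset[OF W(1)] by blast
    then show "\<exists>W. openin T W \<and> x \<in> W \<and> W \<subseteq> ?S" using W by blast
  qed
  moreover have "openin T (topspace T - ?S)"
  proof (subst openin_subopen, intro ballI)
    fix x assume x: "x \<in> topspace T - ?S"
    then obtain W where W: "openin T W" "x \<in> W" "\<forall>u\<in>W. \<forall>v\<in>W. Q u v" using loc[of x] by auto
    then have "W \<subseteq> topspace T - ?S" using x trans openin_subset[OF W(1)] by blast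
    then show "\<exists>W. openin T W \<and> x \<in> W \<and> W \<subseteq> topspace T - ?S" using W by blast
  qed
  ultimately have "openin T ?S \<and> closedin T ?S" unfolding closedin_def by auto
  then have "?S = {} \<or> ?S = topspace T" using T unfolding connected_space_clopen_in by blast
  moreover have "a \<in> ?S" using loc[OF a] a by auto
  ultimately show ?thesis using b by auto
qed

text \<open>Locally, segments of the base are lifted through a sheet; connectedness does the rest.\<close>

lemma cover_curves:
  assumes cov: "covering_map T (rtop R) p" and T: "connected_space T"
    and e: "e \<in> topspace T" "e' \<in> topspace T"
  shows "\<exists>\<beta> C. pathin T \<beta> \<and> \<beta> 0 = e \<and> \<beta> 1 = e' \<and> bounded_speed C (p \<circ> \<beta>)"
proof (rule connected_space_chain[OF T _ _ e, where Q="\<lambda>e e'. \<exists>\<beta> C. pathin T \<beta> \<and> \<beta> 0 = e \<and> \<beta> 1 = e' \<and> bounded_speed C (p \<circ> \<beta>)"])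
  fix u v w
  assume "\<exists>\<beta> C. pathin T \<beta> \<and> \<beta> 0 = u \<and> \<beta> 1 = v \<and> bounded_speed C (p \<circ> \<beta>)"
    "\<exists>\<beta> C. pathin T \<beta> \<and> \<beta> 0 = v \<and> \<beta> 1 = w \<and> bounded_speed C (p \<circ> \<beta>)"
  then obtain \<beta>1 C1 \<beta>2 C2 where b: "pathin T \<beta>1" "\<beta>1 0 = u" "\<beta>1 1 = v" "bounded_speed C1 (p \<circ> \<beta>1)"
    "pathin T \<beta>2" "\<beta>2 0 = v" "\<beta>2 1 = w" "bounded_speed C2 (p \<circ> \<beta>2)" by (elim exE conjE)
  have "p \<circ> join_paths \<beta>1 \<beta>2 = join_paths (p \<circ> \<beta>1) (p \<circ> \<beta>2)" by (auto simp: join_paths_def)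
  moreover have "bounded_speed (max (2*C1) (2*C2)) (join_paths (p \<circ> \<beta>1) (p \<circ> \<beta>2))"
    by (rule bounded_speed_join[OF b(4,8)]) (use b in auto)
  ultimately show "\<exists>\<beta> C. pathin T \<beta> \<and> \<beta> 0 = u \<and> \<beta> 1 = w \<and> bounded_speed C (p \<circ> \<beta>)"
    using b by (intro exI[of _ "join_paths \<beta>1 \<beta>2"] exI[of _ "max (2*C1) (2*C2)"]) (auto intro: pathin_join)
next
  fix x assume x: "x \<in> topspace T"
  have pc: "continuous_map T (rtop R) p" using cov unfolding covering_map_def by simp
  have px: "p x \<in> topspace (rtop R)" using continuous_map_image_subset_topspace[OF pc] x by auto
  obtain U \<V> where U: "openin (rtop R) U" "p x \<in> U" "\<Union>\<V> = {a\<in>topspace T. p a \<in> U}"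
      "\<forall>V\<in>\<V>. openin T V" "pairwise disjnt \<V>"
      "\<forall>V\<in>\<V>. homeomorphic_map (subtopology T V) (subtopology (rtop R) U) p"
    by (rule covering_map_sheets[OF cov px])
  have "x \<in> \<Union>\<V>" using U(2,3) x by auto
  then obtain V where V: "V \<in> \<V>" "x \<in> V" by blast
  have oV: "openin T V" using U(4) V(1) by blast
  obtain s where s: "homeomorphic_maps (subtopology T V) (subtopology (rtop R) U) p s"
    using U(6) V(1) unfolding homeomorphic_map_maps by blast
  have sc: "continuous_map (subtopology (rtop R) U) T s"
    using s unfolding homeomorphic_maps_def by (meson continuous_map_into_fulltopology)
  have UR: "U \<subseteq> topspace (rtop R)" "V \<subseteq> topspace T" using U(1) oV openin_subset by auto
  have ps: "p (s y) = y" if "y \<in> U" for y using s that UR unfolding homeomorphic_maps_def by auto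
  have "\<forall>y\<in>V. s (p y) = y" using s UR unfolding homeomorphic_maps_def by auto
  then have sp: "s (p y) = y" if "y \<in> V" for y using that by blast
  obtain W C where W: "openin (rtop R) W" "p x \<in> W" "0 \<le> C"
    "\<forall>w\<in>W. \<forall>w'\<in>W. \<exists>c. bounded_speed C c \<and> c ` {0..1} \<subseteq> U \<and> c 0 = w \<and> c 1 = w'"
    using local_segments[OF px U(1,2)] by auto
  let ?O = "V \<inter> {a\<in>topspace T. p a \<in> W}"
  have "openin T ?O" using oV openin_continuous_map_preimage[OF pc W(1)] by blast
  moreover have "x \<in> ?O" using V W x by auto
  moreover have "\<exists>\<beta> C. pathin T \<beta> \<and> \<beta> 0 = u \<and> \<beta> 1 = v \<and> bounded_speed C (p \<circ> \<beta>)" if uv: "u \<in> ?O" "v \<in> ?O" for u v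
  proof -
    have "p u \<in> W" "p v \<in> W" using uv by auto
    then obtain c where c: "bounded_speed C c" "c ` {0..1} \<subseteq> U" "c 0 = p u" "c 1 = p v"
      using W(4) by blast
    have pwc: "pw_C1_curve R c" using c(1) unfolding bounded_speed_def by simp
    then have "pathin (rtop R) c" unfolding pw_C1_curve_iff by simp
    then have "pathin (subtopology (rtop R) U) c"
      using c(2) unfolding pathin_def by (auto simp: continuous_map_in_subtopology)
    from pathin_compose[OF this sc] have psc: "pathin T (s \<circ> c)" .
    have eq: "p (s (c t)) = c t" if "t \<in> {0..1}" for t
    proof -
      have "c t \<in> U" using c(2) that by blast
      then show ?thesis using ps by simp
    qed
    have "bounded_speed C (p \<circ> (s \<circ> c))"
      unfolding bounded_speed_def
    proof
      show "pw_C1_curve R (p \<circ> (s \<circ> c))" by (rule pw_C1_curve_cong[OF pwc]) (simp add: eq)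
      obtain E where E: "finite E" "\<forall>t\<in>{0..1}-E. speed R c t \<le> C" using c(1) unfolding bounded_speed_def by auto
      obtain E' where E': "finite E'" "\<forall>t\<in>{0..1}-E'. \<exists>(U,\<phi>)\<in>atlas R. \<exists>v. c t \<in> U \<and>
         ((\<phi> \<circ> c) has_vector_derivative v) (at t) \<and> speed R c t = sqrt (metr R (U,\<phi>) (c t) v v) \<and> 0 \<le> speed R c t"
        using regular_points[OF pwc] by auto
      have "speed R (p \<circ> (s \<circ> c)) t \<le> C" if t: "t \<in> {0..1} - (E \<union> E')" for t
      proof -
        have tt: "t \<in> {0..1}" using t by simp
        have "\<exists>(U,\<phi>)\<in>atlas R. \<exists>v. c t \<in> U \<and>
         ((\<phi> \<circ> c) has_vector_derivative v) (at t) \<and> speed R c t = sqrt (metr R (U,\<phi>) (c t) v v) \<and> 0 \<le> speed R c t"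
          using E'(2) t by blast
        then obtain U' \<phi> v where U': "(U',\<phi>) \<in> atlas R" "c t \<in> U'" "((\<phi> \<circ> c) has_vector_derivative v) (at t)"
          "speed R c t = sqrt (metr R (U',\<phi>) (c t) v v)" by auto
        have "((\<phi> \<circ> (p \<circ> (s \<circ> c))) has_vector_derivative v) (at t within {0..1})"
          by (rule has_vector_derivative_transform[OF tt _ has_vector_derivative_at_within[OF U'(3)]]) (simp add: eq)
        from speed_eq[OF _ tt U'(1) _ this] U'(2,4) eq[OF tt]
        have "speed R (p \<circ> (s \<circ> c)) t = speed R c t" using pathin_compose[OF psc pc] by simp
        then show ?thesis using E(2) t by auto
      qed
      then show "\<exists>E. finite E \<and> (\<forall>t\<in>{0..1}-E. speed R (p \<circ> (s \<circ> c)) t \<le> C)"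
        using E(1) E'(1) by (intro exI[of _ "E \<union> E'"]) auto
    qed
    moreover have "(s \<circ> c) 0 = u" "(s \<circ> c) 1 = v" using c(3,4) sp uv by auto
    ultimately show ?thesis using psc by blast
  qed
  ultimately show "\<exists>W. openin T W \<and> x \<in> W \<and>
     (\<forall>u\<in>W. \<forall>v\<in>W. \<exists>\<beta> C. pathin T \<beta> \<and> \<beta> 0 = u \<and> \<beta> 1 = v \<and> bounded_speed C (p \<circ> \<beta>))"
    by (intro exI[of _ ?O] conjI ballI)
qed

lemma covering_map_id: "covering_map T T id"
  unfolding covering_map_def
proof (intro conjI ballI)
  fix x assume "x \<in> topspace T"
  then show "\<exists>U. x \<in> U \<and> openin T U \<and> (\<exists>\<V>. \<Union>\<V> = {a\<in>topspace T. id a \<in> U} \<and> (\<forall>V\<in>\<V>. openin T V) \<and>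
     pairwise disjnt \<V> \<and> (\<forall>V\<in>\<V>. homeomorphic_map (subtopology T V) (subtopology T U) id))"
    by (intro exI[of _ "topspace T"] conjI exI[of _ "{topspace T}"]) auto
qed auto

text \<open>A finite subcover by neighbourhoods whose points are joined to \<open>a\<close> with a common speed
  bound. The sum of the bounds serves as a bound for all of them.\<close>

lemma uniform_connection:
  assumes "compact_space (rtop R)" "connected_space (rtop R)" and a: "a \<in> topspace (rtop R)"
  shows "\<exists>C\<ge>0. \<forall>x\<in>topspace (rtop R). \<exists>c. bounded_speed C c \<and> c 0 = x \<and> c 1 = a"
proof -
  have "\<exists>W C. openin (rtop R) W \<and> x \<in> W \<and> (\<forall>w\<in>W. \<exists>c. bounded_speed C c \<and> c 0 = w \<and> c 1 = a)"
    if x: "x \<in> topspace (rtop R)" for x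
  proof -
    obtain c0 C0 where c0: "c0 0 = x" "c0 1 = a" "bounded_speed C0 c0"
      using cover_curves[OF covering_map_id assms(2) x a] by auto
    obtain W C where W: "openin (rtop R) W" "x \<in> W" "0 \<le> C"
      "\<forall>w\<in>W. \<forall>w'\<in>W. \<exists>c. bounded_speed C c \<and> c ` {0..1} \<subseteq> topspace (rtop R) \<and> c 0 = w \<and> c 1 = w'"
      using local_segments[OF x _ x] by auto
    have "\<exists>c. bounded_speed (max (2*C) (2*C0)) c \<and> c 0 = w \<and> c 1 = a" if w: "w \<in> W" for w
    proof -
      obtain c where c: "bounded_speed C c" "c 0 = w" "c 1 = x" using W(2,4) w by blast
      have "bounded_speed (max (2*C) (2*C0)) (join_paths c c0)"
        by (rule bounded_speed_join[OF c(1) c0(3)]) (use c c0 in auto)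
      then show ?thesis using c c0 by (intro exI[of _ "join_paths c c0"]) auto
    qed
    then show ?thesis using W by blast
  qed
  then have "\<forall>x\<in>topspace (rtop R). \<exists>WC. openin (rtop R) (fst WC) \<and> x \<in> fst WC \<and>
     (\<forall>w\<in>fst WC. \<exists>c. bounded_speed (snd WC) c \<and> c 0 = w \<and> c 1 = a)" by simp
  from bchoice[OF this] obtain F where F: "\<forall>x\<in>topspace (rtop R). openin (rtop R) (fst (F x)) \<and> x \<in> fst (F x) \<and>
     (\<forall>w\<in>fst (F x). \<exists>c. bounded_speed (snd (F x)) c \<and> c 0 = w \<and> c 1 = a)" by (elim exE)
  let ?\<U> = "(\<lambda>x. fst (F x)) ` topspace (rtop R)"
  have "\<exists>\<F>. finite \<F> \<and> \<F> \<subseteq> ?\<U> \<and> topspace (rtop R) \<subseteq> \<Union>\<F>"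
    using assms(1) unfolding compact_space_alt
  proof (elim allE impE)
    show "(\<forall>U\<in>?\<U>. openin (rtop R) U) \<and> topspace (rtop R) \<subseteq> \<Union>?\<U>" using F by auto
  qed simp
  then obtain I where I: "finite I" "I \<subseteq> topspace (rtop R)" "topspace (rtop R) \<subseteq> (\<Union>x\<in>I. fst (F x))"
    by (metis (no_types, lifting) finite_subset_image)
  have "\<exists>c. bounded_speed (\<Sum>x\<in>I. \<bar>snd (F x)\<bar>) c \<and> c 0 = x \<and> c 1 = a" if x: "x \<in> topspace (rtop R)" for x
  proof -
    obtain i where i: "i \<in> I" "x \<in> fst (F i)" using I(3) x by blast
    then obtain c where c: "bounded_speed (snd (F i)) c" "c 0 = x" "c 1 = a" using F I(2) by blast
    have "\<bar>snd (F i)\<bar> \<le> (\<Sum>x\<in>I. \<bar>snd (F x)\<bar>)"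
      by (rule member_le_sum[OF i(1)]) (use I(1) in auto)
    then have "snd (F i) \<le> (\<Sum>x\<in>I. \<bar>snd (F x)\<bar>)" by linarith
    then show ?thesis using bounded_speed_mono[OF c(1)] c by blast
  qed
  moreover have "0 \<le> (\<Sum>x\<in>I. \<bar>snd (F x)\<bar>)" by (intro sum_nonneg) auto
  ultimately show ?thesis by blast
qed

end

section \<open>Further rules for derivatives and integrals\<close>

lemma vd_cong:
  assumes "\<And>t. t \<in> {0..1} \<Longrightarrow> F t = G t" "t \<in> {0..1}"
  shows "vd F t = vd G t"
proof -
  have "(F has_vector_derivative v) (at t within {0..1}) \<longleftrightarrow> (G has_vector_derivative v) (at t within {0..1})" for v
    using has_vector_derivative_transform[OF assms(2), of F G v] has_vector_derivative_transform[OF assms(2), of G F v]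
      assms(1) by auto
  then show ?thesis unfolding vector_derivative_def by simp
qed

text \<open>In contrast to a monotone inner function, a continuously differentiable outer function needs no new
  breakpoints.\<close>

lemma pw_C1_smooth_compose:
  assumes \<rho>: "pw_C1_real \<rho>" and g: "\<And>x. (g has_real_derivative g' x) (at x)" and g': "continuous_on UNIV g'"
  shows "pw_C1_real (\<lambda>t. g (\<rho> t))"
    and "\<exists>E. finite E \<and> (\<forall>t\<in>{0..1}-E. vd (\<lambda>t. g (\<rho> t)) t = g' (\<rho> t) * vd \<rho> t)"
proof -
  obtain S where S: "finite S"
     "\<And>a b. 0 \<le> a \<and> a < b \<and> b \<le> 1 \<and> {a<..<b} \<inter> S = {} \<Longrightarrow> C1_piece \<rho> UNIV a b"
    using \<rho> unfolding pw_C1_real_iff by auto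
  show "pw_C1_real (\<lambda>t. g (\<rho> t))" unfolding pw_C1_real_iff
  proof (intro exI[of _ S] conjI allI impI S(1))
    fix a b assume ab: "0 \<le> a \<and> a < b \<and> b \<le> 1 \<and> {a<..<b} \<inter> S = {}"
    obtain D where D: "continuous_on {a..b} D"
      "\<forall>t\<in>{a..b}. (\<rho> has_vector_derivative D t) (at t within {a..b})"
      using S(2)[OF ab] unfolding C1_piece_UNIV by auto
    have c: "continuous_on {a..b} \<rho>" using continuous_on_subset[OF pw_C1_vd(2)[OF \<rho>]] ab by auto
    show "C1_piece (\<lambda>t. g (\<rho> t)) UNIV a b" unfolding C1_piece_UNIV
    proof (intro exI[of _ "\<lambda>t. g' (\<rho> t) * D t"] conjI ballI)
      fix t assume t: "t \<in> {a..b}"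
      have "(\<rho> has_real_derivative D t) (at t within {a..b})"
        using D(2) t by (simp add: has_real_derivative_iff_has_vector_derivative)
      from DERIV_chain2[OF g this]
      show "((\<lambda>t. g (\<rho> t)) has_vector_derivative g' (\<rho> t) * D t) (at t within {a..b})"
        by (simp add: has_real_derivative_iff_has_vector_derivative)
    next
      show "continuous_on {a..b} (\<lambda>t. g' (\<rho> t) * D t)"
        by (intro continuous_intros D(1) continuous_on_compose2[OF g' c]) auto
    qed
  qed
  obtain E where E: "finite E" "\<forall>t\<in>{0..1}-E. (\<rho> has_vector_derivative vd \<rho> t) (at t)"
    using pw_C1_vd(3)[OF \<rho>] by auto
  show "\<exists>E. finite E \<and> (\<forall>t\<in>{0..1}-E. vd (\<lambda>t. g (\<rho> t)) t = g' (\<rho> t) * vd \<rho> t)"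
  proof (intro exI[of _ E] conjI ballI E(1))
    fix t assume t: "t \<in> {0..1} - E"
    have "(\<rho> has_real_derivative vd \<rho> t) (at t)"
      using E(2) t by (simp add: has_real_derivative_iff_has_vector_derivative)
    from DERIV_chain2[OF g this]
    have "((\<lambda>t. g (\<rho> t)) has_vector_derivative g' (\<rho> t) * vd \<rho> t) (at t)"
      by (simp add: has_real_derivative_iff_has_vector_derivative)
    then show "vd (\<lambda>t. g (\<rho> t)) t = g' (\<rho> t) * vd \<rho> t"
      by (rule vector_derivative_at_within_ivl) (use t in auto)
  qed
qed

lemma vd_cmult:
  assumes "pw_C1_real \<rho>" shows "\<exists>E. finite E \<and> (\<forall>t\<in>{0..1}-E. vd (\<lambda>t. \<rho> t * c) t = vd \<rho> t * c)"
proof -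
  have "((\<lambda>x. x * c) has_real_derivative c) (at x)" for x by (auto intro!: derivative_eq_intros)
  from pw_C1_smooth_compose(2)[OF assms this] show ?thesis by (auto simp: mult.commute)
qed

lemma integral_reflect01:
  assumes G: "pw_cont G" shows "integral {0..1} (\<lambda>t. G (1 - t)) = integral {0..1} G"
proof -
  let ?\<Gamma> = "\<lambda>u. integral {0..u} G"
  have p: "pw_C1_real ?\<Gamma>" by (rule pw_C1_integral(1)[OF G])
  obtain E1 where E1: "finite E1" "\<forall>t\<in>{0..1}-E1. vd ?\<Gamma> t = G t" using pw_C1_integral(2)[OF G] by auto
  obtain E2 where E2: "finite E2" "\<forall>t\<in>{0..1}-E2. (?\<Gamma> has_vector_derivative vd ?\<Gamma> t) (at t)"
    using pw_C1_vd(3)[OF p] by auto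
  have "((\<lambda>t. G (1 - t)) has_integral ((\<lambda>t. - ?\<Gamma> (1 - t)) 1 - (\<lambda>t. - ?\<Gamma> (1 - t)) 0)) {0..1}"
  proof (rule fundamental_theorem_of_calculus_interior_strong[of "(\<lambda>s. 1 - s) ` (E1 \<union> E2)"])
    fix t :: real assume t: "t \<in> {0<..<1} - (\<lambda>s. 1 - s) ` (E1 \<union> E2)"
    have "1 - t \<notin> E1 \<union> E2"
    proof
      assume "1 - t \<in> E1 \<union> E2"
      then have "1 - (1 - t) \<in> (\<lambda>s. 1 - s) ` (E1 \<union> E2)" by (rule imageI)
      then show False using t by simp
    qed
    then have "1 - t \<in> {0..1} - E1" "1 - t \<in> {0..1} - E2" using t by auto
    from bspec[OF E1(2) this(1)] bspec[OF E2(2) this(2)]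
    have "(?\<Gamma> has_vector_derivative G (1-t)) (at (1-t))" by simp
    then have "(?\<Gamma> has_real_derivative G (1-t)) (at (1-t))"
      by (simp add: has_real_derivative_iff_has_vector_derivative)
    moreover have "((\<lambda>t. 1 - t) has_real_derivative -1) (at t)" by (auto intro!: derivative_eq_intros)
    ultimately have "((\<lambda>t. ?\<Gamma> (1 - t)) has_real_derivative (G (1-t)) * (-1)) (at t)"
      by (rule DERIV_chain2)
    then have "((\<lambda>t. - ?\<Gamma> (1 - t)) has_real_derivative - (G (1-t) * (-1))) (at t)" by (rule DERIV_minus)
    then show "((\<lambda>t. - ?\<Gamma> (1 - t)) has_vector_derivative G (1 - t)) (at t)"
      by (simp add: has_real_derivative_iff_has_vector_derivative)
  next
    show "continuous_on {0..1} (\<lambda>t. - ?\<Gamma> (1 - t))"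
      by (intro continuous_intros continuous_on_compose2[OF pw_C1_vd(2)[OF p]]) auto
  qed (use E1 E2 in auto)
  then show ?thesis by (simp add: integral_unique)
qed

lemma pw_C1_reverse:
  assumes \<rho>: "pw_C1_real \<rho>"
  shows "pw_C1_real (\<lambda>t. \<rho> (1 - t))"
    and "\<exists>E. finite E \<and> (\<forall>t\<in>{0..1}-E. vd (\<lambda>t. \<rho> (1-t)) t = - vd \<rho> (1-t))"
proof -
  obtain S where S: "finite S"
     "\<And>a b. 0 \<le> a \<and> a < b \<and> b \<le> 1 \<and> {a<..<b} \<inter> S = {} \<Longrightarrow> C1_piece \<rho> UNIV a b"
    using \<rho> unfolding pw_C1_real_iff by auto
  show "pw_C1_real (\<lambda>t. \<rho> (1 - t))" unfolding pw_C1_real_iff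
  proof (intro exI[of _ "(\<lambda>s. 1 - s) ` S"] conjI allI impI)
    fix a b :: real assume ab: "0 \<le> a \<and> a < b \<and> b \<le> 1 \<and> {a<..<b} \<inter> (\<lambda>s. 1 - s) ` S = {}"
    have "{1-b<..<1-a} \<inter> S = {}"
    proof (rule ccontr)
      assume "{1-b<..<1-a} \<inter> S \<noteq> {}"
      then obtain s where "s \<in> S" "1-b < s" "s < 1-a" by auto
      then have "1 - s \<in> {a<..<b} \<inter> (\<lambda>s. 1 - s) ` S" by auto
      then show False using ab by blast
    qed
    then have "C1_piece \<rho> UNIV (1-b) (1-a)" using S(2) ab by auto
    then obtain D where D: "continuous_on {1-b..1-a} D"
      "\<forall>t\<in>{1-b..1-a}. (\<rho> has_vector_derivative D t) (at t within {1-b..1-a})"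
      unfolding C1_piece_UNIV by auto
    show "C1_piece (\<lambda>t. \<rho> (1 - t)) UNIV a b" unfolding C1_piece_UNIV
    proof (intro exI[of _ "\<lambda>t. - D (1-t)"] conjI ballI)
      fix t assume t: "t \<in> {a..b}"
      have im: "(\<lambda>t. 1 - t) ` {a..b} = {1-b..1-a}" by (auto intro!: image_eqI[of _ "\<lambda>t. 1 - t" "1 - _"])
      have "((\<lambda>t. 1 - t) has_vector_derivative -1) (at t within {a..b})"
        by (auto intro!: derivative_eq_intros)
      moreover have "(\<rho> has_vector_derivative D (1-t)) (at (1-t) within (\<lambda>t. 1 - t) ` {a..b})"
        unfolding im using D(2) t by auto
      ultimately have "(\<rho> \<circ> (\<lambda>t. 1 - t) has_vector_derivative (-1) *\<^sub>R D (1-t)) (at t within {a..b})"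
        by (rule vector_diff_chain_within)
      then show "((\<lambda>t. \<rho> (1 - t)) has_vector_derivative - D (1-t)) (at t within {a..b})" by (simp add: o_def)
    next
      show "continuous_on {a..b} (\<lambda>t. - D (1-t))"
        by (intro continuous_intros continuous_on_compose2[OF D(1)]) auto
    qed
  qed (use S in auto)
  obtain E where E: "finite E" "\<forall>t\<in>{0..1}-E. (\<rho> has_vector_derivative vd \<rho> t) (at t)"
    using pw_C1_vd(3)[OF \<rho>] by auto
  show "\<exists>E. finite E \<and> (\<forall>t\<in>{0..1}-E. vd (\<lambda>t. \<rho> (1-t)) t = - vd \<rho> (1-t))"
  proof (intro exI[of _ "(\<lambda>s. 1 - s) ` E"] conjI ballI)
    fix t assume t: "t \<in> {0..1} - (\<lambda>s. 1 - s) ` E"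
    have "1 - t \<notin> E"
    proof
      assume "1 - t \<in> E"
      then have "1 - (1 - t) \<in> (\<lambda>s. 1 - s) ` E" by (rule imageI)
      then show False using t by simp
    qed
    then have r: "(\<rho> has_vector_derivative vd \<rho> (1-t)) (at (1-t))" using E(2) t by auto
    have "((\<lambda>t. 1 - t) has_vector_derivative -1) (at t)" by (auto intro!: derivative_eq_intros)
    from vector_diff_chain_at[OF this r]
    have "((\<lambda>t. \<rho> (1 - t)) has_vector_derivative - vd \<rho> (1-t)) (at t)" by (simp add: o_def)
    then show "vd (\<lambda>t. \<rho> (1-t)) t = - vd \<rho> (1-t)"
      by (rule vector_derivative_at_within_ivl) (use t in auto)
  qed (use E in auto)
qed

lemma variation_bound:
  assumes \<eta>: "pw_C1_real \<eta>" and G: "pw_cont G" and E: "finite E"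
    and le: "\<And>t. t \<in> {0..1} - E \<Longrightarrow> \<bar>vd \<eta> t\<bar> \<le> G t" and ab: "0 \<le> a" "a \<le> b" "b \<le> 1"
  shows "\<bar>\<eta> b - \<eta> a\<bar> \<le> integral {a..b} G"
proof -
  have I: "vd \<eta> integrable_on {a..b}" "G integrable_on {a..b}" "(\<lambda>t. - G t) integrable_on {a..b}"
    using pw_cont_integrable[OF pw_C1_vd(1)[OF \<eta>]] pw_cont_integrable[OF G] ab by (auto intro: integrable_neg)
  have e: "integral {a..b} (vd \<eta>) = \<eta> b - \<eta> a" by (rule integral_unique[OF pw_C1_ftc[OF \<eta> ab]])
  have leab: "\<bar>vd \<eta> t\<bar> \<le> G t" if "t \<in> {a..b} - E" for t
    by (rule le) (use that ab in auto)
  have "integral {a..b} (vd \<eta>) \<le> integral {a..b} G"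
    by (rule integral_mono_finite[OF E I(1,2)]) (drule leab, linarith)
  moreover have "integral {a..b} (\<lambda>t. - G t) \<le> integral {a..b} (vd \<eta>)"
    by (rule integral_mono_finite[OF E I(3,1)]) (drule leab, linarith)
  ultimately show ?thesis unfolding e by simp
qed

section \<open>The warped plane\<close>

definition plane_speed :: "(real \<Rightarrow> real) \<Rightarrow> (real \<Rightarrow> real) \<Rightarrow> (real \<Rightarrow> real) \<Rightarrow> real \<Rightarrow> real" where
  "plane_speed f \<rho> \<sigma> t = sqrt ((vd \<rho> t)\<^sup>2 + (f \<bar>\<rho> t\<bar>)\<^sup>2 * (vd \<sigma> t)\<^sup>2)"

lemma plane_length_eq: "plane_length f \<rho> \<sigma> = integral {0..1} (plane_speed f \<rho> \<sigma>)"
  unfolding plane_length_def plane_speed_def ..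

lemma plane_speed_nonneg: "0 \<le> plane_speed f \<rho> \<sigma> t"
  unfolding plane_speed_def by simp

context
  fixes f :: "real \<Rightarrow> real"
  assumes fc: "continuous_on {0..} f" and fpos: "\<And>r. 0 \<le> r \<Longrightarrow> 0 < f r"
begin

lemma pw_cont_f: "pw_C1_real \<rho> \<Longrightarrow> pw_cont (\<lambda>t. f \<bar>\<rho> t\<bar>)"
  by (intro pw_cont_continuous continuous_on_compose2[OF fc] continuous_intros pw_C1_vd(2)) auto

lemma pw_cont_plane_speed: "pw_C1_real \<rho> \<Longrightarrow> pw_C1_real \<sigma> \<Longrightarrow> pw_cont (plane_speed f \<rho> \<sigma>)"
  unfolding plane_speed_def by (intro pw_cont_intros pw_C1_vd(1) pw_cont_f)

lemma plane_speed_ge: "\<bar>vd \<rho> t\<bar> \<le> plane_speed f \<rho> \<sigma> t" "f \<bar>\<rho> t\<bar> * \<bar>vd \<sigma> t\<bar> \<le> plane_speed f \<rho> \<sigma> t"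
proof -
  show "\<bar>vd \<rho> t\<bar> \<le> plane_speed f \<rho> \<sigma> t"
    unfolding plane_speed_def by (rule real_le_rsqrt) simp
  show "f \<bar>\<rho> t\<bar> * \<bar>vd \<sigma> t\<bar> \<le> plane_speed f \<rho> \<sigma> t"
    unfolding plane_speed_def by (rule real_le_rsqrt) (simp add: power_mult_distrib)
qed

lemma plane_length_nonneg: "pw_C1_real \<rho> \<Longrightarrow> pw_C1_real \<sigma> \<Longrightarrow> 0 \<le> plane_length f \<rho> \<sigma>"
  unfolding plane_length_eq
  by (intro integral_nonneg pw_cont_integrable pw_cont_plane_speed) (auto simp: plane_speed_nonneg)

lemma plane_dist_le:
  assumes "pw_C1_real \<rho>" "pw_C1_real \<sigma>" "(\<rho> 0, \<sigma> 0) = a" "(\<rho> 1, \<sigma> 1) = b"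
  shows "plane_dist f a b \<le> plane_length f \<rho> \<sigma>"
  unfolding plane_dist_def
proof (rule cInf_lower)
  show "bdd_below {plane_length f \<rho> \<sigma> | \<rho> \<sigma>. pw_C1_real \<rho> \<and> pw_C1_real \<sigma> \<and> (\<rho> 0, \<sigma> 0) = a \<and> (\<rho> 1, \<sigma> 1) = b}"
    by (rule bdd_belowI[of _ 0]) (auto intro: plane_length_nonneg)
qed (use assms in blast)

lemma plane_curves_nonempty:
  "{plane_length f \<rho> \<sigma> | \<rho> \<sigma>. pw_C1_real \<rho> \<and> pw_C1_real \<sigma> \<and> (\<rho> 0, \<sigma> 0) = a \<and> (\<rho> 1, \<sigma> 1) = b} \<noteq> {}"
proof -
  have "plane_length f (\<lambda>t. fst a + (fst b - fst a) * t) (\<lambda>t. snd a + (snd b - snd a) * t) \<in>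
    {plane_length f \<rho> \<sigma> | \<rho> \<sigma>. pw_C1_real \<rho> \<and> pw_C1_real \<sigma> \<and> (\<rho> 0, \<sigma> 0) = a \<and> (\<rho> 1, \<sigma> 1) = b}"
    by (intro CollectI exI conjI refl pw_C1_affine) auto
  then show ?thesis by blast
qed

lemma plane_dist_greatest:
  assumes "\<And>\<rho> \<sigma>. pw_C1_real \<rho> \<Longrightarrow> pw_C1_real \<sigma> \<Longrightarrow> (\<rho> 0, \<sigma> 0) = a \<Longrightarrow> (\<rho> 1, \<sigma> 1) = b \<Longrightarrow> m \<le> plane_length f \<rho> \<sigma>"
  shows "m \<le> plane_dist f a b"
  unfolding plane_dist_def by (rule cInf_greatest[OF plane_curves_nonempty]) (use assms in blast)

lemma plane_dist_approx:
  assumes "plane_dist f a b < m"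
  obtains \<rho> \<sigma> where "pw_C1_real \<rho>" "pw_C1_real \<sigma>" "(\<rho> 0, \<sigma> 0) = a" "(\<rho> 1, \<sigma> 1) = b" "plane_length f \<rho> \<sigma> < m"
proof -
  from cInf_lessD[OF plane_curves_nonempty assms[unfolded plane_dist_def]] that show ?thesis by blast
qed

lemma plane_dist_nonneg: "0 \<le> plane_dist f a b"
  by (rule plane_dist_greatest) (rule plane_length_nonneg)

text \<open>The part of a curve over a subinterval, reparametrized affinely, is a competitor for the distance of its
  end points.\<close>

lemma plane_dist_subcurve:
  assumes \<rho>: "pw_C1_real \<rho>" and \<sigma>: "pw_C1_real \<sigma>" and ab: "0 \<le> a" "a \<le> b" "b \<le> 1"
  shows "plane_dist f (\<rho> a, \<sigma> a) (\<rho> b, \<sigma> b) \<le> integral {a..b} (plane_speed f \<rho> \<sigma>)"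
proof -
  let ?\<phi> = "\<lambda>t. a + (b - a) * t"
  have \<phi>: "pw_C1_real ?\<phi>" by simp
  have m: "mono_on {0..1} ?\<phi>" using ab by (auto intro!: mono_onI mult_left_mono)
  have im: "?\<phi> ` {0..1} \<subseteq> {0..1}"
  proof
    fix x assume "x \<in> ?\<phi> ` {0..1}"
    then obtain t where t: "t \<in> {0..1}" "x = ?\<phi> t" by blast
    have "(b - a) * t \<le> (b - a) * 1" using t ab by (intro mult_left_mono) auto
    moreover have "0 \<le> (b - a) * t" using t ab by auto
    ultimately show "x \<in> {0..1}" using t ab by auto
  qed
  obtain E1 where E1: "finite E1" "\<forall>t\<in>{0..1}-E1. vd (\<rho> \<circ> ?\<phi>) t = vd \<rho> (?\<phi> t) * vd ?\<phi> t"
    using vd_compose[OF \<rho> \<phi> m im] by (elim exE conjE)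
  obtain E2 where E2: "finite E2" "\<forall>t\<in>{0..1}-E2. vd (\<sigma> \<circ> ?\<phi>) t = vd \<sigma> (?\<phi> t) * vd ?\<phi> t"
    using vd_compose[OF \<sigma> \<phi> m im] by (elim exE conjE)
  have "plane_dist f (\<rho> a, \<sigma> a) (\<rho> b, \<sigma> b) \<le> plane_length f (\<rho> \<circ> ?\<phi>) (\<sigma> \<circ> ?\<phi>)"
    by (rule plane_dist_le[OF pw_C1_compose[OF \<rho> \<phi> m im] pw_C1_compose[OF \<sigma> \<phi> m im]]) auto
  also have "\<dots> = integral {0..1} (\<lambda>t. plane_speed f \<rho> \<sigma> (?\<phi> t) * vd ?\<phi> t)"
    unfolding plane_length_eq
  proof (rule integral_spike_finite01[of "E1 \<union> E2"])
    fix t :: real assume t: "t \<in> {0..1} - (E1 \<union> E2)"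
    have v: "vd ?\<phi> t = b - a" using t by simp
    have "(vd \<rho> (?\<phi> t) * (b - a))\<^sup>2 + (f \<bar>\<rho> (?\<phi> t)\<bar>)\<^sup>2 * (vd \<sigma> (?\<phi> t) * (b - a))\<^sup>2 =
      ((vd \<rho> (?\<phi> t))\<^sup>2 + (f \<bar>\<rho> (?\<phi> t)\<bar>)\<^sup>2 * (vd \<sigma> (?\<phi> t))\<^sup>2) * (b - a)\<^sup>2"
    proof -
      have "(x * k)\<^sup>2 + w\<^sup>2 * (y * k)\<^sup>2 = (x\<^sup>2 + w\<^sup>2 * y\<^sup>2) * k\<^sup>2" for x y w k :: real
        by (simp add: power2_eq_square algebra_simps)
      then show ?thesis .
    qed
    then have s: "sqrt ((vd \<rho> (?\<phi> t) * (b - a))\<^sup>2 + (f \<bar>\<rho> (?\<phi> t)\<bar>)\<^sup>2 * (vd \<sigma> (?\<phi> t) * (b - a))\<^sup>2) =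
      sqrt ((vd \<rho> (?\<phi> t))\<^sup>2 + (f \<bar>\<rho> (?\<phi> t)\<bar>)\<^sup>2 * (vd \<sigma> (?\<phi> t))\<^sup>2) * (b - a)"
      using ab by (simp only: real_sqrt_mult real_sqrt_abs)
    have "vd (\<rho> \<circ> ?\<phi>) t = vd \<rho> (?\<phi> t) * (b - a)" "vd (\<sigma> \<circ> ?\<phi>) t = vd \<sigma> (?\<phi> t) * (b - a)"
      using E1(2) E2(2) t v by auto
    then show "plane_speed f (\<rho> \<circ> ?\<phi>) (\<sigma> \<circ> ?\<phi>) t = plane_speed f \<rho> \<sigma> (?\<phi> t) * vd ?\<phi> t"
      unfolding plane_speed_def v comp_apply using s by (simp only:)
  qed (use E1 E2 in auto)
  also have "\<dots> = integral {?\<phi> 0..?\<phi> 1} (plane_speed f \<rho> \<sigma>)"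
    by (rule integral_unique[OF integral_substitution_mono[OF pw_cont_plane_speed[OF \<rho> \<sigma>] \<phi> m im]])
  finally show ?thesis by simp
qed

lemma plane_dist_sym_le: "plane_dist f b a \<le> plane_dist f a b"
proof (rule plane_dist_greatest)
  fix \<rho> \<sigma> assume h: "pw_C1_real \<rho>" "pw_C1_real \<sigma>" "(\<rho> 0, \<sigma> 0) = a" "(\<rho> 1, \<sigma> 1) = b"
  obtain E1 where E1: "finite E1" "\<forall>t\<in>{0..1}-E1. vd (\<lambda>t. \<rho> (1-t)) t = - vd \<rho> (1-t)"
    using pw_C1_reverse(2)[OF h(1)] by (elim exE conjE)
  obtain E2 where E2: "finite E2" "\<forall>t\<in>{0..1}-E2. vd (\<lambda>t. \<sigma> (1-t)) t = - vd \<sigma> (1-t)"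
    using pw_C1_reverse(2)[OF h(2)] by (elim exE conjE)
  have "plane_dist f b a \<le> plane_length f (\<lambda>t. \<rho> (1-t)) (\<lambda>t. \<sigma> (1-t))"
    by (rule plane_dist_le[OF pw_C1_reverse(1)[OF h(1)] pw_C1_reverse(1)[OF h(2)]]) (use h in auto)
  also have "\<dots> = integral {0..1} (\<lambda>t. plane_speed f \<rho> \<sigma> (1 - t))"
    unfolding plane_length_eq
  proof (rule integral_spike_finite01[of "E1 \<union> E2"])
    fix t :: real assume t: "t \<in> {0..1} - (E1 \<union> E2)"
    then have "vd (\<lambda>t. \<rho> (1-t)) t = - vd \<rho> (1-t)" "vd (\<lambda>t. \<sigma> (1-t)) t = - vd \<sigma> (1-t)"
      using E1(2) E2(2) by blast+
    then show "plane_speed f (\<lambda>t. \<rho> (1-t)) (\<lambda>t. \<sigma> (1-t)) t = plane_speed f \<rho> \<sigma> (1 - t)"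
      unfolding plane_speed_def by simp
  qed (use E1 E2 in auto)
  also have "\<dots> = plane_length f \<rho> \<sigma>"
    unfolding plane_length_eq by (rule integral_reflect01[OF pw_cont_plane_speed[OF h(1,2)]])
  finally show "plane_dist f b a \<le> plane_length f \<rho> \<sigma>" .
qed

lemma plane_dist_sym: "plane_dist f a b = plane_dist f b a"
  by (rule antisym[OF plane_dist_sym_le plane_dist_sym_le])

lemma plane_dist_triangle: "plane_dist f a c \<le> plane_dist f a b + plane_dist f b c"
proof (rule field_le_epsilon)
  fix e :: real assume e: "e > 0"
  obtain \<rho>1 \<sigma>1 where 1: "pw_C1_real \<rho>1" "pw_C1_real \<sigma>1" "(\<rho>1 0, \<sigma>1 0) = a" "(\<rho>1 1, \<sigma>1 1) = b"
    "plane_length f \<rho>1 \<sigma>1 < plane_dist f a b + e/2"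
    by (rule plane_dist_approx[of a b "plane_dist f a b + e/2"]) (use e in auto)
  obtain \<rho>2 \<sigma>2 where 2: "pw_C1_real \<rho>2" "pw_C1_real \<sigma>2" "(\<rho>2 0, \<sigma>2 0) = b" "(\<rho>2 1, \<sigma>2 1) = c"
    "plane_length f \<rho>2 \<sigma>2 < plane_dist f b c + e/2"
    by (rule plane_dist_approx[of b c "plane_dist f b c + e/2"]) (use e in auto)
  have eq: "\<rho>1 1 = \<rho>2 0" "\<sigma>1 1 = \<sigma>2 0" using 1(4) 2(3) by auto
  let ?\<rho> = "join_paths \<rho>1 \<rho>2" and ?\<sigma> = "join_paths \<sigma>1 \<sigma>2"
  have p: "pw_C1_real ?\<rho>" "pw_C1_real ?\<sigma>" using pw_C1_join 1 2 eq by auto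
  obtain E1 where E1: "finite E1" "\<forall>t\<in>{0..1}-E1. (t < 1/2 \<longrightarrow> vd ?\<rho> t = 2 * vd \<rho>1 (2*t)) \<and>
    (t > 1/2 \<longrightarrow> vd ?\<rho> t = 2 * vd \<rho>2 (2*t-1))" using vd_join[OF 1(1) 2(1)] by (elim exE conjE)
  obtain E2 where E2: "finite E2" "\<forall>t\<in>{0..1}-E2. (t < 1/2 \<longrightarrow> vd ?\<sigma> t = 2 * vd \<sigma>1 (2*t)) \<and>
    (t > 1/2 \<longrightarrow> vd ?\<sigma> t = 2 * vd \<sigma>2 (2*t-1))" using vd_join[OF 1(2) 2(2)] by (elim exE conjE)
  have two: "sqrt ((2*x)\<^sup>2 + w\<^sup>2 * (2*y)\<^sup>2) = 2 * sqrt (x\<^sup>2 + w\<^sup>2 * y\<^sup>2)" for x y w :: real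
  proof -
    have "(2*x)\<^sup>2 + w\<^sup>2 * (2*y)\<^sup>2 = 2\<^sup>2 * (x\<^sup>2 + w\<^sup>2 * y\<^sup>2)" by (simp add: power_mult_distrib algebra_simps)
    then show ?thesis by (simp only: real_sqrt_mult real_sqrt_abs)
  qed
  have "plane_dist f a c \<le> plane_length f ?\<rho> ?\<sigma>" by (rule plane_dist_le[OF p]) (use 1 2 in auto)
  also have "\<dots> = integral {0..1} (plane_speed f \<rho>1 \<sigma>1) + integral {0..1} (plane_speed f \<rho>2 \<sigma>2)"
    unfolding plane_length_eq
  proof (rule integral_join[OF pw_cont_plane_speed[OF p], of "E1 \<union> E2"])
    show "finite (E1 \<union> E2)" using E1 E2 by auto
    fix t :: real assume t: "t \<in> {0..1} - (E1 \<union> E2)"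
    show "plane_speed f ?\<rho> ?\<sigma> t = 2 * plane_speed f \<rho>1 \<sigma>1 (2*t)" if lt: "t < 1/2"
    proof -
      have "vd ?\<rho> t = 2 * vd \<rho>1 (2*t)" "vd ?\<sigma> t = 2 * vd \<sigma>1 (2*t)" using E1(2) E2(2) t lt by blast+
      moreover have "?\<rho> t = \<rho>1 (2*t)" using lt by (simp add: join_paths_def)
      ultimately show ?thesis unfolding plane_speed_def by (simp only: two)
    qed
    show "plane_speed f ?\<rho> ?\<sigma> t = 2 * plane_speed f \<rho>2 \<sigma>2 (2*t-1)" if gt: "t > 1/2"
    proof -
      have "vd ?\<rho> t = 2 * vd \<rho>2 (2*t-1)" "vd ?\<sigma> t = 2 * vd \<sigma>2 (2*t-1)" using E1(2) E2(2) t gt by blast+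
      moreover have "?\<rho> t = \<rho>2 (2*t-1)" using gt by (simp add: join_paths_def)
      ultimately show ?thesis unfolding plane_speed_def by (simp only: two)
    qed
  qed
  finally show "plane_dist f a c \<le> plane_dist f a b + plane_dist f b c + e"
    using 1(5) 2(5) unfolding plane_length_eq by simp
qed

lemma plane_dist_vertical: "plane_dist f (a, b) (a', b) \<le> \<bar>a - a'\<bar>"
proof -
  have "plane_dist f (a,b) (a',b) \<le> plane_length f (\<lambda>t. a + (a' - a) * t) (\<lambda>t. b)"
    by (rule plane_dist_le) auto
  also have "\<dots> = integral {0..1::real} (\<lambda>t. \<bar>a' - a\<bar>)"
    unfolding plane_length_def by (rule integral_cong) simp
  finally show ?thesis by simp
qed

lemma plane_dist_horizontal: "plane_dist f (a, b) (a, b') \<le> f \<bar>a\<bar> * \<bar>b - b'\<bar>"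
proof -
  have "plane_dist f (a,b) (a,b') \<le> plane_length f (\<lambda>t. a) (\<lambda>t. b + (b' - b) * t)"
    by (rule plane_dist_le) auto
  also have "\<dots> = integral {0..1::real} (\<lambda>t. f \<bar>a\<bar> * \<bar>b' - b\<bar>)"
    unfolding plane_length_def using fpos[of "\<bar>a\<bar>"]
    by (intro integral_cong) (simp add: real_sqrt_mult abs_mult)
  finally show ?thesis by (simp add: abs_minus_commute)
qed

lemma plane_dist_upper: "plane_dist f (a, b) (a', b') \<le> \<bar>a - a'\<bar> + f \<bar>a\<bar> * \<bar>b - b'\<bar>"
  using plane_dist_triangle[of "(a,b)" "(a',b')" "(a,b')"] plane_dist_vertical[of a b' a'] plane_dist_horizontal[of a b b']
  by simp

text \<open>Go down to the line over radius \<open>0\<close>, along this line, and up again.\<close>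

lemma plane_dist_across: "0 \<le> r \<Longrightarrow> plane_dist f (r, 0) (r, d) \<le> 2 * r + f 0 * \<bar>d\<bar>"
  using plane_dist_triangle[of "(r,0)" "(r,d)" "(0,0)"] plane_dist_upper[of 0 0 r d] plane_dist_vertical[of r 0 0]
  by simp

text \<open>The bound \<open>plane_dist_upper\<close> compares the distance with the Euclidean one near a given
  point.\<close>

lemma continuous_plane_dist: "continuous_on UNIV (\<lambda>z. plane_dist f (fst z) (snd z))"
  unfolding continuous_on_def
proof
  fix z0 :: "(real \<times> real) \<times> (real \<times> real)"
  obtain a b a' b' where z0: "z0 = ((a,b),(a',b'))" by (cases z0) auto
  let ?B = "\<lambda>z::(real\<times>real)\<times>(real\<times>real). (\<bar>a - fst (fst z)\<bar> + f \<bar>a\<bar> * \<bar>b - snd (fst z)\<bar>) +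
     (\<bar>a' - fst (snd z)\<bar> + f \<bar>a'\<bar> * \<bar>b' - snd (snd z)\<bar>)"
  have bound: "norm (plane_dist f (fst z) (snd z) - plane_dist f (fst z0) (snd z0)) \<le> ?B z" for z
  proof -
    obtain c d c' d' where z: "z = ((c,d),(c',d'))" by (cases z) auto
    have "plane_dist f (c,d) (c',d') \<le> plane_dist f (a,b) (c,d) + plane_dist f (a,b) (a',b') + plane_dist f (a',b') (c',d')"
      using plane_dist_triangle[of "(c,d)" "(c',d')" "(a,b)"] plane_dist_triangle[of "(a,b)" "(c',d')" "(a',b')"]
        plane_dist_sym[of "(a,b)" "(c,d)"] by linarith
    moreover have "plane_dist f (a,b) (a',b') \<le> plane_dist f (a,b) (c,d) + plane_dist f (c,d) (c',d') + plane_dist f (a',b') (c',d')"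
      using plane_dist_triangle[of "(a,b)" "(a',b')" "(c,d)"] plane_dist_triangle[of "(c,d)" "(a',b')" "(c',d')"]
        plane_dist_sym[of "(a',b')" "(c',d')"] by linarith
    moreover note plane_dist_upper[of a b c d] plane_dist_upper[of a' b' c' d']
    ultimately show ?thesis unfolding z z0 by (simp add: abs_le_iff)
  qed
  have "(?B \<longlongrightarrow> ?B z0) (at z0)" by (intro tendsto_intros)
  then have "(?B \<longlongrightarrow> 0) (at z0)" by (simp add: z0)
  then have "((\<lambda>z. plane_dist f (fst z) (snd z) - plane_dist f (fst z0) (snd z0)) \<longlongrightarrow> 0) (at z0)"
    by (rule Lim_null_comparison[rotated]) (use bound in auto)
  then show "((\<lambda>z. plane_dist f (fst z) (snd z)) \<longlongrightarrow> plane_dist f (fst z0) (snd z0)) (at z0 within UNIV)"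
    using LIM_zero_iff by blast
qed

text \<open>The first coordinate moves by at most the length of the curve. In the strip that it cannot leave,
  \<open>f\<close> is at least \<open>m\<close>, and this bounds the movement of the second coordinate.\<close>

lemma plane_confined:
  assumes \<rho>: "pw_C1_real \<rho>" and \<sigma>: "pw_C1_real \<sigma>" and len: "plane_length f \<rho> \<sigma> \<le> K"
    and m: "m > 0" "\<And>r. 0 \<le> r \<Longrightarrow> r \<le> \<bar>\<rho> 0\<bar> + K \<Longrightarrow> m \<le> f r" and t: "t \<in> {0..1}"
  shows "\<bar>\<rho> t - \<rho> 0\<bar> \<le> K" "m * \<bar>\<sigma> t - \<sigma> 0\<bar> \<le> K"
proof -
  have pc: "pw_cont (plane_speed f \<rho> \<sigma>)" by (rule pw_cont_plane_speed[OF \<rho> \<sigma>])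
  have part: "integral {0..t} (plane_speed f \<rho> \<sigma>) \<le> K" if t: "t \<in> {0..1}" for t
  proof -
    have "integral {0..t} (plane_speed f \<rho> \<sigma>) \<le> integral {0..1} (plane_speed f \<rho> \<sigma>)"
      by (rule integral_subset_le) (use t pw_cont_integrable[OF pc] plane_speed_nonneg in auto)
    then show ?thesis using len unfolding plane_length_eq by simp
  qed
  have r: "\<bar>\<rho> t - \<rho> 0\<bar> \<le> K" if t: "t \<in> {0..1}" for t
  proof -
    have "\<bar>\<rho> t - \<rho> 0\<bar> \<le> integral {0..t} (plane_speed f \<rho> \<sigma>)"
      by (rule variation_bound[OF \<rho> pc, of "{}"]) (use plane_speed_ge t in auto)
    then show ?thesis using part[OF t] by simp
  qed
  show "\<bar>\<rho> t - \<rho> 0\<bar> \<le> K" by (rule r[OF t])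
  have pc': "pw_cont (\<lambda>t. (1/m) * plane_speed f \<rho> \<sigma> t)" by (intro pw_cont_intros pc)
  have "\<bar>\<sigma> t - \<sigma> 0\<bar> \<le> integral {0..t} (\<lambda>t. (1/m) * plane_speed f \<rho> \<sigma> t)"
  proof (rule variation_bound[OF \<sigma> pc', of "{}"])
    fix s :: real assume "s \<in> {0..1} - {}"
    then have "m \<le> f \<bar>\<rho> s\<bar>" using r[of s] by (intro m(2)) auto
    then have "m * \<bar>vd \<sigma> s\<bar> \<le> f \<bar>\<rho> s\<bar> * \<bar>vd \<sigma> s\<bar>" by (intro mult_right_mono) auto
    also have "\<dots> \<le> plane_speed f \<rho> \<sigma> s" by (rule plane_speed_ge)
    finally show "\<bar>vd \<sigma> s\<bar> \<le> (1/m) * plane_speed f \<rho> \<sigma> s" using m(1) by (simp add: field_simps)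
  qed (use t in auto)
  also have "\<dots> = (1/m) * integral {0..t} (plane_speed f \<rho> \<sigma>)" by (rule integral_mult_right)
  finally have "m * \<bar>\<sigma> t - \<sigma> 0\<bar> \<le> integral {0..t} (plane_speed f \<rho> \<sigma>)" using m(1) by (simp add: field_simps)
  then show "m * \<bar>\<sigma> t - \<sigma> 0\<bar> \<le> K" using part[OF t] by simp
qed

lemma f_lower_bound: "\<exists>m>0. \<forall>r. 0 \<le> r \<and> r \<le> K \<longrightarrow> m \<le> f r"
proof (cases "0 \<le> K")
  case True
  have "continuous_on {0..K} f" by (rule continuous_on_subset[OF fc]) auto
  then obtain x where "x \<in> {0..K}" "\<forall>y\<in>{0..K}. f x \<le> f y"
    using continuous_attains_inf[of "{0..K}" f] True by auto
  then show ?thesis using fpos[of x] by (intro exI[of _ "f x"]) auto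
next
  case False then show ?thesis by (intro exI[of _ 1]) auto
qed

lemma plane_dist_zero:
  assumes "plane_dist f (r, 0) (r, d) = 0" shows "d = 0"
proof (rule ccontr)
  assume d: "d \<noteq> 0"
  obtain m where m: "m > 0" "\<forall>s. 0 \<le> s \<and> s \<le> \<bar>r\<bar> + 1 \<longrightarrow> m \<le> f s" using f_lower_bound by blast
  define e where "e = min 1 (m * \<bar>d\<bar> / 2)"
  have e: "0 < e" "e \<le> 1" "e < m * \<bar>d\<bar>" using m d by (auto simp: e_def min_def)
  obtain \<rho> \<sigma> where c: "pw_C1_real \<rho>" "pw_C1_real \<sigma>" "(\<rho> 0, \<sigma> 0) = (r,0)" "(\<rho> 1, \<sigma> 1) = (r,d)"
    "plane_length f \<rho> \<sigma> < e"
    by (rule plane_dist_approx[of "(r,0)" "(r,d)" e]) (use e assms in auto)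
  have "m * \<bar>\<sigma> 1 - \<sigma> 0\<bar> \<le> e"
    by (rule plane_confined(2)[OF c(1,2) less_imp_le[OF c(5)] m(1)]) (use c(3) e m(2) in auto)
  then show False using c(3,4) e by simp
qed

text \<open>Existence by compactness. A nearly minimal curve, parametrized proportionally to arc length, is a map
  into a fixed rectangle that increases distances by a factor at most \<open>1 + 1/(n+1)\<close>. Such
  maps form closed nested sets in the product of copies of the rectangle, one for each parameter, which is
  compact by Tychonoff's theorem. A common element does not increase distances, and since its end points
  have distance \<open>l\<close>, the triangle inequality turns the inequalities into equalities.\<close>

lemma minimal_geodesic_exists:
  "\<exists>c. minimal_geodesic f c (plane_dist f (r, 0) (r, d)) (r, 0) (r, d)"
proof -
  define l where "l = plane_dist f (r,0) (r,d)"
  have l0: "0 \<le> l" unfolding l_def by (rule plane_dist_nonneg)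
  show ?thesis
  proof (cases "l = 0")
    case True
    then have "d = 0" using plane_dist_zero unfolding l_def by blast
    then show ?thesis using True unfolding l_def minimal_geodesic_def
      by (intro exI[of _ "\<lambda>_. (r,0)"]) auto
  next
    case False
    then have l: "l > 0" using l0 by simp
    obtain m where m: "m > 0" "\<forall>s. 0 \<le> s \<and> s \<le> \<bar>r\<bar> + 2*l \<longrightarrow> m \<le> f s" using f_lower_bound by blast
    define K where "K = {r - 2*l..r + 2*l} \<times> {- (2*l/m)..2*l/m}"
    \<comment> \<open>Candidates for a geodesic that may stretch by the factor \<open>1 + 1/(n+1)\<close>.\<close>
    define Z where "Z n = {c::real \<Rightarrow> real \<times> real. c 0 = (r,0) \<and> c l = (r,d) \<and>
      (\<forall>s\<in>{0..l}. \<forall>t\<in>{0..l}. plane_dist f (c s) (c t) \<le> \<bar>s - t\<bar> * (1 + 1 / real (Suc n)))}" for n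
    have ne: "\<exists>c. (\<forall>s. c s \<in> K) \<and> c \<in> Z n" for n
    proof -
      have "l < l * (1 + 1 / real (Suc n))" using l by (simp add: field_simps)
      then obtain \<rho> \<sigma> where c: "pw_C1_real \<rho>" "pw_C1_real \<sigma>" "(\<rho> 0, \<sigma> 0) = (r,0)" "(\<rho> 1, \<sigma> 1) = (r,d)"
        "plane_length f \<rho> \<sigma> < l * (1 + 1 / real (Suc n))"
        unfolding l_def by (rule plane_dist_approx)
      have pc: "pw_cont (plane_speed f \<rho> \<sigma>)" by (rule pw_cont_plane_speed[OF c(1,2)])
      let ?L = "plane_length f \<rho> \<sigma>"
      have "l * (1 + 1 / real (Suc n)) \<le> l * 2" using l by (intro mult_left_mono) auto
      then have L2: "?L \<le> 2*l" using c(5) by simp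
      have Ll: "l \<le> ?L" unfolding l_def by (rule plane_dist_le[OF c(1-4)])
      have inK: "(\<rho> t, \<sigma> t) \<in> K" if t: "t \<in> {0..1}" for t
      proof -
        have "\<bar>\<rho> t - \<rho> 0\<bar> \<le> 2*l" "m * \<bar>\<sigma> t - \<sigma> 0\<bar> \<le> 2*l"
          by (rule plane_confined[OF c(1,2) L2 m(1) _ t]; use c(3) m(2) in simp)+
        then have "\<bar>\<rho> t - \<rho> 0\<bar> \<le> 2*l" "\<bar>\<sigma> t - \<sigma> 0\<bar> \<le> 2*l/m"
          using m(1) by (simp_all add: field_simps)
        then show ?thesis using c(3) unfolding K_def abs_le_iff by auto
      qed
      \<comment> \<open>Arc length, and a parameter at which a given fraction of it has been travelled.\<close>
      define ar where "ar = (\<lambda>t. integral {0..t} (plane_speed f \<rho> \<sigma>))"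
      have ar: "continuous_on {0..1} ar" "ar 0 = 0" "ar 1 = ?L"
        unfolding ar_def plane_length_eq using pw_C1_vd(2)[OF pw_C1_integral(1)[OF pc]] by auto
      have "\<exists>\<tau>. \<tau> \<in> {0..1} \<and> ar \<tau> = s * (?L / l) \<and> (s = 0 \<longrightarrow> \<tau> = 0) \<and> (s = l \<longrightarrow> \<tau> = 1)" if s: "s \<in> {0..l}" for s
      proof -
        consider "s = 0" | "s = l" | "0 < s" "s < l" using s by force
        then show ?thesis
        proof cases
          case 1 then show ?thesis using ar l by (intro exI[of _ 0]) auto
        next
          case 2 then show ?thesis using ar l by (intro exI[of _ 1]) auto
        next
          case 3
          have "0 \<le> s * (?L / l)" "s * (?L / l) \<le> ?L" using 3 l Ll by (auto simp: field_simps mult_right_mono)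
          then obtain \<tau> where "0 \<le> \<tau>" "\<tau> \<le> 1" "ar \<tau> = s * (?L / l)"
            using IVT'[of ar 0 "s * (?L / l)" 1] ar by auto
          then show ?thesis using 3 by (intro exI[of _ \<tau>]) auto
        qed
      qed
      then have "\<forall>s\<in>{0..l}. \<exists>\<tau>. \<tau> \<in> {0..1} \<and> ar \<tau> = s * (?L / l) \<and> (s = 0 \<longrightarrow> \<tau> = 0) \<and> (s = l \<longrightarrow> \<tau> = 1)" by blast
      from bchoice[OF this] obtain \<tau> where \<tau>: "\<forall>s\<in>{0..l}. \<tau> s \<in> {0..1} \<and> ar (\<tau> s) = s * (?L / l) \<and> (s = 0 \<longrightarrow> \<tau> s = 0) \<and> (s = l \<longrightarrow> \<tau> s = 1)"
        by (elim exE)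
      define c' where "c' = (\<lambda>s. if s \<in> {0..l} then (\<rho> (\<tau> s), \<sigma> (\<tau> s)) else (\<rho> 0, \<sigma> 0))"
      have "c' s \<in> K" for s using inK \<tau> unfolding c'_def by auto
      moreover have "c' \<in> Z n" unfolding Z_def
      proof (intro CollectI conjI ballI)
        show "c' 0 = (r,0)" "c' l = (r,d)" using \<tau> l c(3,4) unfolding c'_def by auto
        have le: "plane_dist f (c' s) (c' t) \<le> \<bar>s - t\<bar> * (1 + 1 / real (Suc n))"
          if st: "s \<in> {0..l}" "t \<in> {0..l}" "\<tau> s \<le> \<tau> t" for s t
        proof -
          have tt: "0 \<le> \<tau> s" "\<tau> t \<le> 1" "ar (\<tau> s) = s * (?L / l)" "ar (\<tau> t) = t * (?L / l)" using \<tau> st by auto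
          have "plane_dist f (c' s) (c' t) \<le> integral {\<tau> s..\<tau> t} (plane_speed f \<rho> \<sigma>)"
            unfolding c'_def using st plane_dist_subcurve[OF c(1,2) tt(1) st(3) tt(2)] by simp
          also have "\<dots> = ar (\<tau> t) - ar (\<tau> s)"
            unfolding ar_def
            using Henstock_Kurzweil_Integration.integral_combine[of 0 "\<tau> s" "\<tau> t" "plane_speed f \<rho> \<sigma>"] tt st(3)
              pw_cont_integrable[OF pc] by simp
          also have "\<dots> = (t - s) * (?L / l)" using tt(3,4) by (simp only: left_diff_distrib)
          also have "\<dots> \<le> \<bar>s - t\<bar> * (?L / l)" using l Ll by (intro mult_right_mono) auto
          also have "\<dots> \<le> \<bar>s - t\<bar> * (1 + 1 / real (Suc n))"
          proof (rule mult_left_mono)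
            show "?L / l \<le> 1 + 1 / real (Suc n)" using c(5) l by (simp add: pos_divide_le_eq mult.commute)
          qed simp
          finally show ?thesis .
        qed
        fix s t assume st: "s \<in> {0..l}" "t \<in> {0..l}"
        show "plane_dist f (c' s) (c' t) \<le> \<bar>s - t\<bar> * (1 + 1 / real (Suc n))"
          using le[OF st] le[OF st(2,1)] plane_dist_sym[of "c' s" "c' t"]
          by (cases "\<tau> s \<le> \<tau> t") (auto simp: abs_minus_commute)
      qed
      ultimately show ?thesis by blast
    qed
    have "compactin (product_topology (\<lambda>i::real. euclidean :: (real\<times>real) topology) UNIV) (PiE UNIV (\<lambda>_. K))"
      unfolding compactin_PiE K_def by (auto intro: compact_Times)
    then have cK: "compact (PiE (UNIV::real set) (\<lambda>_. K))"
      by (simp add: euclidean_product_topology)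
    have cont: "continuous_on UNIV (\<lambda>c::real \<Rightarrow> real \<times> real. plane_dist f (c s) (c t))" for s t
    proof -
      have "continuous_on UNIV (\<lambda>c::real \<Rightarrow> real \<times> real. (c s, c t))"
        by (intro continuous_on_Pair continuous_on_product_coordinates)
      from continuous_on_compose2[OF continuous_plane_dist this] show ?thesis by simp
    qed
    have Z_eq: "Z n = {c. c 0 = (r,0)} \<inter> {c. c l = (r,d)} \<inter>
       (\<Inter>s\<in>{0..l}. \<Inter>t\<in>{0..l}. {c. plane_dist f (c s) (c t) \<le> \<bar>s - t\<bar> * (1 + 1 / real (Suc n))})" for n
      unfolding Z_def by auto
    have closedZ: "closed (Z n)" for n
      unfolding Z_eq
      by (intro closed_Int closed_INT ballI closed_Collect_eq closed_Collect_le cont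
        continuous_on_product_coordinates continuous_on_const)
    have Zmono: "Z n \<subseteq> Z k" if "k \<le> n" for k n
    proof
      fix c assume c: "c \<in> Z n"
      have "1 / real (Suc n) \<le> 1 / real (Suc k)" using that by (simp add: field_simps)
      then have le: "\<bar>s - t\<bar> * (1 + 1 / real (Suc n)) \<le> \<bar>s - t\<bar> * (1 + 1 / real (Suc k))" for s t :: real
        by (intro mult_left_mono) auto
      show "c \<in> Z k" unfolding Z_def
      proof (intro CollectI conjI ballI)
        show "c 0 = (r,0)" "c l = (r,d)" using c unfolding Z_def by auto
        fix s t assume "s \<in> {0..l}" "t \<in> {0..l}"
        then have "plane_dist f (c s) (c t) \<le> \<bar>s - t\<bar> * (1 + 1 / real (Suc n))"
          using c unfolding Z_def by blast
        then show "plane_dist f (c s) (c t) \<le> \<bar>s - t\<bar> * (1 + 1 / real (Suc k))"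
          using le by (rule order_trans)
      qed
    qed
    have "PiE (UNIV::real set) (\<lambda>_. K) \<inter> (\<Inter>n\<in>UNIV. Z n) \<noteq> {}"
    proof (rule compact_imp_fip_image[OF cK closedZ])
      fix I :: "nat set" assume I: "finite I"
      obtain c where c: "\<forall>s. c s \<in> K" "c \<in> Z (if I = {} then 0 else Max I)" using ne by blast
      have "c \<in> Z n" if "n \<in> I" for n
      proof -
        have "I \<noteq> {}" "n \<le> Max I" using that I by auto
        then show ?thesis using c(2) Zmono[of n "Max I"] by auto
      qed
      moreover have "c \<in> PiE UNIV (\<lambda>_. K)" using c(1) by (simp add: PiE_UNIV_domain)
      ultimately have "c \<in> PiE UNIV (\<lambda>_. K) \<inter> (\<Inter>n\<in>I. Z n)" by blast
      then show "PiE UNIV (\<lambda>_. K) \<inter> (\<Inter>n\<in>I. Z n) \<noteq> {}" by blast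
    qed
    then obtain c where c: "\<And>n. c \<in> Z n" by auto
    have ends: "c 0 = (r,0)" "c l = (r,d)" using c[of 0] unfolding Z_def by auto
    have le: "plane_dist f (c s) (c t) \<le> \<bar>s - t\<bar>" if "s \<in> {0..l}" "t \<in> {0..l}" for s t
    proof (rule LIMSEQ_le_const)
      have "(\<lambda>n. \<bar>s - t\<bar> * (1 + 1 / real (Suc n))) \<longlonglongrightarrow> \<bar>s - t\<bar> * (1 + 0)"
        by (intro tendsto_intros LIMSEQ_Suc[OF lim_1_over_n])
      then show "(\<lambda>n. \<bar>s - t\<bar> * (1 + 1 / real (Suc n))) \<longlonglongrightarrow> \<bar>s - t\<bar>" by simp
      show "\<exists>N. \<forall>n\<ge>N. plane_dist f (c s) (c t) \<le> \<bar>s - t\<bar> * (1 + 1 / real (Suc n))"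
        using c that unfolding Z_def by blast
    qed
    have eq: "plane_dist f (c s) (c t) = \<bar>s - t\<bar>" if st: "s \<in> {0..l}" "t \<in> {0..l}" "s \<le> t" for s t
    proof (rule antisym[OF le[OF st(1,2)]])
      have "l \<le> plane_dist f (c 0) (c s) + plane_dist f (c s) (c t) + plane_dist f (c t) (c l)"
      proof -
        have "l = plane_dist f (c 0) (c l)" unfolding ends by (rule l_def)
        then show ?thesis
          using plane_dist_triangle[of "c 0" "c l" "c s"] plane_dist_triangle[of "c s" "c l" "c t"] by linarith
      qed
      also have "\<dots> \<le> s + plane_dist f (c s) (c t) + (l - t)"
        using le[of 0 s] le[of t l] st l by auto
      finally show "\<bar>s - t\<bar> \<le> plane_dist f (c s) (c t)" using st by simp
    qed
    have "minimal_geodesic f c l (r,0) (r,d)"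
      unfolding minimal_geodesic_def
    proof (intro conjI ballI l0 ends)
      fix s t assume "s \<in> {0..l}" "t \<in> {0..l}"
      then show "plane_dist f (c s) (c t) = \<bar>s - t\<bar>"
        using eq[of s t] eq[of t s] plane_dist_sym[of "c s" "c t"] by (cases "s \<le> t") (auto simp: abs_minus_commute)
    qed
    then show ?thesis unfolding l_def by blast
  qed
qed

text \<open>The length of a minimal geodesic is the distance of its end points, hence unique.\<close>

lemma geodesic_length_eq: "geodesic_length f r d = plane_dist f (r, 0) (r, d)"
  unfolding geodesic_length_def
proof (rule the_equality)
  show "\<exists>c. minimal_geodesic f c (plane_dist f (r, 0) (r, d)) (r, 0) (r, d)" by (rule minimal_geodesic_exists)
  fix l assume "\<exists>c. minimal_geodesic f c l (r, 0) (r, d)"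
  then obtain c where c: "0 \<le> l" "c 0 = (r,0)" "c l = (r,d)"
    "\<forall>s\<in>{0..l}. \<forall>t\<in>{0..l}. plane_dist f (c s) (c t) = \<bar>s - t\<bar>" unfolding minimal_geodesic_def by blast
  have "plane_dist f (c 0) (c l) = \<bar>0 - l\<bar>" using c(1) bspec[OF bspec[OF c(4), of 0], of l] by simp
  then show "l = plane_dist f (r, 0) (r, d)" using c by simp
qed

end

section \<open>Curves in the warped product\<close>

lemma speed_cong:
  fixes R :: "('p, 'e::real_inner) riem"
  assumes "\<And>s. s \<in> {0..1} \<Longrightarrow> c s = c' s" "t \<in> {0..1}"
  shows "speed R c t = speed R c' t"
proof -
  have "((\<phi> \<circ> c) has_vector_derivative v) (at t within {0..1}) \<longleftrightarrow>
    ((\<phi> \<circ> c') has_vector_derivative v) (at t within {0..1})" for \<phi> :: "'p \<Rightarrow> 'e" and v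
    using has_vector_derivative_transform[OF assms(2), of "\<phi> \<circ> c" "\<phi> \<circ> c'" v]
      has_vector_derivative_transform[OF assms(2), of "\<phi> \<circ> c'" "\<phi> \<circ> c" v] assms(1) by auto
  then show ?thesis unfolding speed_def using assms by simp
qed

lemma riem_length_cong:
  assumes "\<And>s. s \<in> {0..1} \<Longrightarrow> c s = c' s" shows "riem_length R c = riem_length R c'"
  unfolding riem_length_def by (rule integral_cong) (rule speed_cong[OF assms])

lemma sqrt_perturb: "sqrt (x\<^sup>2 + B\<^sup>2) \<le> sqrt (x\<^sup>2 + b\<^sup>2) + \<bar>B - b\<bar>"
  using real_sqrt_sum_squares_triangle_ineq[of x 0 b "B - b"] by simp

locale warped_factors =
  fixes N :: "('n, 'e::real_inner) riem" and M :: "('m, 'd::real_inner) riem" and f h :: "real \<Rightarrow> real"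
  assumes N: "riemannian_manifold N" and M: "riemannian_manifold M"
    and fc: "continuous_on {0..} f" and fpos: "\<And>r. 0 \<le> r \<Longrightarrow> 0 < f r" and hc: "continuous_on {0..} h"
begin

definition dw_speed :: "(real \<Rightarrow> real) \<Rightarrow> (real \<Rightarrow> 'n) \<Rightarrow> (real \<Rightarrow> 'm) \<Rightarrow> real \<Rightarrow> real" where
  "dw_speed \<rho> y z t = sqrt ((vd \<rho> t)\<^sup>2 + (f (\<rho> t))\<^sup>2 * (speed N y t)\<^sup>2 + (h (\<rho> t))\<^sup>2 * (speed M z t)\<^sup>2)"

lemma dw_length_eq: "dw_length f h N M \<rho> y z = integral {0..1} (dw_speed \<rho> y z)"
  unfolding dw_length_def dw_speed_def ..

lemma pw_cont_dw_speed:
  assumes "dw_curve N M \<rho> y z" shows "pw_cont (dw_speed \<rho> y z)"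
proof -
  have *: "pw_C1_real \<rho>" "\<forall>t\<in>{0..1}. 0 \<le> \<rho> t" "pw_C1_curve N y" "pw_C1_curve M z"
    using assms unfolding dw_curve_def by auto
  have "pw_cont (\<lambda>t. f (\<rho> t))" "pw_cont (\<lambda>t. h (\<rho> t))"
    by (rule pw_cont_continuous, rule continuous_on_compose2[OF fc pw_C1_vd(2)[OF *(1)]], use *(2) in auto)
       (rule pw_cont_continuous, rule continuous_on_compose2[OF hc pw_C1_vd(2)[OF *(1)]], use *(2) in auto)
  then show ?thesis unfolding dw_speed_def
    by (intro pw_cont_intros pw_C1_vd(1) pw_cont_speed[OF N] pw_cont_speed[OF M] *)
qed

lemma dw_speed_nonneg: "0 \<le> dw_speed \<rho> y z t"
  unfolding dw_speed_def by simp

lemma dw_length_nonneg: "dw_curve N M \<rho> y z \<Longrightarrow> 0 \<le> dw_length f h N M \<rho> y z"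
  unfolding dw_length_eq
  by (intro integral_nonneg pw_cont_integrable pw_cont_dw_speed) (auto simp: dw_speed_nonneg)

lemma dw_length_ge_radial:
  assumes "dw_curve N M \<rho> y z" shows "\<bar>\<rho> 1 - \<rho> 0\<bar> \<le> dw_length f h N M \<rho> y z"
  unfolding dw_length_eq
proof (rule variation_bound[OF _ pw_cont_dw_speed[OF assms], of _ "{}"])
  show "\<bar>vd \<rho> t\<bar> \<le> dw_speed \<rho> y z t" for t
    unfolding dw_speed_def by (rule real_le_rsqrt) simp
qed (use assms in \<open>auto simp: dw_curve_def\<close>)

text \<open>Unroll the curve: replace the point of \<open>N\<close> by its arc length, scaled down to end at
  \<open>L\<close>, and drop the contribution of \<open>M\<close>. Neither step increases the integrand.\<close>

lemma plane_dist_le_dw_length: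
  assumes c: "dw_curve N M \<rho> y z" and L: "0 \<le> L" "L \<le> riem_length N y"
  shows "plane_dist f (\<rho> 0, 0) (\<rho> 1, L) \<le> dw_length f h N M \<rho> y z"
proof -
  have *: "pw_C1_real \<rho>" "\<forall>t\<in>{0..1}. 0 \<le> \<rho> t" "pw_C1_curve N y" "pw_C1_curve M z"
    using c unfolding dw_curve_def by auto
  let ?l = "riem_length N y" and ?s = "\<lambda>t. integral {0..t} (speed N y)"
  have sp: "pw_cont (speed N y)" by (rule pw_cont_speed[OF N *(3)])
  have s: "pw_C1_real ?s" by (rule pw_C1_integral(1)[OF sp])
  let ?\<sigma> = "\<lambda>t. ?s t * (L / ?l)"
  have \<sigma>: "pw_C1_real ?\<sigma>" by (rule pw_C1_cmult[OF s])
  obtain E1 where E1: "finite E1" "\<forall>t\<in>{0..1}-E1. vd ?s t = speed N y t"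
    using pw_C1_integral(2)[OF sp] by (elim exE conjE)
  obtain E2 where E2: "finite E2" "\<forall>t\<in>{0..1}-E2. vd ?\<sigma> t = vd ?s t * (L / ?l)"
    using vd_cmult[OF s, of "L / ?l"] by (elim exE conjE)
  have k: "0 \<le> L / ?l" "L / ?l \<le> 1" using L by (auto simp: divide_le_eq)
  have "?\<sigma> 1 = L" using L unfolding riem_length_def by auto
  then have "plane_dist f (\<rho> 0, 0) (\<rho> 1, L) \<le> plane_length f \<rho> ?\<sigma>"
    by (intro plane_dist_le[OF fc fpos *(1) \<sigma>]) auto
  also have "\<dots> \<le> dw_length f h N M \<rho> y z"
    unfolding plane_length_eq dw_length_eq
  proof (rule integral_mono_finite[of "E1 \<union> E2"])
    fix t :: real assume t: "t \<in> {0..1} - (E1 \<union> E2)"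
    have "vd ?\<sigma> t = speed N y t * (L / ?l)" using E1(2) E2(2) t by auto
    then have "(vd ?\<sigma> t)\<^sup>2 = (speed N y t)\<^sup>2 * (L / ?l)\<^sup>2" by (simp only: power_mult_distrib)
    also have "\<dots> \<le> (speed N y t)\<^sup>2 * 1" using k by (intro mult_left_mono power_le_one) auto
    finally have v: "(vd ?\<sigma> t)\<^sup>2 \<le> (speed N y t)\<^sup>2" by simp
    have r: "\<bar>\<rho> t\<bar> = \<rho> t" using *(2) t by auto
    have "(f \<bar>\<rho> t\<bar>)\<^sup>2 * (vd ?\<sigma> t)\<^sup>2 \<le> (f (\<rho> t))\<^sup>2 * (speed N y t)\<^sup>2"
      unfolding r using v by (intro mult_left_mono) auto
    then show "plane_speed f \<rho> ?\<sigma> t \<le> dw_speed \<rho> y z t"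
      unfolding plane_speed_def dw_speed_def
      by (intro real_sqrt_le_mono) (smt (verit) mult_nonneg_nonneg zero_le_power2)
  qed (use E1 E2 pw_cont_integrable[OF pw_cont_plane_speed[OF fc fpos *(1) \<sigma>]]
      pw_cont_integrable[OF pw_cont_dw_speed[OF c]] in auto)
  finally show ?thesis .
qed

text \<open>At a small cost in length, a nearly minimal plane curve is made to have a nonnegative first and a
  strictly increasing second coordinate: \<open>f\<close> is extended evenly, so the first one may be
  replaced by a smooth approximation of its absolute value, and the second one by its total variation plus
  a small multiple of the parameter. The latter is normalized to end at \<open>1\<close>, which accounts
  for the factor \<open>l\<close>.\<close>

lemma plane_curve_monotone_approx:
  assumes r: "0 \<le> r" and l: "0 < l" and \<epsilon>: "0 < \<epsilon>"
  shows "\<exists>\<rho>1 \<sigma>1 E c. pw_C1_real \<rho>1 \<and> pw_C1_real \<sigma>1 \<and> (\<forall>t. 0 \<le> \<rho>1 t) \<and> \<rho>1 0 = r \<and> \<rho>1 1 = r \<and>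
     \<sigma>1 0 = 0 \<and> \<sigma>1 1 = 1 \<and> finite E \<and> 0 < c \<and> (\<forall>t\<in>{0..1}-E. c \<le> vd \<sigma>1 t) \<and>
     integral {0..1} (\<lambda>t. sqrt ((vd \<rho>1 t)\<^sup>2 + (f (\<rho>1 t))\<^sup>2 * (l * vd \<sigma>1 t)\<^sup>2))
       \<le> plane_dist f (r, 0) (r, l) + \<epsilon>"
proof -
  obtain \<rho>0 \<sigma>0 where c0: "pw_C1_real \<rho>0" "pw_C1_real \<sigma>0" "(\<rho>0 0, \<sigma>0 0) = (r,0)" "(\<rho>0 1, \<sigma>0 1) = (r,l)"
    "plane_length f \<rho>0 \<sigma>0 < plane_dist f (r,0) (r,l) + \<epsilon>/2"
    by (rule plane_dist_approx[OF fc fpos, of "(r,0)" "(r,l)" "plane_dist f (r,0) (r,l) + \<epsilon>/2"]) (use \<epsilon> in auto)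
  have av: "pw_cont (\<lambda>t. \<bar>vd \<sigma>0 t\<bar>)" by (intro pw_cont_intros pw_C1_vd(1) c0)
  define V where "V = integral {0..1} (\<lambda>t. \<bar>vd \<sigma>0 t\<bar>)"
  have "\<bar>\<sigma>0 1 - \<sigma>0 0\<bar> \<le> V" unfolding V_def
    by (rule variation_bound[OF c0(2) av, of "{}"]) auto
  then have lV: "l \<le> V" using c0(3,4) by auto
  have "compact (\<rho>0 ` {0..1})" by (rule compact_continuous_image[OF pw_C1_vd(2)[OF c0(1)]]) auto
  then have "bounded (\<rho>0 ` {0..1})" by (rule compact_imp_bounded)
  then obtain A where A: "\<forall>x\<in>\<rho>0 ` {0..1}. norm x \<le> A" unfolding bounded_iff by blast
  then have A': "\<bar>\<rho>0 t\<bar> \<le> A" if "t \<in> {0..1}" for t using that by auto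
  have A0: "0 \<le> A" using A'[of 0] by auto
  have fK: "continuous_on {0..A+1} f" by (rule continuous_on_subset[OF fc]) auto
  obtain xm where xm: "xm \<in> {0..A+1}" "\<forall>x\<in>{0..A+1}. f x \<le> f xm"
    using continuous_attains_sup[of "{0..A+1}" f] fK A0 by auto
  define F where "F = f xm"
  have F: "F > 0" "\<And>x. 0 \<le> x \<Longrightarrow> x \<le> A+1 \<Longrightarrow> f x \<le> F" unfolding F_def using xm fpos by auto
  \<comment> \<open>The error from changing \<open>f\<close> along the curve is at most \<open>\<kappa> * V\<close>, the one from \<open>\<eta>\<close> at most
      \<open>F * \<eta>\<close>; both are kept below \<open>\<epsilon>/8\<close>.\<close>
  define \<kappa> where "\<kappa> = \<epsilon> / (8 * (V+1))"
  have \<kappa>: "\<kappa> > 0" "\<kappa> * V \<le> \<epsilon>/8"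
    using \<epsilon> lV l by (auto simp: \<kappa>_def field_simps)
  have "uniformly_continuous_on {0..A+1} f" by (rule compact_uniformly_continuous[OF fK]) auto
  then obtain \<delta> where \<delta>: "\<delta> > 0" "\<forall>x\<in>{0..A+1}. \<forall>x'\<in>{0..A+1}. dist x' x < \<delta> \<longrightarrow> dist (f x') (f x) < \<kappa>"
    unfolding uniformly_continuous_on_def using \<kappa>(1) by blast
  define \<eta> where "\<eta> = min (min 1 (\<delta>/2)) (\<epsilon> / (8 * F))"
  have \<eta>: "\<eta> > 0" "\<eta> \<le> 1" "\<eta> < \<delta>" "F * \<eta> \<le> \<epsilon>/8"
  proof -
    show "\<eta> > 0" using \<delta>(1) \<epsilon> F(1) by (simp add: \<eta>_def)
    have "\<eta> \<le> \<delta>/2" unfolding \<eta>_def by (simp add: min_le_iff_disj)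
    then show "\<eta> < \<delta>" using \<delta>(1) by simp
    show "\<eta> \<le> 1" unfolding \<eta>_def by (simp add: min_le_iff_disj)
    have "F * \<eta> \<le> F * (\<epsilon> / (8 * F))" using F(1) by (intro mult_left_mono) (auto simp: \<eta>_def)
    then show "F * \<eta> \<le> \<epsilon>/8" using F(1) by simp
  qed
  \<comment> \<open>A smooth nonnegative substitute for the absolute value of the radius. The additive constant
      makes \<open>r\<close> a fixed point, so that the end points are kept.\<close>
  define g where "g = (\<lambda>x. sqrt (x\<^sup>2 + \<eta>\<^sup>2) + (r - sqrt (r\<^sup>2 + \<eta>\<^sup>2)))"
  have sq: "\<bar>x\<bar> \<le> sqrt (x\<^sup>2 + \<eta>\<^sup>2)" "sqrt (x\<^sup>2 + \<eta>\<^sup>2) \<le> \<bar>x\<bar> + \<eta>" "\<eta> \<le> sqrt (x\<^sup>2 + \<eta>\<^sup>2)" for x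
    using sqrt_sum_squares_le_sum_abs[of x \<eta>] \<eta>(1) by (auto intro!: real_le_rsqrt)
  have pos: "0 < x\<^sup>2 + \<eta>\<^sup>2" for x using \<eta>(1) by (simp add: add_nonneg_pos)
  have gd: "(g has_real_derivative (x / sqrt (x\<^sup>2 + \<eta>\<^sup>2))) (at x)" for x
    unfolding g_def using pos[of x] by (auto intro!: derivative_eq_intros simp: field_simps)
  have gc: "continuous_on UNIV (\<lambda>x. x / sqrt (x\<^sup>2 + \<eta>\<^sup>2))"
    using pos by (intro continuous_intros) (auto simp: less_imp_neq[symmetric])
  have g1: "\<bar>x / sqrt (x\<^sup>2 + \<eta>\<^sup>2)\<bar> \<le> 1" for x
    using sq(1)[of x] pos[of x] by (simp add: abs_divide divide_le_eq)
  have gr: "g r = r" unfolding g_def by simp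
  have g0: "0 \<le> g x" for x unfolding g_def using sq(3)[of x] sq(2)[of r] abs_of_nonneg[OF r] by linarith
  have gx: "\<bar>g x - \<bar>x\<bar>\<bar> \<le> \<eta>" for x
    unfolding g_def using sq(1,2)[of x] sq(1,2)[of r] abs_of_nonneg[OF r] unfolding abs_le_iff by linarith
  define \<rho>1 where "\<rho>1 = (\<lambda>t. g (\<rho>0 t))"
  have \<rho>1: "pw_C1_real \<rho>1" unfolding \<rho>1_def by (rule pw_C1_smooth_compose(1)[OF c0(1) gd gc])
  obtain E1 where E1: "finite E1" "\<forall>t\<in>{0..1}-E1. vd \<rho>1 t = (\<rho>0 t / sqrt ((\<rho>0 t)\<^sup>2 + \<eta>\<^sup>2)) * vd \<rho>0 t"
    unfolding \<rho>1_def using pw_C1_smooth_compose(2)[OF c0(1) gd gc] by (elim exE conjE)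
  have f1: "\<bar>f (\<rho>1 t) - f \<bar>\<rho>0 t\<bar>\<bar> \<le> \<kappa>" "f (\<rho>1 t) \<le> F" if t: "t \<in> {0..1}" for t
  proof -
    have in1: "\<rho>1 t \<in> {0..A+1}" "\<bar>\<rho>0 t\<bar> \<in> {0..A+1}"
      using g0[of "\<rho>0 t"] gx[of "\<rho>0 t"] A'[OF t] \<eta>(2) unfolding \<rho>1_def by (auto simp: abs_le_iff)
    have "dist (\<rho>1 t) \<bar>\<rho>0 t\<bar> < \<delta>" using gx[of "\<rho>0 t"] \<eta>(3) unfolding \<rho>1_def dist_real_def by simp
    then have "dist (f (\<rho>1 t)) (f \<bar>\<rho>0 t\<bar>) < \<kappa>" using \<delta>(2) in1 by blast
    then show "\<bar>f (\<rho>1 t) - f \<bar>\<rho>0 t\<bar>\<bar> \<le> \<kappa>" by (simp add: dist_real_def)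
    show "f (\<rho>1 t) \<le> F" using F(2) in1 by auto
  qed
  \<comment> \<open>The total variation of the second coordinate, made strictly increasing by \<open>\<eta>\<close> so that its
      normalization \<open>\<sigma>1\<close> can be inverted.\<close>
  let ?G = "\<lambda>t. \<bar>vd \<sigma>0 t\<bar> + \<eta>"
  have G: "pw_cont ?G" by (intro pw_cont_intros av)
  define I where "I = V + \<eta>"
  have IG: "integral {0..1} ?G = I"
    unfolding I_def V_def using Henstock_Kurzweil_Integration.integral_add[OF pw_cont_integrable[OF av, of 0 1], of "\<lambda>_. \<eta>"]
      integrable_const_ivl[of \<eta> 0 "1::real"] by simp
  have I: "I > 0" "l \<le> I" using lV l \<eta>(1) by (auto simp: I_def)
  let ?S = "\<lambda>t. integral {0..t} ?G"
  define \<sigma>1 where "\<sigma>1 = (\<lambda>t. ?S t * (1 / I))"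
  have S: "pw_C1_real ?S" by (rule pw_C1_integral(1)[OF G])
  have \<sigma>1: "pw_C1_real \<sigma>1" unfolding \<sigma>1_def by (rule pw_C1_cmult[OF S])
  obtain E2 where E2: "finite E2" "\<forall>t\<in>{0..1}-E2. vd ?S t = ?G t" using pw_C1_integral(2)[OF G] by (elim exE conjE)
  obtain E3 where E3: "finite E3" "\<forall>t\<in>{0..1}-E3. vd \<sigma>1 t = vd ?S t * (1/I)"
    unfolding \<sigma>1_def using vd_cmult[OF S, of "1/I"] by (elim exE conjE)
  have v\<sigma>1: "vd \<sigma>1 t = ?G t / I" if "t \<in> {0..1} - (E2 \<union> E3)" for t
  proof -
    have "vd \<sigma>1 t = vd ?S t * (1/I)" "vd ?S t = ?G t" using E2(2) E3(2) that by blast+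
    then show ?thesis by simp
  qed
  have ends: "\<sigma>1 0 = 0" "\<sigma>1 1 = 1" unfolding \<sigma>1_def using IG I by auto
  let ?Q = "\<lambda>x. sqrt ((vd \<rho>1 x)\<^sup>2 + (f (\<rho>1 x))\<^sup>2 * (l * vd \<sigma>1 x)\<^sup>2)"
  have \<rho>1pos: "0 \<le> \<rho>1 t" for t unfolding \<rho>1_def by (rule g0)
  have "pw_cont (\<lambda>t. f (\<rho>1 t))"
    by (rule pw_cont_continuous, rule continuous_on_compose2[OF fc pw_C1_vd(2)[OF \<rho>1]]) (auto simp: \<rho>1pos)
  then have Q: "pw_cont ?Q" by (intro pw_cont_intros pw_C1_vd(1) \<rho>1 \<sigma>1)
  have "integral {0..1} ?Q \<le> integral {0..1} (\<lambda>t. plane_speed f \<rho>0 \<sigma>0 t + (\<kappa> * \<bar>vd \<sigma>0 t\<bar> + F * \<eta>))"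
  proof (rule integral_mono_finite[of "E1 \<union> E2 \<union> E3"])
    fix t :: real assume t: "t \<in> {0..1} - (E1 \<union> E2 \<union> E3)"
    have tt: "t \<in> {0..1}" using t by simp
    have "\<bar>vd \<rho>1 t\<bar> = \<bar>\<rho>0 t / sqrt ((\<rho>0 t)\<^sup>2 + \<eta>\<^sup>2)\<bar> * \<bar>vd \<rho>0 t\<bar>" using E1(2) t by (simp add: abs_mult)
    also have "\<dots> \<le> 1 * \<bar>vd \<rho>0 t\<bar>" by (intro mult_right_mono g1) auto
    finally have a: "(vd \<rho>1 t)\<^sup>2 \<le> (vd \<rho>0 t)\<^sup>2" by (simp add: abs_le_square_iff)
    have "l * vd \<sigma>1 t = (l / I) * ?G t" using v\<sigma>1[of t] t by simp
    also have "\<dots> \<le> 1 * ?G t" using I \<eta>(1) by (intro mult_right_mono) auto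
    finally have "l * vd \<sigma>1 t \<le> ?G t" by simp
    moreover have "0 \<le> l * vd \<sigma>1 t" using v\<sigma>1[of t] t l I \<eta>(1) by simp
    ultimately have b: "(l * vd \<sigma>1 t)\<^sup>2 \<le> (?G t)\<^sup>2" by (intro power_mono)
    let ?b = "f \<bar>\<rho>0 t\<bar> * \<bar>vd \<sigma>0 t\<bar>" and ?B = "f (\<rho>1 t) * ?G t"
    have "?Q t \<le> sqrt ((vd \<rho>0 t)\<^sup>2 + ?B\<^sup>2)"
      unfolding power_mult_distrib[of "f (\<rho>1 t)"] using a b by (intro real_sqrt_le_mono add_mono mult_left_mono) auto
    also have "\<dots> \<le> sqrt ((vd \<rho>0 t)\<^sup>2 + ?b\<^sup>2) + \<bar>?B - ?b\<bar>" by (rule sqrt_perturb)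
    also have "sqrt ((vd \<rho>0 t)\<^sup>2 + ?b\<^sup>2) = plane_speed f \<rho>0 \<sigma>0 t"
      unfolding plane_speed_def by (simp add: power_mult_distrib)
    also have "\<bar>?B - ?b\<bar> \<le> \<kappa> * \<bar>vd \<sigma>0 t\<bar> + F * \<eta>"
    proof -
      have "?B - ?b = (f (\<rho>1 t) - f \<bar>\<rho>0 t\<bar>) * \<bar>vd \<sigma>0 t\<bar> + f (\<rho>1 t) * \<eta>" by (simp add: algebra_simps)
      moreover have "\<bar>(f (\<rho>1 t) - f \<bar>\<rho>0 t\<bar>) * \<bar>vd \<sigma>0 t\<bar>\<bar> \<le> \<kappa> * \<bar>vd \<sigma>0 t\<bar>"
        unfolding abs_mult abs_abs by (intro mult_right_mono f1(1) tt) auto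
      moreover have "\<bar>f (\<rho>1 t) * \<eta>\<bar> \<le> F * \<eta>"
        using f1(2)[OF tt] fpos[of "\<rho>1 t"] g0[of "\<rho>0 t"] \<eta>(1) unfolding \<rho>1_def
        by (auto simp: abs_mult intro!: mult_right_mono)
      ultimately show ?thesis by linarith
    qed
    finally show "?Q t \<le> plane_speed f \<rho>0 \<sigma>0 t + (\<kappa> * \<bar>vd \<sigma>0 t\<bar> + F * \<eta>)" by simp
  qed (use E1 E2 E3 in \<open>auto intro!: pw_cont_integrable Q pw_cont_intros av pw_cont_plane_speed[OF fc fpos] c0\<close>)
  also have "\<dots> = plane_length f \<rho>0 \<sigma>0 + (\<kappa> * V + F * \<eta>)"
  proof -
    have i: "plane_speed f \<rho>0 \<sigma>0 integrable_on {0..1}" "(\<lambda>t. \<kappa> * \<bar>vd \<sigma>0 t\<bar>) integrable_on {0..1}"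
      "(\<lambda>t. F * \<eta>) integrable_on {0..1::real}"
      by (auto intro!: pw_cont_integrable pw_cont_intros av pw_cont_plane_speed[OF fc fpos] c0)
    show ?thesis
      unfolding Henstock_Kurzweil_Integration.integral_add[OF i(1) integrable_add[OF i(2,3)]]
        Henstock_Kurzweil_Integration.integral_add[OF i(2,3)]
      by (simp add: V_def plane_length_eq)
  qed
  also have "\<dots> \<le> plane_dist f (r,0) (r,l) + \<epsilon>" using c0(5) \<kappa>(2) \<eta>(4) \<epsilon> by linarith
  finally have "integral {0..1} ?Q \<le> plane_dist f (r, 0) (r, l) + \<epsilon>" .
  moreover have "\<eta> / I \<le> vd \<sigma>1 t" if "t \<in> {0..1} - (E2 \<union> E3)" for t
    using v\<sigma>1[OF that] I by (simp add: divide_right_mono)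
  moreover have "\<rho>1 0 = r" "\<rho>1 1 = r" unfolding \<rho>1_def using c0(3,4) gr by auto
  ultimately show ?thesis
    using \<rho>1 \<sigma>1 \<rho>1pos ends E2(1) E3(1) \<eta>(1) I(1)
    by (intro exI[of _ \<rho>1] exI[of _ \<sigma>1] exI[of _ "E2 \<union> E3"] exI[of _ "\<eta> / I"]) auto
qed

text \<open>The converse of unrolling. A nearly minimal plane curve with increasing second coordinate is
  reparametrized so that this coordinate becomes the arc length of the given curve \<open>y\<close>; its
  first coordinate then serves as the radius along \<open>y\<close>. The curve \<open>y\<close> itself
  keeps its parametrization, as its arc length function need not be invertible.\<close>

lemma dw_curve_along:
  assumes r: "0 \<le> r" and y: "pw_C1_curve N y" and z: "z \<in> topspace (rtop M)" and \<epsilon>: "0 < \<epsilon>"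
  shows "\<exists>\<rho>. dw_curve N M \<rho> y (\<lambda>_. z) \<and> \<rho> 0 = r \<and> \<rho> 1 = r \<and>
     dw_length f h N M \<rho> y (\<lambda>_. z) \<le> plane_dist f (r, 0) (r, riem_length N y) + \<epsilon>"
proof -
  let ?l = "riem_length N y"
  have zc: "pw_C1_curve M (\<lambda>_. z)" by (rule pw_C1_curve_const[OF M z])
  have zs: "speed M (\<lambda>_. z) t = 0" if "t \<in> {0..1}" for t by (rule speed_const[OF M z that])
  have sp: "pw_cont (speed N y)" by (rule pw_cont_speed[OF N y])
  obtain E0 where E0: "finite E0" "\<forall>t\<in>{0..1}-E0. 0 \<le> speed N y t" using speed_nonneg[OF N y] by (elim exE conjE)
  have l0: "0 \<le> ?l" by (rule riem_length_nonneg[OF N y])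
  show ?thesis
  proof (cases "?l = 0")
    case True
    have c: "dw_curve N M (\<lambda>_. r) y (\<lambda>_. z)" unfolding dw_curve_def using r y zc by auto
    have "dw_length f h N M (\<lambda>_. r) y (\<lambda>_. z) = integral {0..1} (\<lambda>t. f r * speed N y t)"
      unfolding dw_length_eq
    proof (rule integral_spike_finite01[OF E0(1)])
      fix t :: real assume t: "t \<in> {0..1} - E0"
      then show "dw_speed (\<lambda>_. r) y (\<lambda>_. z) t = f r * speed N y t"
        unfolding dw_speed_def using zs E0(2) fpos[OF r] by (simp add: real_sqrt_mult abs_of_nonneg)
    qed
    also have "\<dots> = f r * ?l" unfolding riem_length_def by (rule integral_mult_right)
    finally have "dw_length f h N M (\<lambda>_. r) y (\<lambda>_. z) = 0" using True by simp
    then show ?thesis using c \<epsilon> plane_dist_nonneg[OF fc fpos, of "(r,0)" "(r,?l)"]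
      by (intro exI[of _ "\<lambda>_. r"]) auto
  next
    case False
    then have l: "?l > 0" using l0 by simp
    obtain \<rho>1 \<sigma>1 E1 k where c1: "pw_C1_real \<rho>1" "pw_C1_real \<sigma>1" "\<forall>t. 0 \<le> \<rho>1 t" "\<rho>1 0 = r" "\<rho>1 1 = r"
      "\<sigma>1 0 = 0" "\<sigma>1 1 = 1" "finite E1" "0 < k" "\<forall>t\<in>{0..1}-E1. k \<le> vd \<sigma>1 t"
      "integral {0..1} (\<lambda>t. sqrt ((vd \<rho>1 t)\<^sup>2 + (f (\<rho>1 t))\<^sup>2 * (?l * vd \<sigma>1 t)\<^sup>2)) \<le> plane_dist f (r, 0) (r, ?l) + \<epsilon>"
      using plane_curve_monotone_approx[OF r l \<epsilon>] by (elim exE conjE)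
    note \<rho>1 = c1(1) and \<sigma>1 = c1(2)
    have "\<exists>\<psi>. pw_C1_real \<psi> \<and> mono_on {0..1} \<psi> \<and> \<psi> ` {0..1} \<subseteq> {0..1} \<and> \<psi> 0 = 0 \<and> \<psi> 1 = 1 \<and>
     (\<forall>s\<in>{0..1}. \<sigma>1 (\<psi> s) = s)"
      by (rule pw_C1_inverse[OF \<sigma>1 c1(6,7,8,9)]) (use c1(10) in blast)
    then obtain \<psi> where \<psi>: "pw_C1_real \<psi>" "mono_on {0..1} \<psi>" "\<psi> ` {0..1} \<subseteq> {0..1}" "\<psi> 0 = 0" "\<psi> 1 = 1"
      "\<forall>s\<in>{0..1}. \<sigma>1 (\<psi> s) = s" by (elim exE conjE)
    let ?T = "\<lambda>t. integral {0..t} (speed N y)"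
    have T: "pw_C1_real ?T" by (rule pw_C1_integral(1)[OF sp])
    define s where "s = (\<lambda>t. ?T t * (1 / ?l))"
    have s: "pw_C1_real s" unfolding s_def by (rule pw_C1_cmult[OF T])
    have Tmono: "?T a \<le> ?T b" if "0 \<le> a" "a \<le> b" "b \<le> 1" for a b
    proof -
      have "integral {a..b} (\<lambda>_. 0) \<le> integral {a..b} (speed N y)"
        by (rule integral_mono_finite[OF E0(1)]) (use that E0(2) pw_cont_integrable[OF sp] in auto)
      moreover have "?T a + integral {a..b} (speed N y) = ?T b"
        using Henstock_Kurzweil_Integration.integral_combine[of 0 a b "speed N y"] that pw_cont_integrable[OF sp] by simp
      ultimately show ?thesis by simp
    qed
    have smono: "mono_on {0..1} s"
      unfolding s_def using Tmono l by (intro mono_onI mult_right_mono) auto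
    have s01: "s 0 = 0" "s 1 = 1" unfolding s_def riem_length_def using l by (auto simp: riem_length_def)
    have srange: "s ` {0..1} \<subseteq> {0..1}"
    proof
      fix x assume "x \<in> s ` {0..1}"
      then obtain t where t: "t \<in> {0..1}" "x = s t" by blast
      then show "x \<in> {0..1}" using mono_onD[OF smono, of 0 t] mono_onD[OF smono, of t 1] s01 by auto
    qed
    \<comment> \<open>Along \<open>\<rho>1 \<circ> \<phi>\<close> the normalized second coordinate \<open>\<sigma>1 \<circ> \<phi>\<close> is the normalized arc length \<open>s\<close>.\<close>
    define \<phi> where "\<phi> = \<psi> \<circ> s"
    have \<phi>: "pw_C1_real \<phi>" unfolding \<phi>_def by (rule pw_C1_compose[OF \<psi>(1) s smono srange])
    have \<phi>mono: "mono_on {0..1} \<phi>"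
    proof (rule mono_onI)
      fix a b :: real assume ab: "a \<in> {0..1}" "b \<in> {0..1}" "a \<le> b"
      have "s a \<in> {0..1}" "s b \<in> {0..1}" using srange ab by blast+
      then show "\<phi> a \<le> \<phi> b" unfolding \<phi>_def comp_apply
        using mono_onD[OF \<psi>(2)] mono_onD[OF smono ab] by blast
    qed
    have \<phi>range: "\<phi> ` {0..1} \<subseteq> {0..1}" unfolding \<phi>_def image_comp[symmetric] using srange \<psi>(3) by blast
    have \<phi>ends: "\<phi> 0 = 0" "\<phi> 1 = 1" unfolding \<phi>_def using s01 \<psi> by auto
    have \<sigma>\<phi>: "(\<sigma>1 \<circ> \<phi>) t = s t" if "t \<in> {0..1}" for t
      using \<psi>(6) srange that unfolding \<phi>_def by (auto simp: image_subset_iff)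
    define \<rho> where "\<rho> = \<rho>1 \<circ> \<phi>"
    have \<rho>: "pw_C1_real \<rho>" unfolding \<rho>_def by (rule pw_C1_compose[OF \<rho>1 \<phi> \<phi>mono \<phi>range])
    have \<rho>0: "0 \<le> \<rho> t" for t unfolding \<rho>_def using c1(3) by simp
    have c: "dw_curve N M \<rho> y (\<lambda>_. z)" unfolding dw_curve_def using \<rho> \<rho>0 y zc by auto
    let ?Q = "\<lambda>x. sqrt ((vd \<rho>1 x)\<^sup>2 + (f (\<rho>1 x))\<^sup>2 * (?l * vd \<sigma>1 x)\<^sup>2)"
    have "pw_cont (\<lambda>t. f (\<rho>1 t))"
      by (rule pw_cont_continuous, rule continuous_on_compose2[OF fc pw_C1_vd(2)[OF \<rho>1]]) (use c1(3) in auto)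
    then have Q: "pw_cont ?Q" by (intro pw_cont_intros pw_C1_vd(1) \<rho>1 \<sigma>1)
    obtain E4 where E4: "finite E4" "\<forall>t\<in>{0..1}-E4. vd (\<rho>1 \<circ> \<phi>) t = vd \<rho>1 (\<phi> t) * vd \<phi> t"
      using vd_compose[OF \<rho>1 \<phi> \<phi>mono \<phi>range] by (elim exE conjE)
    obtain E5 where E5: "finite E5" "\<forall>t\<in>{0..1}-E5. vd (\<sigma>1 \<circ> \<phi>) t = vd \<sigma>1 (\<phi> t) * vd \<phi> t"
      using vd_compose[OF \<sigma>1 \<phi> \<phi>mono \<phi>range] by (elim exE conjE)
    obtain E6 where E6: "finite E6" "\<forall>t\<in>{0..1}-E6. vd s t = vd ?T t * (1 / ?l)"
      unfolding s_def using vd_cmult[OF T, of "1/?l"] by (elim exE conjE)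
    obtain E7 where E7: "finite E7" "\<forall>t\<in>{0..1}-E7. vd ?T t = speed N y t"
      using pw_C1_integral(2)[OF sp] by (elim exE conjE)
    obtain E8 where E8: "finite E8" "{0,1} \<subseteq> E8" "\<forall>t\<in>{0..1}-E8. (\<phi> has_vector_derivative vd \<phi> t) (at t)"
      using pw_C1_vd(3)[OF \<phi>] by (elim exE conjE)
    have "dw_length f h N M \<rho> y (\<lambda>_. z) = integral {0..1} (\<lambda>t. ?Q (\<phi> t) * vd \<phi> t)"
      unfolding dw_length_eq
    proof (rule integral_spike_finite01[of "E4 \<union> E5 \<union> E6 \<union> E7 \<union> E8"])
      fix t :: real assume t: "t \<in> {0..1} - (E4 \<union> E5 \<union> E6 \<union> E7 \<union> E8)"
      have a: "vd \<rho> t = vd \<rho>1 (\<phi> t) * vd \<phi> t" unfolding \<rho>_def using E4(2) t by blast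
      have "vd s t = vd (\<sigma>1 \<circ> \<phi>) t" by (rule vd_cong) (use \<sigma>\<phi> t in auto)
      also have "\<dots> = vd \<sigma>1 (\<phi> t) * vd \<phi> t" using E5(2) t by blast
      finally have "vd ?T t * (1 / ?l) = vd \<sigma>1 (\<phi> t) * vd \<phi> t" using E6(2) t by auto
      moreover have "vd ?T t = speed N y t" using E7(2) t by blast
      ultimately have b: "speed N y t = ?l * vd \<sigma>1 (\<phi> t) * vd \<phi> t" using l by (simp add: field_simps)
      have "t \<noteq> 0" "t \<noteq> 1" using t E8(2) by blast+
      then have "t \<in> interior {0..1}" using t by simp
      moreover have "(\<phi> has_real_derivative vd \<phi> t) (at t)"
        using E8(3) t by (simp add: has_real_derivative_iff_has_vector_derivative)
      ultimately have nn: "0 \<le> vd \<phi> t" using mono_on_imp_deriv_nonneg[OF \<phi>mono] by blast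
      have "(x * k)\<^sup>2 + w\<^sup>2 * (u * k)\<^sup>2 = (x\<^sup>2 + w\<^sup>2 * u\<^sup>2) * k\<^sup>2" for x w u k :: real
        by (simp add: power2_eq_square algebra_simps)
      then have "sqrt ((x * k)\<^sup>2 + w\<^sup>2 * (u * k)\<^sup>2) = sqrt (x\<^sup>2 + w\<^sup>2 * u\<^sup>2) * \<bar>k\<bar>" for x w u k :: real
        by (simp only: real_sqrt_mult real_sqrt_abs)
      from this[of "vd \<rho>1 (\<phi> t)" "vd \<phi> t" "f (\<rho>1 (\<phi> t))" "?l * vd \<sigma>1 (\<phi> t)"]
      have "sqrt ((vd \<rho>1 (\<phi> t) * vd \<phi> t)\<^sup>2 + (f (\<rho>1 (\<phi> t)))\<^sup>2 * (?l * vd \<sigma>1 (\<phi> t) * vd \<phi> t)\<^sup>2) = ?Q (\<phi> t) * vd \<phi> t"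
        using nn by (simp only: abs_of_nonneg)
      moreover have "speed M (\<lambda>_. z) t = 0" using zs t by blast
      ultimately show "dw_speed \<rho> y (\<lambda>_. z) t = ?Q (\<phi> t) * vd \<phi> t"
        unfolding dw_speed_def a b by (simp add: \<rho>_def)
    qed (use E4 E5 E6 E7 E8 in auto)
    also have "\<dots> = integral {0..1} ?Q"
      using integral_unique[OF integral_substitution_mono[OF Q \<phi> \<phi>mono \<phi>range]] \<phi>ends by simp
    also have "\<dots> \<le> plane_dist f (r,0) (r,?l) + \<epsilon>" by (rule c1(11))
    finally have "dw_length f h N M \<rho> y (\<lambda>_. z) \<le> plane_dist f (r,0) (r,?l) + \<epsilon>" .
    moreover have "\<rho> 0 = r" "\<rho> 1 = r" unfolding \<rho>_def using \<phi>ends c1(4,5) by auto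
    ultimately show ?thesis using c by blast
  qed
qed

text \<open>Only the radial direction is unbounded: move radially to the radius of \<open>x0\<close>, and then
  inside that slice with a speed bounded in terms of the compact factors.\<close>

lemma dw_dist_bounds:
  assumes compN: "compact_space (rtop N)" "connected_space (rtop N)"
    and compM: "compact_space (rtop M)" "connected_space (rtop M)"
    and x0: "x0 \<in> topspace (dw_top h (rtop N) (rtop M))"
  shows "\<exists>C\<ge>0. \<forall>x\<in>topspace (dw_top h (rtop N) (rtop M)).
     \<bar>fst x - fst x0\<bar> \<le> dw_dist f h N M x x0 \<and> dw_dist f h N M x x0 \<le> \<bar>fst x - fst x0\<bar> + C"
proof -
  obtain r0 y0 z0 where 0: "0 \<le> r0" "y0 \<in> topspace (rtop N)" "z0 \<in> topspace (rtop M)" "x0 = collapse h (r0,y0,z0)"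
    using x0 unfolding topspace_dw by auto
  obtain CN where CN: "0 \<le> CN" "\<forall>y\<in>topspace (rtop N). \<exists>c. bounded_speed N CN c \<and> c 0 = y \<and> c 1 = y0"
    using uniform_connection[OF N compN 0(2)] by (elim exE conjE)
  obtain CM where CM: "0 \<le> CM" "\<forall>z\<in>topspace (rtop M). \<exists>c. bounded_speed M CM c \<and> c 0 = z \<and> c 1 = z0"
    using uniform_connection[OF M compM 0(3)] by (elim exE conjE)
  define C where "C = sqrt ((f r0)\<^sup>2 * CN\<^sup>2 + (h r0)\<^sup>2 * CM\<^sup>2)"
  have "\<bar>fst x - fst x0\<bar> \<le> dw_dist f h N M x x0 \<and> dw_dist f h N M x x0 \<le> \<bar>fst x - fst x0\<bar> + C"
    if x: "x \<in> topspace (dw_top h (rtop N) (rtop M))" for x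
  proof -
    obtain r y z where 1: "0 \<le> r" "y \<in> topspace (rtop N)" "z \<in> topspace (rtop M)" "x = collapse h (r,y,z)"
      using x unfolding topspace_dw by auto
    obtain cN where cN: "bounded_speed N CN cN" "cN 0 = y" "cN 1 = y0" using CN(2) 1(2) by blast
    obtain cM where cM: "bounded_speed M CM cM" "cM 0 = z" "cM 1 = z0" using CM(2) 1(3) by blast
    have pN: "pw_C1_curve N cN" and pM: "pw_C1_curve M cM"
      using cN(1) cM(1) unfolding bounded_speed_def[OF N] bounded_speed_def[OF M] by auto
    let ?\<rho>1 = "\<lambda>t. r + (r0 - r) * t" and ?\<rho>2 = "\<lambda>t::real. r0"
    let ?\<rho> = "join_paths ?\<rho>1 ?\<rho>2" and ?y = "join_paths (\<lambda>_. y) cN" and ?z = "join_paths (\<lambda>_. z) cM"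
    have \<rho>: "pw_C1_real ?\<rho>" by (rule pw_C1_join) auto
    have yj: "pw_C1_curve N ?y" by (rule pw_C1_curve_join[OF N pw_C1_curve_const[OF N 1(2)] pN]) (simp add: cN)
    have zj: "pw_C1_curve M ?z" by (rule pw_C1_curve_join[OF M pw_C1_curve_const[OF M 1(3)] pM]) (simp add: cM)
    have "0 \<le> ?\<rho> t" if t: "t \<in> {0..1}" for t
    proof (cases "t \<le> 1/2")
      case True
      have "0 \<le> (1 - 2*t) * r + 2*t * r0" using True t 1(1) 0(1) by auto
      also have "\<dots> = ?\<rho> t" using True by (simp add: join_paths_def algebra_simps)
      finally show ?thesis .
    next
      case False then show ?thesis using 0(1) by (simp add: join_paths_def)
    qed
    then have c: "dw_curve N M ?\<rho> ?y ?z" unfolding dw_curve_def using \<rho> yj zj by auto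
    let ?S = "{dw_length f h N M \<rho> y z | \<rho> y z. dw_curve N M \<rho> y z \<and>
     collapse h (\<rho> 0, y 0, z 0) = x \<and> collapse h (\<rho> 1, y 1, z 1) = x0}"
    have mem: "dw_length f h N M ?\<rho> ?y ?z \<in> ?S"
      by (intro CollectI exI[of _ ?\<rho>] exI[of _ ?y] exI[of _ ?z] conjI refl c) (simp_all add: 0(4) 1(4) cN(3) cM(3))
    have "\<bar>fst x - fst x0\<bar> \<le> dw_dist f h N M x x0"
      unfolding dw_dist_def
    proof (rule cInf_greatest)
      show "?S \<noteq> {}" using mem by blast
      fix l assume "l \<in> ?S"
      then obtain \<rho> y z where s: "l = dw_length f h N M \<rho> y z" "dw_curve N M \<rho> y z"
        "collapse h (\<rho> 0, y 0, z 0) = x" "collapse h (\<rho> 1, y 1, z 1) = x0" by blast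
      have "\<rho> 0 = fst x" "\<rho> 1 = fst x0" using s(3,4) unfolding collapse_def by auto
      then show "\<bar>fst x - fst x0\<bar> \<le> l" using dw_length_ge_radial[OF s(2)] s(1) by (simp add: abs_minus_commute)
    qed
    moreover have "dw_dist f h N M x x0 \<le> dw_length f h N M ?\<rho> ?y ?z"
      unfolding dw_dist_def
    proof (rule cInf_lower[OF mem])
      show "bdd_below ?S" by (rule bdd_belowI[of _ 0]) (auto intro: dw_length_nonneg)
    qed
    moreover have "dw_length f h N M ?\<rho> ?y ?z \<le> \<bar>r - r0\<bar> + C"
    proof -
      let ?G2 = "\<lambda>t. sqrt ((f r0)\<^sup>2 * (speed N cN t)\<^sup>2 + (h r0)\<^sup>2 * (speed M cM t)\<^sup>2)"
      have pG2: "pw_cont ?G2" by (intro pw_cont_intros pw_cont_speed[OF N pN] pw_cont_speed[OF M pM])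
      obtain E1 where E1: "finite E1" "\<forall>t\<in>{0..1}-E1. (t < 1/2 \<longrightarrow> vd ?\<rho> t = 2 * vd ?\<rho>1 (2*t)) \<and>
        (t > 1/2 \<longrightarrow> vd ?\<rho> t = 2 * vd ?\<rho>2 (2*t-1))"
        using vd_join[of ?\<rho>1 ?\<rho>2] by auto
      obtain E2 where E2: "finite E2" "\<forall>t\<in>{0..1}-E2. t \<noteq> 1/2 \<and> (t < 1/2 \<longrightarrow> speed N ?y t = 2 * speed N (\<lambda>_. y) (2*t)) \<and>
        (t > 1/2 \<longrightarrow> speed N ?y t = 2 * speed N cN (2*t-1))"
        using speed_join[OF N pw_C1_curve_const[OF N 1(2)] pN] cN(2) by auto
      obtain E3 where E3: "finite E3" "\<forall>t\<in>{0..1}-E3. t \<noteq> 1/2 \<and> (t < 1/2 \<longrightarrow> speed M ?z t = 2 * speed M (\<lambda>_. z) (2*t)) \<and>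
        (t > 1/2 \<longrightarrow> speed M ?z t = 2 * speed M cM (2*t-1))"
        using speed_join[OF M pw_C1_curve_const[OF M 1(3)] pM] cM(2) by auto
      have "dw_length f h N M ?\<rho> ?y ?z = integral {0..1} (\<lambda>_::real. \<bar>r - r0\<bar>) + integral {0..1} ?G2"
        unfolding dw_length_eq
      proof (rule integral_join[OF pw_cont_dw_speed[OF c], of "E1 \<union> E2 \<union> E3"])
        show "finite (E1 \<union> E2 \<union> E3)" using E1 E2 E3 by auto
        fix t :: real assume t: "t \<in> {0..1} - (E1 \<union> E2 \<union> E3)"
        show "dw_speed ?\<rho> ?y ?z t = 2 * \<bar>r - r0\<bar>" if lt: "t < 1/2"
        proof -
          have t2: "2*t \<in> {0..1}" using lt t by auto
          have "vd ?\<rho> t = 2 * (r0 - r)" using E1(2) t lt vd_affine[OF t2, of r "r0 - r"] by auto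
          moreover have "speed N ?y t = 0" using E2(2) t lt speed_const[OF N 1(2) t2] by auto
          moreover have "speed M ?z t = 0" using E3(2) t lt speed_const[OF M 1(3) t2] by auto
          ultimately have "dw_speed ?\<rho> ?y ?z t = sqrt ((2 * (r0 - r))\<^sup>2)" unfolding dw_speed_def by simp
          also have "\<dots> = \<bar>2\<bar> * \<bar>r0 - r\<bar>" by (simp only: real_sqrt_abs abs_mult)
          finally show ?thesis by (simp add: abs_minus_commute)
        qed
        show "dw_speed ?\<rho> ?y ?z t = 2 * ?G2 (2*t-1)" if gt: "t > 1/2"
        proof -
          have t2: "2*t-1 \<in> {0..1}" using gt t by auto
          have a: "vd ?\<rho> t = 0" using E1(2) t gt vd_const[OF t2, of r0] by auto
          have b: "speed N ?y t = 2 * speed N cN (2*t-1)" using E2(2) t gt by auto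
          have d: "speed M ?z t = 2 * speed M cM (2*t-1)" using E3(2) t gt by auto
          have e: "?\<rho> t = r0" using gt by (simp add: join_paths_def)
          have "0\<^sup>2 + w\<^sup>2 * (2 * u)\<^sup>2 + w'\<^sup>2 * (2 * u')\<^sup>2 = 2\<^sup>2 * (w\<^sup>2 * u\<^sup>2 + w'\<^sup>2 * u'\<^sup>2)" for w u w' u' :: real
            by (simp add: power2_eq_square algebra_simps)
          then have "sqrt (0\<^sup>2 + w\<^sup>2 * (2 * u)\<^sup>2 + w'\<^sup>2 * (2 * u')\<^sup>2) = \<bar>2\<bar> * sqrt (w\<^sup>2 * u\<^sup>2 + w'\<^sup>2 * u'\<^sup>2)" for w u w' u' :: real
            by (simp only: real_sqrt_mult real_sqrt_abs)
          then show ?thesis unfolding dw_speed_def a b d e by (simp only: abs_numeral)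
        qed
      qed
      moreover have "integral {0..1} ?G2 \<le> integral {0..1} (\<lambda>_::real. C)"
      proof -
        obtain F1 where F1: "finite F1" "\<forall>t\<in>{0..1}-F1. speed N cN t \<le> CN" using cN(1) unfolding bounded_speed_def[OF N] by auto
        obtain F2 where F2: "finite F2" "\<forall>t\<in>{0..1}-F2. speed M cM t \<le> CM" using cM(1) unfolding bounded_speed_def[OF M] by auto
        obtain F3 where F3: "finite F3" "\<forall>t\<in>{0..1}-F3. 0 \<le> speed N cN t" using speed_nonneg[OF N pN] by auto
        obtain F4 where F4: "finite F4" "\<forall>t\<in>{0..1}-F4. 0 \<le> speed M cM t" using speed_nonneg[OF M pM] by auto
        show ?thesis
        proof (rule integral_mono_finite[of "F1 \<union> F2 \<union> F3 \<union> F4"])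
          fix t :: real assume t: "t \<in> {0..1} - (F1 \<union> F2 \<union> F3 \<union> F4)"
          have "(speed N cN t)\<^sup>2 \<le> CN\<^sup>2" "(speed M cM t)\<^sup>2 \<le> CM\<^sup>2"
            using F1(2) F2(2) F3(2) F4(2) t by (auto intro!: power_mono)
          then show "?G2 t \<le> C" unfolding C_def by (intro real_sqrt_le_mono add_mono mult_left_mono) auto
        qed (use F1 F2 F3 F4 pw_cont_integrable[OF pG2] in auto)
      qed
      ultimately show ?thesis by simp
    qed
    moreover have "fst x = r" "fst x0 = r0" using 0(4) 1(4) unfolding collapse_def by auto
    ultimately show ?thesis by linarith
  qed
  moreover have "0 \<le> C" unfolding C_def by simp
  ultimately show ?thesis by blast
qed

end

lemma smooth_on_continuous: "smooth_on S F \<Longrightarrow> continuous_on S F"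
proof -
  assume "smooth_on S F"
  then have "Ck_on 0 F S" unfolding smooth_on_def by blast
  then show ?thesis by simp
qed

section \<open>Lengths of deck transformations\<close>

context
  fixes N :: "('n, 'e::real_inner) riem" and TN :: "'c topology" and p :: "'c \<Rightarrow> 'n" and \<gamma> :: "'c \<Rightarrow> 'c"
  assumes N: "riemannian_manifold N" and cov: "covering_map TN (rtop N) p"
    and conn: "connected_space TN" and \<gamma>: "\<gamma> \<in> deck TN p" and ne: "topspace TN \<noteq> {}"
begin

lemma deck_in: "y \<in> topspace TN \<Longrightarrow> \<gamma> y \<in> topspace TN"
  using \<gamma> homeomorphic_imp_surjective_map[of TN TN \<gamma>] unfolding deck_def by blast

lemma deck_curve_exists:
  assumes "y \<in> topspace TN"
  shows "\<exists>\<beta>. pathin TN \<beta> \<and> \<beta> 0 = \<gamma> y \<and> \<beta> 1 = y \<and> pw_C1_curve N (p \<circ> \<beta>)"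
  using cover_curves[OF N cov conn deck_in[OF assms] assms] unfolding bounded_speed_def[OF N] by blast

text \<open>An infimum of reals is meaningful only for a nonempty set bounded below.\<close>

lemma deck_curve_lengths:
  assumes "y \<in> topspace TN"
  shows "{riem_length N (p \<circ> \<beta>) | \<beta>. pathin TN \<beta> \<and> \<beta> 0 = \<gamma> y \<and> \<beta> 1 = y \<and> pw_C1_curve N (p \<circ> \<beta>)} \<noteq> {}"
    and "bdd_below {riem_length N (p \<circ> \<beta>) | \<beta>. pathin TN \<beta> \<and> \<beta> 0 = \<gamma> y \<and> \<beta> 1 = y \<and> pw_C1_curve N (p \<circ> \<beta>)}"
proof -
  show "{riem_length N (p \<circ> \<beta>) | \<beta>. pathin TN \<beta> \<and> \<beta> 0 = \<gamma> y \<and> \<beta> 1 = y \<and> pw_C1_curve N (p \<circ> \<beta>)} \<noteq> {}"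
    using deck_curve_exists[OF assms] by blast
  show "bdd_below {riem_length N (p \<circ> \<beta>) | \<beta>. pathin TN \<beta> \<and> \<beta> 0 = \<gamma> y \<and> \<beta> 1 = y \<and> pw_C1_curve N (p \<circ> \<beta>)}"
    by (rule bdd_belowI[of _ 0]) (auto intro: riem_length_nonneg[OF N])
qed

lemma displacement_nonneg: "y \<in> topspace TN \<Longrightarrow> 0 \<le> riem_cover_dist N TN p (\<gamma> y) y"
  unfolding riem_cover_dist_def
  by (rule cInf_greatest[OF deck_curve_lengths(1)]) (auto intro: riem_length_nonneg[OF N])

lemma deck_length_nonneg: "0 \<le> deck_length N TN p \<gamma>"
  unfolding deck_length_def by (rule cINF_greatest[OF ne displacement_nonneg])

lemma deck_length_le:
  assumes "pathin TN \<beta>" "\<beta> 0 = \<gamma> y" "\<beta> 1 = y" "pw_C1_curve N (p \<circ> \<beta>)" "y \<in> topspace TN"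
  shows "deck_length N TN p \<gamma> \<le> riem_length N (p \<circ> \<beta>)"
proof -
  have "deck_length N TN p \<gamma> \<le> riem_cover_dist N TN p (\<gamma> y) y"
    unfolding deck_length_def
    by (rule cINF_lower[OF _ assms(5)], rule bdd_belowI[of _ 0]) (use displacement_nonneg in auto)
  also have "\<dots> \<le> riem_length N (p \<circ> \<beta>)"
    unfolding riem_cover_dist_def
    by (rule cInf_lower[OF _ deck_curve_lengths(2)[OF assms(5)]]) (use assms in blast)
  finally show ?thesis .
qed

lemma deck_length_approx:
  assumes "deck_length N TN p \<gamma> < m"
  shows "\<exists>y \<beta>. y \<in> topspace TN \<and> pathin TN \<beta> \<and> \<beta> 0 = \<gamma> y \<and> \<beta> 1 = y \<and> pw_C1_curve N (p \<circ> \<beta>) \<and>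
    riem_length N (p \<circ> \<beta>) < m"
proof -
  have "(\<lambda>y. riem_cover_dist N TN p (\<gamma> y) y) ` topspace TN \<noteq> {}" using ne by simp
  from cInf_lessD[OF this assms[unfolded deck_length_def]]
  obtain y where y: "y \<in> topspace TN" "riem_cover_dist N TN p (\<gamma> y) y < m" by auto
  from cInf_lessD[OF deck_curve_lengths(1)[OF y(1)] y(2)[unfolded riem_cover_dist_def]] y(1)
  show ?thesis by blast
qed

end

section \<open>Displacements in the universal cover of the warped product\<close>

locale warped_covers = warped_factors N M f h
  for N :: "('n, 'e::real_inner) riem" and M :: "('m, 'd::real_inner) riem" and f h +
  fixes TN :: "'c topology" and p :: "'c \<Rightarrow> 'n" and TX :: "'x topology" and q :: "'x \<Rightarrow> real \<times> 'n \<times> 'm option"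
    and g :: "'x \<Rightarrow> 'x" and \<gamma> :: "'c \<Rightarrow> 'c"
  assumes covN: "covering_map TN (rtop N) p" and scN: "simply_connected_space TN"
    and covX: "covering_map TX (dw_top h (rtop N) (rtop M)) q" and scX: "simply_connected_space TX"
    and coll: "simply_connected_space (rtop M) \<or> h 0 = 0"
    and g: "g \<in> deck TX q" and \<gamma>: "\<gamma> \<in> deck TN p" and ind: "induced_on_deck TX q TN p (\<lambda>(r, y, z). y) g \<gamma>"
begin

abbreviation X where "X \<equiv> dw_top h (rtop N) (rtop M)"
abbreviation link where "link \<equiv> linked TX q TN p dw_pr"
abbreviation L where "L \<equiv> deck_length N TN p \<gamma>"

lemma path_connected_TX: "path_connected_space TX" and path_connected_TN: "path_connected_space TN" and connected_TN: "connected_space TN"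
proof -
  show "path_connected_space TX" "path_connected_space TN" using scX scN unfolding simply_connected_space_def by auto
  then show "connected_space TN" using path_connected_imp_connected_space by blast
qed

text \<open>The correspondence between \<open>g\<close> and \<open>\<gamma>\<close>, in terms of linked pairs.\<close>

lemma base_link: "\<exists>a b. a \<in> topspace TX \<and> b \<in> topspace TN \<and> p b = dw_pr (q a) \<and> link (a, b) (g a, \<gamma> b)"
proof -
  obtain \<alpha> \<beta> where *: "pathin TX \<alpha>" "\<alpha> 1 = g (\<alpha> 0)" "pathin TN \<beta>" "\<beta> 1 = \<gamma> (\<beta> 0)"
    "\<forall>t\<in>{0..1}. p (\<beta> t) = dw_pr (q (\<alpha> t))" using ind unfolding induced_on_deck_def by (elim exE conjE)
  have "link (\<alpha> 0, \<beta> 0) (\<alpha> 1, \<beta> 1)" unfolding linked_def using * by (intro exI[of _ \<alpha>] exI[of _ \<beta>]) auto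
  then show ?thesis using * pathin_topspace[OF *(1), of 0] pathin_topspace[OF *(3), of 0]
    by (intro exI[of _ "\<alpha> 0"] exI[of _ "\<beta> 0"]) auto
qed

lemma cover_nonempty: "topspace TN \<noteq> {}" using base_link by blast

lemmas deck_facts = N covN connected_TN \<gamma> cover_nonempty

lemma q_in: "x \<in> topspace TX \<Longrightarrow> q x \<in> topspace X"
  using covX unfolding covering_map_def by blast

lemma g_in: "x \<in> topspace TX \<Longrightarrow> g x \<in> topspace TX" "x \<in> topspace TX \<Longrightarrow> q (g x) = q x"
  using g homeomorphic_imp_surjective_map[of TX TX g] unfolding deck_def by blast+

lemma p_gamma: "y \<in> topspace TN \<Longrightarrow> p (\<gamma> y) = p y"
  using \<gamma> unfolding deck_def by blast

lemma link_ends: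
  assumes "link (x,y) (x',y')"
  shows "x' \<in> topspace TX" "y' \<in> topspace TN" "p y' = dw_pr (q x')"
proof -
  obtain \<alpha> \<beta> where *: "pathin TX \<alpha>" "pathin TN \<beta>" "\<forall>t\<in>{0..1}. p (\<beta> t) = dw_pr (q (\<alpha> t))"
     "(\<alpha> 0, \<beta> 0) = (x,y)" "(\<alpha> 1, \<beta> 1) = (x',y')" using assms unfolding linked_def by (elim exE conjE)
  have "\<alpha> 1 = x'" "\<beta> 1 = y'" using *(5) by auto
  then show "x' \<in> topspace TX" "y' \<in> topspace TN" "p y' = dw_pr (q x')"
    using pathin_topspace[OF *(1), of 1] pathin_topspace[OF *(2), of 1] bspec[OF *(3), of 1] by auto
qed

text \<open>Travel from \<open>(x, y)\<close> back to the base pair, from there to its translate, and along the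
  translated path to \<open>(g x, \<gamma> y)\<close>.\<close>

lemma link_equivariant:
  assumes "link (a, b) (g a, \<gamma> b)" "link (a, b) (x, y)"
  shows "link (x, y) (g x, \<gamma> y)"
  using linked_trans[OF linked_trans[OF linked_sym[OF assms(2)] assms(1)] linked_deck[OF assms(2) g \<gamma>]] .

lemma partner: "x \<in> topspace TX \<Longrightarrow> \<exists>y. link (x, y) (g x, \<gamma> y) \<and> y \<in> topspace TN \<and> p y = dw_pr (q x)"
proof -
  assume x: "x \<in> topspace TX"
  obtain a b where ab: "a \<in> topspace TX" "b \<in> topspace TN" "p b = dw_pr (q a)" "link (a, b) (g a, \<gamma> b)"
    using base_link by (elim exE conjE)
  obtain y where y: "link (a, b) (x, y)"
    by (rule linked_exists[OF covX continuous_dw_pr covN path_connected_TX ab(1) x ab(2,3)])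
  show ?thesis using link_equivariant[OF ab(4) y] link_ends[OF y] by blast
qed

abbreviation lengths where "lengths x \<equiv> {dw_length f h N M \<rho> y z | \<rho> y z. dw_curve N M \<rho> y z \<and>
     (\<exists>\<alpha>. pathin TX \<alpha> \<and> \<alpha> 0 = g x \<and> \<alpha> 1 = x \<and>
          (\<forall>t\<in>{0..1}. q (\<alpha> t) = collapse h (\<rho> t, y t, z t)))}"

text \<open>Lift the curve to the cover, starting at \<open>g x\<close>. Its end point lies in the fibre of
  \<open>x\<close> and is linked to the same \<open>y\<close>, so it is \<open>x\<close>.\<close>

lemma lift_to_displacement:
  assumes x: "link (x, y) (g x, \<gamma> y)" "x \<in> topspace TX" "y \<in> topspace TN"
    and \<beta>: "pathin TN \<beta>" "\<beta> 0 = \<gamma> y" "\<beta> 1 = y" and c: "dw_curve N M \<rho> (p \<circ> \<beta>) (\<lambda>_. z)"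
    and z: "z \<in> topspace (rtop M)" and ends: "\<rho> 0 = r" "\<rho> 1 = r" "q x = collapse h (r, p y, z)"
  shows "dw_length f h N M \<rho> (p \<circ> \<beta>) (\<lambda>_. z) \<in> lengths x"
proof -
  have \<rho>: "pw_C1_real \<rho>" "\<forall>t\<in>{0..1}. 0 \<le> \<rho> t" using c unfolding dw_curve_def by auto
  have pc: "continuous_map TN (rtop N) p" using covN unfolding covering_map_def by simp
  have "pathin X (\<lambda>t. collapse h (\<rho> t, (p \<circ> \<beta>) t, z))"
    unfolding pathin_def
  proof (rule continuous_map_into_cyl)
    show "continuous_map (top_of_set {0..1}) (top_of_set {0..}) \<rho>" using pw_C1_vd(2)[OF \<rho>(1)] \<rho>(2) by auto
    show "continuous_map (top_of_set {0..1}) (rtop N) (p \<circ> \<beta>)" using pathin_compose[OF \<beta>(1) pc] unfolding pathin_def .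
    show "continuous_map (top_of_set {0..1}) (rtop M) (\<lambda>_. z)" using z by simp
  qed
  moreover have "q (g x) = collapse h (\<rho> 0, (p \<circ> \<beta>) 0, z)"
    using g_in(2)[OF x(2)] ends \<beta>(2) p_gamma[OF x(3)] by simp
  ultimately obtain \<alpha> where \<alpha>: "pathin TX \<alpha>" "\<alpha> 0 = g x"
    "\<And>t. t \<in> {0..1} \<Longrightarrow> q (\<alpha> t) = collapse h (\<rho> t, (p \<circ> \<beta>) t, z)"
    using covering_lift_path[OF covX _ g_in(1)[OF x(2)]] by blast
  have "link (\<alpha> 0, \<beta> 0) (\<alpha> 1, \<beta> 1)"
    by (rule linkedI[of TX \<alpha> TN \<beta> p dw_pr q, OF \<alpha>(1) \<beta>(1)]) (simp add: \<alpha>(3) collapse_def)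
  then have "link (g x, \<gamma> y) (\<alpha> 1, y)" using \<alpha>(2) \<beta>(2,3) by simp
  from linked_trans[OF x(1) this] have "link (x, y) (\<alpha> 1, y)" .
  moreover have "q x = q (\<alpha> 1)" using \<alpha>(3)[of 1] ends \<beta>(3) by simp
  ultimately have "x = \<alpha> 1" using linked_injective[OF covX covN scN coll] by blast
  then show ?thesis
    by (intro CollectI exI[of _ \<rho>] exI[of _ "p \<circ> \<beta>"] exI[of _ "\<lambda>_. z"] exI[of _ \<alpha>] conjI refl c ballI)
      (simp_all add: \<alpha>)
qed

lemma lengths_bdd: "bdd_below (lengths x)"
  by (rule bdd_belowI[of _ 0]) (auto intro: dw_length_nonneg)

lemma cover_dist_eq: "dw_cover_dist f h N M TX q (g x) x = Inf (lengths x)"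
  unfolding dw_cover_dist_def ..

lemma lengths_nonempty:
  assumes x: "x \<in> topspace TX" shows "lengths x \<noteq> {}"
proof -
  obtain y where y: "link (x, y) (g x, \<gamma> y)" "y \<in> topspace TN" "p y = dw_pr (q x)"
    using partner[OF x] by (elim exE conjE)
  obtain r y' z where q: "0 \<le> r" "z \<in> topspace (rtop M)" "q x = collapse h (r, y', z)"
    using q_in[OF x] unfolding topspace_dw by auto
  have "y' = p y" using y(3) q(3) by (simp add: collapse_def)
  then have qx: "q x = collapse h (r, p y, z)" using q(3) by simp
  obtain \<beta> where \<beta>: "pathin TN \<beta>" "\<beta> 0 = \<gamma> y" "\<beta> 1 = y" "pw_C1_curve N (p \<circ> \<beta>)"
    using deck_curve_exists[OF deck_facts y(2)] by (elim exE conjE)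
  have "dw_curve N M (\<lambda>_. r) (p \<circ> \<beta>) (\<lambda>_. z)"
    unfolding dw_curve_def using q(1) \<beta>(4) pw_C1_curve_const[OF M q(2)] by auto
  from lift_to_displacement[OF y(1) x y(2) \<beta>(1-3) this q(2) refl refl qx] show ?thesis by blast
qed

text \<open>The component in \<open>N\<close> of a curve from \<open>g x\<close> to \<open>x\<close> lifts to a path
  that starts at \<open>\<gamma> y\<close> and ends at \<open>y\<close>, where \<open>y\<close> is the
  partner of \<open>x\<close>. Its length is therefore at least \<open>L\<close>, and unrolling applies.\<close>

lemma displacement_ge:
  assumes x: "x \<in> topspace TX"
  shows "plane_dist f (fst (q x), 0) (fst (q x), L) \<le> dw_cover_dist f h N M TX q (g x) x"
  unfolding cover_dist_eq
proof (rule cInf_greatest[OF lengths_nonempty[OF x]])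
  fix l assume "l \<in> lengths x"
  then obtain \<rho> yc z \<alpha> where l: "l = dw_length f h N M \<rho> yc z" "dw_curve N M \<rho> yc z"
    "pathin TX \<alpha>" "\<alpha> 0 = g x" "\<alpha> 1 = x" "\<forall>t\<in>{0..1}. q (\<alpha> t) = collapse h (\<rho> t, yc t, z t)"
    by blast
  have qt: "q (\<alpha> t) = collapse h (\<rho> t, yc t, z t)" if "t \<in> {0..1}" for t using l(6) that by blast
  have yc: "pw_C1_curve N yc" using l(2) unfolding dw_curve_def by simp
  then have py: "pathin (rtop N) yc" unfolding pw_C1_curve_iff[OF N] by simp
  obtain y where y: "link (x, y) (g x, \<gamma> y)" "y \<in> topspace TN" "p y = dw_pr (q x)"
    using partner[OF x] by (elim exE conjE)
  have "q (g x) = collapse h (\<rho> 0, yc 0, z 0)" using qt[of 0] l(4) by simp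
  then have "p (\<gamma> y) = yc 0"
    using p_gamma[OF y(2)] y(3) g_in(2)[OF x] by (simp add: collapse_def)
  then obtain \<beta> where \<beta>: "pathin TN \<beta>" "\<beta> 0 = \<gamma> y" "\<And>t. t \<in> {0..1} \<Longrightarrow> p (\<beta> t) = yc t"
    using covering_lift_path[OF covN py deck_in[OF deck_facts y(2)]] by blast
  have "link (\<alpha> 0, \<beta> 0) (\<alpha> 1, \<beta> 1)"
    by (rule linkedI[of TX \<alpha> TN \<beta> p dw_pr q, OF l(3) \<beta>(1)]) (simp add: qt \<beta>(3) collapse_def)
  then have "link (x, y) (x, \<beta> 1)" using linked_trans[OF y(1)] l(4,5) \<beta>(2) by simp
  then have \<beta>1: "\<beta> 1 = y" using linked_functional[OF covX continuous_dw_pr covN scX] by metis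
  have "pw_C1_curve N (p \<circ> \<beta>)" by (rule pw_C1_curve_cong[OF N yc]) (simp add: \<beta>(3))
  then have "L \<le> riem_length N (p \<circ> \<beta>)"
    by (rule deck_length_le[OF deck_facts \<beta>(1,2) \<beta>1 _ y(2)])
  also have "\<dots> = riem_length N yc" by (rule riem_length_cong) (simp add: \<beta>(3))
  finally have "plane_dist f (\<rho> 0, 0) (\<rho> 1, L) \<le> dw_length f h N M \<rho> yc z"
    by (rule plane_dist_le_dw_length[OF l(2) deck_length_nonneg[OF deck_facts]])
  moreover have "\<rho> 0 = fst (q x)" "\<rho> 1 = fst (q x)"
    using qt[of 0] qt[of 1] l(4,5) g_in(2)[OF x] by (auto simp: collapse_def)
  ultimately show "plane_dist f (fst (q x), 0) (fst (q x), L) \<le> l" using l(1) by simp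
qed

text \<open>Choose a point \<open>y\<close> that is displaced by little more than \<open>L\<close>, and let
  \<open>x\<close> be a partner of it at radius \<open>r\<close>, found by lifting a path in the warped
  product. The additive error \<open>1\<close> becomes negligible after division by \<open>r\<close>.\<close>

lemma displacement_le:
  assumes r: "0 < r"
  shows "\<exists>x\<in>topspace TX. fst (q x) = r \<and> dw_cover_dist f h N M TX q (g x) x \<le> plane_dist f (r, 0) (r, L) + 1"
proof -
  have fr: "f r > 0" using fpos r by simp
  \<comment> \<open>A surplus \<open>1/(2 * f r)\<close> of the length in \<open>N\<close> costs at most \<open>1/2\<close> at radius \<open>r\<close>.\<close>
  obtain y \<beta> where y: "y \<in> topspace TN" "pathin TN \<beta>" "\<beta> 0 = \<gamma> y" "\<beta> 1 = y" "pw_C1_curve N (p \<circ> \<beta>)"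
    "riem_length N (p \<circ> \<beta>) < L + 1 / (2 * f r)"
    using deck_length_approx[OF deck_facts, of "L + 1 / (2 * f r)"] fr by auto
  let ?l = "riem_length N (p \<circ> \<beta>)"
  obtain a b where ab: "a \<in> topspace TX" "b \<in> topspace TN" "p b = dw_pr (q a)" "link (a, b) (g a, \<gamma> b)"
    using base_link by (elim exE conjE)
  obtain ra ya z where qa: "0 \<le> ra" "z \<in> topspace (rtop M)" "q a = collapse h (ra, ya, z)"
    using q_in[OF ab(1)] unfolding topspace_dw by auto
  have ya: "ya = p b" using ab(3) qa(3) by (simp add: collapse_def)
  obtain \<eta> where \<eta>: "pathin TN \<eta>" "\<eta> 0 = b" "\<eta> 1 = y"
    using path_connected_TN ab(2) y(1) unfolding path_connected_space_def by metis
  have pc: "continuous_map TN (rtop N) p" using covN unfolding covering_map_def by simp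
  have path: "pathin X (\<lambda>t. collapse h ((1 - t) * ra + t * r, (p \<circ> \<eta>) t, z))"
    unfolding pathin_def
  proof (rule continuous_map_into_cyl)
    show "continuous_map (top_of_set {0..1}) (top_of_set {0..}) (\<lambda>t. (1 - t) * ra + t * r)"
      using qa(1) r by (auto intro!: continuous_intros)
    show "continuous_map (top_of_set {0..1}) (rtop N) (p \<circ> \<eta>)" using pathin_compose[OF \<eta>(1) pc] unfolding pathin_def .
    show "continuous_map (top_of_set {0..1}) (rtop M) (\<lambda>_. z)" using qa(2) by simp
  qed
  have "q a = collapse h ((1 - 0) * ra + 0 * r, (p \<circ> \<eta>) 0, z)" using qa(3) ya \<eta>(2) by simp
  then obtain \<alpha> where \<alpha>: "pathin TX \<alpha>" "\<alpha> 0 = a"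
    "\<And>t. t \<in> {0..1} \<Longrightarrow> q (\<alpha> t) = collapse h ((1 - t) * ra + t * r, (p \<circ> \<eta>) t, z)"
    using covering_lift_path[OF covX path ab(1)] by blast
  define x where "x = \<alpha> 1"
  have x: "x \<in> topspace TX" unfolding x_def by (rule pathin_topspace[OF \<alpha>(1)]) simp
  have qx: "q x = collapse h (r, p y, z)" unfolding x_def using \<alpha>(3)[of 1] \<eta>(3) by simp
  have "link (\<alpha> 0, \<eta> 0) (\<alpha> 1, \<eta> 1)"
    by (rule linkedI[of TX \<alpha> TN \<eta> p dw_pr q, OF \<alpha>(1) \<eta>(1)]) (simp add: \<alpha>(3) collapse_def)
  then have "link (a, b) (x, y)" using \<alpha>(2) \<eta>(2,3) unfolding x_def by simp
  from link_equivariant[OF ab(4) this] have link: "link (x, y) (g x, \<gamma> y)" .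
  obtain \<rho> where \<rho>: "dw_curve N M \<rho> (p \<circ> \<beta>) (\<lambda>_. z)" "\<rho> 0 = r" "\<rho> 1 = r"
    "dw_length f h N M \<rho> (p \<circ> \<beta>) (\<lambda>_. z) \<le> plane_dist f (r, 0) (r, ?l) + 1/2"
    using dw_curve_along[OF less_imp_le[OF r] y(5) qa(2), of "1/2"] by auto
  have "dw_length f h N M \<rho> (p \<circ> \<beta>) (\<lambda>_. z) \<in> lengths x"
    by (rule lift_to_displacement[OF link x y(1-4) \<rho>(1) qa(2) \<rho>(2,3) qx])
  then have "dw_cover_dist f h N M TX q (g x) x \<le> dw_length f h N M \<rho> (p \<circ> \<beta>) (\<lambda>_. z)"
    unfolding cover_dist_eq by (rule cInf_lower[OF _ lengths_bdd])
  also have "\<dots> \<le> plane_dist f (r, 0) (r, ?l) + 1/2" by (rule \<rho>(4))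
  also have "plane_dist f (r, 0) (r, ?l) \<le> plane_dist f (r, 0) (r, L) + plane_dist f (r, L) (r, ?l)"
    by (rule plane_dist_triangle[OF fc fpos])
  also have "plane_dist f (r, L) (r, ?l) \<le> f \<bar>r\<bar> * \<bar>L - ?l\<bar>" by (rule plane_dist_horizontal[OF fc fpos])
  also have "\<dots> \<le> f r * (1 / (2 * f r))"
  proof -
    have "L \<le> ?l" by (rule deck_length_le[OF deck_facts y(2-5) y(1)])
    then show ?thesis using y(6) r fr by (intro mult_mono) auto
  qed
  also have "\<dots> = 1/2" using fr by simp
  finally have "dw_cover_dist f h N M TX q (g x) x \<le> plane_dist f (r, 0) (r, L) + 1" by simp
  moreover have "fst (q x) = r" using qx by (simp add: collapse_def)
  ultimately show ?thesis using x by blast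
qed

end

section \<open>The limit\<close>

lemma Liminf_ereal_eq:
  fixes u v :: "real \<Rightarrow> real"
  assumes "((\<lambda>r. u r - v r) \<longlongrightarrow> 0) at_top"
  shows "Liminf at_top (\<lambda>r. ereal (u r)) = Liminf at_top (\<lambda>r. ereal (v r))"
proof -
  have half: "Liminf at_top (\<lambda>r. ereal (v r)) \<le> Liminf at_top (\<lambda>r. ereal (u r))"
    if "((\<lambda>r. u r - v r) \<longlongrightarrow> 0) at_top" for u v :: "real \<Rightarrow> real"
  proof (rule ereal_le_epsilon2)
    fix e :: real assume e: "0 < e"
    have "\<forall>\<^sub>F r in at_top. dist (u r - v r) 0 < e" using that e by (simp add: tendsto_iff)
    then have "\<forall>\<^sub>F r in at_top. ereal (v r) \<le> ereal (u r) + ereal e"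
      by eventually_elim (auto simp: dist_real_def)
    then have "Liminf at_top (\<lambda>r. ereal (v r)) \<le> Liminf at_top (\<lambda>r. ereal (u r) + ereal e)"
      by (rule Liminf_mono)
    also have "\<dots> = Liminf at_top (\<lambda>r. ereal (u r)) + ereal e"
      by (rule Liminf_add_ereal_right) auto
    finally show "Liminf at_top (\<lambda>r. ereal (v r)) \<le> Liminf at_top (\<lambda>r. ereal (u r)) + ereal e" .
  qed
  have "((\<lambda>r. v r - u r) \<longlongrightarrow> 0) at_top" using tendsto_minus[OF assms] by simp
  then show ?thesis using half[OF assms] half by (intro antisym)
qed

text \<open>Distances to the base point differ from the radius by a bounded amount, and numerators from
  \<open>F\<close> by at most \<open>1\<close>. As \<open>F r / r\<close> stays bounded, the quotients
  \<open>F r / (r + b + C)\<close> and \<open>(F r + 1) / (r - b)\<close>, which enclose the infima, have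
  the same limit inferior as \<open>F r / r\<close>.\<close>

lemma limit_of_infima:
  fixes d \<delta> \<rho> :: "'x \<Rightarrow> real" and F :: "real \<Rightarrow> real"
  assumes F: "\<And>r. 0 \<le> r \<Longrightarrow> 0 \<le> F r" "\<And>r. 0 \<le> r \<Longrightarrow> F r \<le> 2 * r + K" and b: "0 \<le> b" and C: "0 \<le> C"
    and \<rho>: "\<And>x. x \<in> A \<Longrightarrow> 0 \<le> \<rho> x"
    and d: "\<And>x. x \<in> A \<Longrightarrow> \<bar>\<rho> x - b\<bar> \<le> d x" "\<And>x. x \<in> A \<Longrightarrow> d x \<le> \<bar>\<rho> x - b\<bar> + C"
    and lower: "\<And>x. x \<in> A \<Longrightarrow> F (\<rho> x) \<le> \<delta> x"
    and upper: "\<And>r. 0 < r \<Longrightarrow> \<exists>x\<in>A. \<rho> x = r \<and> \<delta> x \<le> F r + 1"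
  shows "((\<lambda>R. INF x\<in>{x\<in>A. R \<le> d x}. ereal (\<delta> x / d x)) \<longlongrightarrow> Liminf at_top (\<lambda>r. ereal (F r / r))) at_top"
proof -
  define \<Phi> where "\<Phi> = (\<lambda>R. INF x\<in>{x\<in>A. R \<le> d x}. ereal (\<delta> x / d x))"
  define \<Lambda> where "\<Lambda> = Liminf at_top (\<lambda>r. ereal (F r / r))"
  let ?K = "\<bar>K\<bar>"
  have bnd: "0 \<le> F r / r \<and> F r / r \<le> 2 + ?K" if "1 \<le> r" for r
  proof -
    have "?K \<le> ?K * r" using that mult_left_mono[of 1 r ?K] by simp
    then have "F r \<le> (2 + ?K) * r" using F(2)[of r] that by (simp add: algebra_simps)
    then show ?thesis using F(1)[of r] that by (simp add: divide_le_eq)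
  qed
  have lo: "Liminf at_top (\<lambda>r. ereal (F r / (r + b + C))) = \<Lambda>"
    unfolding \<Lambda>_def
  proof (rule Liminf_ereal_eq, rule Lim_null_comparison)
    show "\<forall>\<^sub>F r in at_top. norm (F r / (r + b + C) - F r / r) \<le> (2 + ?K) * (b + C) / r"
      using eventually_ge_at_top[of 1]
    proof eventually_elim
      case (elim r)
      have "F r / r - F r / (r + b + C) = (F r / r) * ((b + C) / (r + b + C))"
        using elim b C by (simp add: field_simps)
      moreover have "0 \<le> (F r / r) * ((b + C) / (r + b + C))" 
        using bnd[OF elim] elim b C by (intro mult_nonneg_nonneg[of "F r / r"] divide_nonneg_nonneg[of "b + C"]) auto
      moreover have "(F r / r) * ((b + C) / (r + b + C)) \<le> (2 + ?K) * ((b + C) / r)"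
        using bnd[OF elim] elim b C by (intro mult_mono divide_left_mono) auto
      ultimately show ?case by simp
    qed
    show "((\<lambda>r. (2 + ?K) * (b + C) / r) \<longlongrightarrow> 0) at_top"
      by (rule tendsto_divide_0[OF tendsto_const]) (simp add: filterlim_at_top_imp_at_infinity filterlim_ident)
  qed
  have hi: "Liminf at_top (\<lambda>r. ereal ((F r + 1) / (r - b))) = \<Lambda>"
    unfolding \<Lambda>_def
  proof (rule Liminf_ereal_eq, rule Lim_null_comparison)
    show "\<forall>\<^sub>F r in at_top. norm ((F r + 1) / (r - b) - F r / r) \<le> (1 + (2 + ?K) * b) / (r - b)"
      using eventually_ge_at_top[of "b + 1"]
    proof eventually_elim
      case (elim r)
      then have r: "1 \<le> r" "0 < r - b" using b by auto
      have "(F r + 1) / (r - b) - F r / r = (1 + (F r / r) * b) / (r - b)"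
        using r by (simp add: field_simps)
      moreover have "0 \<le> (1 + (F r / r) * b) / (r - b)" 
        using bnd[OF r(1)] r b by (intro divide_nonneg_nonneg[of "1 + (F r / r) * b"] add_nonneg_nonneg mult_nonneg_nonneg[of "F r / r"]) auto
      moreover have "(1 + (F r / r) * b) / (r - b) \<le> (1 + (2 + ?K) * b) / (r - b)"
        using bnd[OF r(1)] r b by (intro divide_right_mono add_left_mono mult_right_mono) auto
      ultimately show ?case unfolding real_norm_def by linarith
    qed
    have "filterlim (\<lambda>r::real. r - b) at_top at_top"
      using filterlim_tendsto_add_at_top[OF tendsto_const[of "-b"] filterlim_ident[of at_top]] by simp
    then show "((\<lambda>r. (1 + (2 + ?K) * b) / (r - b)) \<longlongrightarrow> 0) at_top"
      by (intro tendsto_divide_0[OF tendsto_const] filterlim_at_top_imp_at_infinity)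
  qed
  have "(\<Phi> \<longlongrightarrow> \<Lambda>) at_top"
  proof (rule order_tendstoI)
    fix y assume "y < \<Lambda>"
    then obtain y' where y': "y < y'" "y' < \<Lambda>" using dense by blast
    then have "y' < Liminf at_top (\<lambda>r. ereal (F r / (r + b + C)))" unfolding lo by simp
    from less_LiminfD[OF this] obtain \<rho>0 where \<rho>0: "\<And>r. \<rho>0 \<le> r \<Longrightarrow> y' < ereal (F r / (r + b + C))"
      unfolding eventually_at_top_linorder by auto
    have "y' \<le> \<Phi> R" if R: "\<bar>\<rho>0\<bar> + b + C + 1 \<le> R" for R
      unfolding \<Phi>_def
    proof (rule INF_greatest)
      fix x assume "x \<in> {x\<in>A. R \<le> d x}"
      then have x: "x \<in> A" "R \<le> d x" by auto
      have dp: "0 < d x" using x R b C by linarith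
      have dle: "d x \<le> \<rho> x + b + C" using d(2)[OF x(1)] \<rho>[OF x(1)] b by linarith
      then have "\<rho>0 \<le> \<rho> x" using x(2) R by linarith
      then have "y' < ereal (F (\<rho> x) / (\<rho> x + b + C))" by (rule \<rho>0)
      also have "F (\<rho> x) / (\<rho> x + b + C) \<le> F (\<rho> x) / d x"
        using F(1)[OF \<rho>[OF x(1)]] dp dle by (intro divide_left_mono) auto
      also have "\<dots> \<le> \<delta> x / d x" using lower[OF x(1)] dp by (intro divide_right_mono) auto
      finally show "y' \<le> ereal (\<delta> x / d x)" by simp
    qed
    then show "\<forall>\<^sub>F R in at_top. y < \<Phi> R"
      unfolding eventually_at_top_linorder using y'(1) less_le_trans by blast
  next
    fix y assume y: "\<Lambda> < y"
    have "\<Phi> R < y" for R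
    proof -
      have "\<not> y \<le> Liminf at_top (\<lambda>r. ereal ((F r + 1) / (r - b)))" unfolding hi using y by simp
      then have "\<not> (\<forall>\<^sub>F r in at_top. y \<le> ereal ((F r + 1) / (r - b)))" by (rule contrapos_nn) (rule Liminf_bounded)
      then have "\<not> (\<forall>r\<ge>\<bar>R\<bar> + b + 1. y \<le> ereal ((F r + 1) / (r - b)))"
        unfolding eventually_at_top_linorder by blast
      then obtain r where r: "\<bar>R\<bar> + b + 1 \<le> r" "ereal ((F r + 1) / (r - b)) < y" by (auto simp: not_le)
      then have rp: "0 < r" "0 < r - b" using b by auto
      obtain x where x: "x \<in> A" "\<rho> x = r" "\<delta> x \<le> F r + 1" using upper[OF rp(1)] by blast
      have dx: "r - b \<le> d x" using d(1)[OF x(1)] x(2) by linarith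
      then have "R \<le> d x" using r(1) by linarith
      then have "\<Phi> R \<le> ereal (\<delta> x / d x)" unfolding \<Phi>_def using x(1) by (intro INF_lower) auto
      also have "\<delta> x / d x \<le> (F r + 1) / (r - b)"
        using x(3) dx rp F(1)[of r] by (intro frac_le) auto
      finally show ?thesis using r(2) by simp
    qed
    then show "\<forall>\<^sub>F R in at_top. \<Phi> R < y" by simp
  qed
  then show ?thesis unfolding \<Phi>_def \<Lambda>_def .
qed

theorem theorem6p6:
  fixes N :: "('n, 'e::real_inner) riem" and M :: "('m, 'd::real_inner) riem"
    and f h :: "real \<Rightarrow> real"
    and TN :: "'c topology" and p :: "'c \<Rightarrow> 'n"
    and TX :: "'x topology" and q :: "'x \<Rightarrow> real \<times> 'n \<times> 'm option"
    and x0 :: "real \<times> 'n \<times> 'm option"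
    and g :: "'x \<Rightarrow> 'x" and \<gamma> :: "'c \<Rightarrow> 'c"
  assumes N: "riemannian_manifold N" "compact_space (rtop N)" "connected_space (rtop N)"
    and M: "riemannian_manifold M" "compact_space (rtop M)" "connected_space (rtop M)"
    and f: "smooth_on {0..} f" "(f has_real_derivative 0) (at 0 within {0..})" "f 0 > 0"
      "\<And>r. r > 0 \<Longrightarrow> f r > 0"
    and h: "smooth_on {0..} h" "(h has_real_derivative 0) (at 0 within {0..}) \<or> h 0 = 0"
      "\<And>r. r > 0 \<Longrightarrow> h r > 0"
    and collapsed: "simply_connected_space (rtop M) \<or> h 0 = 0"
    and coverN: "universal_cover TN (rtop N) p"
    and coverX: "universal_cover TX (dw_top h (rtop N) (rtop M)) q"
    and x0: "x0 \<in> topspace (dw_top h (rtop N) (rtop M))"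
    and g: "g \<in> deck TX q"
    and \<gamma>: "\<gamma> \<in> deck TN p" "induced_on_deck TX q TN p (\<lambda>(r, y, z). y) g \<gamma>"
  shows "rescaled_length f h N M TX q x0 g =
         Liminf at_top (\<lambda>r. ereal (geodesic_length f r (deck_length N TN p \<gamma>) / r))"
proof -
  note compact_connected = N(2,3) M(2,3)
  have fc: "continuous_on {0..} f" and hc: "continuous_on {0..} h"
    using f(1) h(1) by (auto intro: smooth_on_continuous)
  have fpos: "0 < f r" if "0 \<le> r" for r using f(3) f(4)[of r] that by (cases "r = 0") auto
  interpret warped_covers N M f h TN p TX q g \<gamma>
    by unfold_locales
      (use N M fc fpos hc coverN coverX collapsed g \<gamma> in \<open>auto simp: universal_cover_def\<close>)
  have geo: "geodesic_length f r d = plane_dist f (r, 0) (r, d)" for r d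
    by (rule geodesic_length_eq[OF fc]) (rule fpos)
  let ?F = "\<lambda>r. plane_dist f (r, 0) (r, L)"
  obtain C where C: "0 \<le> C" "\<forall>x\<in>topspace X.
     \<bar>fst x - fst x0\<bar> \<le> dw_dist f h N M x x0 \<and> dw_dist f h N M x x0 \<le> \<bar>fst x - fst x0\<bar> + C"
    using dw_dist_bounds[OF compact_connected x0] by (elim exE conjE)
  have r0: "0 \<le> fst x" if "x \<in> topspace X" for x
    using that unfolding topspace_dw by (auto simp: collapse_def)
  have "((\<lambda>R. INF x\<in>{x\<in>topspace TX. R \<le> dw_dist f h N M (q x) x0}.
       ereal (dw_cover_dist f h N M TX q (g x) x / dw_dist f h N M (q x) x0))
     \<longlongrightarrow> Liminf at_top (\<lambda>r. ereal (?F r / r))) at_top"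
  proof (rule limit_of_infima[where \<rho>="\<lambda>x. fst (q x)" and b="fst x0" and C=C and K="f 0 * \<bar>L\<bar>"])
    show "0 \<le> ?F r" for r by (rule plane_dist_nonneg[OF fc fpos])
    show "?F r \<le> 2 * r + f 0 * \<bar>L\<bar>" if "0 \<le> r" for r by (rule plane_dist_across[OF fc fpos that])
    show "0 \<le> fst x0" by (rule r0[OF x0])
    show "0 \<le> C" by (rule C(1))
    fix x assume x: "x \<in> topspace TX"
    show "0 \<le> fst (q x)" by (rule r0[OF q_in[OF x]])
    show "\<bar>fst (q x) - fst x0\<bar> \<le> dw_dist f h N M (q x) x0"
      "dw_dist f h N M (q x) x0 \<le> \<bar>fst (q x) - fst x0\<bar> + C" using C(2) q_in[OF x] by auto
    show "?F (fst (q x)) \<le> dw_cover_dist f h N M TX q (g x) x" by (rule displacement_ge[OF x])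
  next
    show "\<exists>x\<in>topspace TX. fst (q x) = r \<and> dw_cover_dist f h N M TX q (g x) x \<le> ?F r + 1" if "0 < r" for r
      by (rule displacement_le[OF that])
  qed
  from tendsto_Lim[OF _ this] show ?thesis
    unfolding rescaled_length_def geo by simp
qed

end
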